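(* Let $p\in(0,1)$, $\beta\in\mathbb{R}$ and $n\ge1$ be fixed, let $\theta=0$ and $\alpha=\frac{k}{3^n}$ with $k\in\{1,\dots,3^n-1\}$. There exists a polynomial $R_{p,\beta,\frac{k}{3^n},0}$ of degree $3^n$ such that $$\sigma\Big(H_{p,\beta,\frac{k}{3^n},0}\Big)=R^{-1}_{p,\beta,\frac{k}{3^n},0}\big(\sigma(\Delta_p)\big).$$ Moreover, $H_{p,\beta,\frac{k}{3^n},0}$ has purely singularly continuous spectrum if $p\ne\frac12$.
   Context: For $x\in\mathbb{Z}_+\setminus\{0\}$ let $m(x)$ be the largest integer $m\ge0$ with $3^m\mid x$. Set $p(0,1)=1$, and for $x\ge1$: $p(x,x-1)=1-p,\ p(x,x+1)=p$ if $3^{-m(x)}x\equiv1\pmod3$, and $p(x,x-1)=p,\ p(x,x+1)=1-p$ if $3^{-m(x)}x\equiv2\pmod3$. The self-similar Laplacian is $(\Delta_pf)(0)=f(0)-f(1)$ and $(\Delta_pf)(x)=f(x)-p(x,x-1)f(x-1)-p(x,x+1)f(x+1)$ for $x\ge1$. The self-similar almost Mathieu operator is $(H_{p,\beta,\alpha,\theta}f)(0)=\beta\cos(\theta)f(0)-f(1)$ and $(H_{p,\beta,\alpha,\theta}f)(x)=\beta\cos(2\pi\alpha x+\theta)f(x)-p(x,x-1)f(x-1)-p(x,x+1)f(x+1)$ for $x\ge1$. Both are considered as bounded self-adjoint operators on $\ell^2(\mathbb{Z}_+,d\pi)=\{\psi:\sum_x|\psi(x)|^2\pi(x)<\infty\}$,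 where $\pi$ is a positive measure on $\mathbb{Z}_+$ satisfying the reversibility condition $\pi(x)p(x,y)=\pi(y)p(y,x)$. For a polynomial $R$, $R^{-1}(A)=\{z\in\mathbb{C}:R(z)\in A\}$. *)

theory Defs
  imports "HOL-Probability.Probability" "HOL-Computational_Algebra.Polynomial"
    "HOL-Computational_Algebra.Factorial_Ring"
begin

definition trans_prob :: "real \<Rightarrow> nat \<Rightarrow> nat \<Rightarrow> real" where
  "trans_prob p x y =
     (if x = 0 then (if y = 1 then 1 else 0)
      else (let r = (x div 3 ^ multiplicity (3::nat) x) mod 3 in
            if y = x + 1 then (if r = 1 then p else 1 - p)
            else if y + 1 = x then (if r = 1 then 1 - p else p)
            else 0))"

definition jacobi_op :: "real \<Rightarrow> (nat \<Rightarrow> real) \<Rightarrow> (nat \<Rightarrow> complex) \<Rightarrow> nat \<Rightarrow> complex" where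
  "jacobi_op p V f x =
     complex_of_real (V x) * f x
     - (if x = 0 then 0 else complex_of_real (trans_prob p x (x - 1)) * f (x - 1))
     - complex_of_real (trans_prob p x (x + 1)) * f (x + 1)"

definition ss_laplacian :: "real \<Rightarrow> (nat \<Rightarrow> complex) \<Rightarrow> nat \<Rightarrow> complex" where
  "ss_laplacian p = jacobi_op p (\<lambda>x. 1)"

definition ss_amo :: "real \<Rightarrow> real \<Rightarrow> real \<Rightarrow> real \<Rightarrow> (nat \<Rightarrow> complex) \<Rightarrow> nat \<Rightarrow> complex" where
  "ss_amo p \<beta> \<alpha> \<theta> = jacobi_op p (\<lambda>x. \<beta> * cos (2 * pi * \<alpha> * real x + \<theta>))"

definition ell2w :: "(nat \<Rightarrow> real) \<Rightarrow> (nat \<Rightarrow> complex) set" where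
  "ell2w \<pi> = {f. summable (\<lambda>x. (cmod (f x))\<^sup>2 * \<pi> x)}"

definition norm2w :: "(nat \<Rightarrow> real) \<Rightarrow> (nat \<Rightarrow> complex) \<Rightarrow> real" where
  "norm2w \<pi> f = sqrt (\<Sum>x. (cmod (f x))\<^sup>2 * \<pi> x)"

definition inner2w :: "(nat \<Rightarrow> real) \<Rightarrow> (nat \<Rightarrow> complex) \<Rightarrow> (nat \<Rightarrow> complex) \<Rightarrow> complex" where
  "inner2w \<pi> f g = (\<Sum>x. cnj (f x) * g x * complex_of_real (\<pi> x))"

definition in_resolvent_set :: "(nat \<Rightarrow> real) \<Rightarrow> ((nat \<Rightarrow> complex) \<Rightarrow> nat \<Rightarrow> complex) \<Rightarrow> complex \<Rightarrow> bool" where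
  "in_resolvent_set \<pi> H z \<longleftrightarrow>
     (\<exists>G. (\<forall>f\<in>ell2w \<pi>. G f \<in> ell2w \<pi>)
        \<and> (\<exists>C. \<forall>f\<in>ell2w \<pi>. norm2w \<pi> (G f) \<le> C * norm2w \<pi> f)
        \<and> (\<forall>f\<in>ell2w \<pi>. (\<lambda>x. H (G f) x - z * G f x) = f)
        \<and> (\<forall>f\<in>ell2w \<pi>. G (\<lambda>x. H f x - z * f x) = f))"

definition op_spectrum :: "(nat \<Rightarrow> real) \<Rightarrow> ((nat \<Rightarrow> complex) \<Rightarrow> nat \<Rightarrow> complex) \<Rightarrow> complex set" where
  "op_spectrum \<pi> H = {z. \<not> in_resolvent_set \<pi> H z}"

text \<open>Spectral measure of a bounded self-adjoint H at the vector \<psi>: the (unique, compactly supported)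
  finite Borel measure on the reals whose moments are <\<psi>, H^k \<psi>>.\<close>
definition is_spectral_measure ::
  "(nat \<Rightarrow> real) \<Rightarrow> ((nat \<Rightarrow> complex) \<Rightarrow> nat \<Rightarrow> complex) \<Rightarrow> (nat \<Rightarrow> complex) \<Rightarrow> real measure \<Rightarrow> bool" where
  "is_spectral_measure \<pi> H \<psi> \<mu> \<longleftrightarrow>
     finite_measure \<mu> \<and> sets \<mu> = sets borel \<and>
     (\<forall>k::nat. integrable \<mu> (\<lambda>t. t ^ k) \<and>
        complex_of_real (\<integral>t. t ^ k \<partial>\<mu>) = inner2w \<pi> \<psi> ((H ^^ k) \<psi>))"

definition purely_sc_spectrum :: "(nat \<Rightarrow> real) \<Rightarrow> ((nat \<Rightarrow> complex) \<Rightarrow> nat \<Rightarrow> complex) \<Rightarrow> bool" where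
  "purely_sc_spectrum \<pi> H \<longleftrightarrow>
     (\<forall>\<psi>\<in>ell2w \<pi>. \<forall>\<mu>. is_spectral_measure \<pi> H \<psi> \<mu> \<longrightarrow>
        (\<forall>t. emeasure \<mu> {t} = 0) \<and>
        (\<exists>N\<in>sets borel. emeasure lborel N = 0 \<and> emeasure \<mu> (UNIV - N) = 0))"

end

theory Submission
  imports Defs
begin

text \<open>
  Put \<open>L = 3\<^sup>n\<close>. The potential and the transition probabilities inside the blocks \<open>[Lq, L(q+1)]\<close>
  do not depend on \<open>q\<close> and are symmetric under reflection of the block, while at the points \<open>Lq\<close>
  the walk behaves as the original one does at \<open>q\<close>. Let \<open>S\<close> be the solution on a block with
  \<open>S 0 = 0\<close>, \<open>S 1 = 1\<close>. Eliminating the interior of the blocks turns \<open>H - z\<close> into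
  \<open>(\<Delta> - R z) / S L\<close> with \<open>R z = 1 - ((V 0 - z) S L - S (L - 1))\<close>, a polynomial of degree \<open>L\<close> in \<open>z\<close>;
  so the resolvents of \<open>H\<close> at \<open>z\<close> and of \<open>\<Delta>\<close> at \<open>R z\<close> are built from each other when \<open>S L \<noteq> 0\<close>.
  If \<open>S L = 0\<close> then \<open>R z\<close> is 0 or 2, both in the spectrum of \<open>\<Delta>\<close>, and gluing multiples of \<open>S\<close> gives
  an approximate eigenvector of \<open>H\<close>.

  An \<open>\<ell>\<^sup>2\<close> eigenvector of \<open>H\<close> restricts to one of \<open>\<Delta>\<close>, and decimating \<open>\<Delta>\<close> by \<open>3\<^sup>m\<close> ties its values
  at \<open>3\<^sup>m\<close> and \<open>2 \<cdot> 3\<^sup>m\<close> by a quadratic relation that forbids both from tending to 0; hence there are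
  no atoms. Decimation by 3 makes the spectrum of \<open>\<Delta>\<close> invariant under a cubic which, in the metric
  \<open>dy / sqrt (1 - y\<^sup>2)\<close>, expands on each of its three branches by a factor larger than 3 if \<open>p \<noteq> 1/2\<close>.
  The spectrum of \<open>\<Delta>\<close> and its polynomial preimage are therefore Lebesgue null, and they carry all
  spectral measures.
\<close>

section \<open>Transition probabilities and the reversible weight\<close>

text \<open>For positive \<open>x\<close> this is the last nonzero ternary digit, which selects one
  of the two transition laws.\<close>

definition res3 :: "nat \<Rightarrow> nat" where
  "res3 x = (x div 3 ^ multiplicity (3::nat) x) mod 3"

lemma res3_triple [simp]: "x > 0 \<Longrightarrow> res3 (3 * x) = res3 x"
  by (simp add: res3_def multiplicity_times_same)

lemma res3_not_dvd: "\<not> 3 dvd x \<Longrightarrow> res3 x = x mod 3"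
  by (simp add: res3_def not_dvd_imp_multiplicity_0)

lemma res3_cases:
  assumes "x > 0" shows "res3 x = 1 \<or> res3 x = 2"
proof -
  have "\<not> 3 dvd (x div 3 ^ multiplicity (3::nat) x)"
    using multiplicity_decompose[of x "3::nat"] assms by auto
  then have "res3 x \<noteq> 0" "res3 x < 3" by (auto simp: res3_def dvd_eq_mod_eq_0)
  then show ?thesis by linarith
qed

lemma res3_scale [simp]: "q > 0 \<Longrightarrow> res3 (3 ^ n * q) = res3 q"
proof (induction n)
  case (Suc n)
  then show ?case using res3_triple[of "3 ^ n * q"] by (simp add: mult.assoc)
qed simp

text \<open>Adding a multiple of \<open>3 ^ n\<close> leaves the lowest \<open>n\<close> ternary
  digits alone, and for \<open>0 < j < 3 ^ n\<close> the last nonzero digit is among them. Hence all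
  blocks look alike inside.\<close>

lemma res3_block:
  "0 < j \<Longrightarrow> j < 3 ^ n \<Longrightarrow> res3 (3 ^ n * q + j) = res3 j"
proof (induction n arbitrary: j)
  case (Suc n)
  show ?case
  proof (cases "3 dvd j")
    case True
    then obtain i where i: "j = 3 * i" by (auto elim: dvdE)
    have e: "3 ^ Suc n * q + j = 3 * (3 ^ n * q + i)" by (simp add: i)
    have "0 < i" "i < 3 ^ n" using Suc.prems i by auto
    then show ?thesis unfolding e using i res3_triple[of i] res3_triple[of "3 ^ n * q + i"] Suc.IH[of i]
      by (metis add_gr_0)
  next
    case False
    moreover have "\<not> 3 dvd (3 ^ Suc n * q + j)"
      using False by (metis dvd_add_right_iff dvd_mult2 dvd_power_same dvd_triv_left power_Suc)
    moreover have "(3 ^ Suc n * q + j) mod 3 = j mod 3"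
      by (metis mod_mult_self4 mult.assoc power_Suc)
    ultimately show ?thesis by (simp add: res3_not_dvd)
  qed
qed simp

text \<open>The power of 3 in \<open>j\<close> is lower than \<open>3 ^ n\<close>. After dividing it
  out, the difference is congruent to minus the digit of \<open>j\<close>, and negation modulo 3
  exchanges 1 and 2.\<close>

lemma res3_reflect:
  "0 < j \<Longrightarrow> j < 3 ^ n \<Longrightarrow> res3 (3 ^ n - j) = 3 - res3 j"
proof (induction n arbitrary: j)
  case (Suc n)
  show ?case
  proof (cases "3 dvd j")
    case True
    then obtain i where i: "j = 3 * i" by (auto elim: dvdE)
    have e: "3 ^ Suc n - j = 3 * (3 ^ n - i)" by (simp add: i diff_mult_distrib2)
    have i': "0 < i" "i < 3 ^ n" using Suc.prems i by auto
    then show ?thesis unfolding e using i res3_triple[of i] res3_triple[of "3 ^ n - i"] Suc.IH[of i]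
      by (metis zero_less_diff)
  next
    case False
    have nd: "\<not> 3 dvd (3 ^ Suc n - j)"
      using False Suc.prems by (metis dvd_diffD1 dvd_triv_left less_imp_le_nat power_Suc)
    define a r where "a = j div 3" and "r = j mod 3"
    have j: "j = 3 * a + r" by (simp add: a_def r_def)
    have r: "0 < r" "r < 3" using False by (auto simp: r_def dvd_eq_mod_eq_0)
    have "3 * a + r < 3 * 3 ^ n" using Suc.prems j by simp
    then have "3 ^ Suc n - j = (3 - r) + 3 * (3 ^ n - a - 1)" using r j by simp
    then have "(3 ^ Suc n - j) mod 3 = (3 - r) mod 3" by (metis mod_mult_self2)
    then have "(3 ^ Suc n - j) mod 3 = 3 - j mod 3" using r by (simp add: r_def)
    then show ?thesis unfolding res3_not_dvd[OF nd] res3_not_dvd[OF False] .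
  qed
qed simp

locale ss_walk =
  fixes p :: real and \<pi> :: "nat \<Rightarrow> real"
  assumes p_pos: "0 < p" and p_less_1: "p < 1" and weight_pos: "\<And>x. \<pi> x > 0"
    and reversible: "\<And>x y. \<pi> x * trans_prob p x y = \<pi> y * trans_prob p y x"
begin

definition up :: "nat \<Rightarrow> real" where "up x = trans_prob p x (x + 1)"
definition down :: "nat \<Rightarrow> real" where "down x = trans_prob p x (x - 1)"

lemma up_0 [simp]: "up 0 = 1"
  by (simp add: up_def trans_prob_def)

lemma up_eq: "x > 0 \<Longrightarrow> up x = (if res3 x = 1 then p else 1 - p)"
  by (simp add: up_def trans_prob_def res3_def Let_def)

lemma down_eq: "x > 0 \<Longrightarrow> down x = (if res3 x = 1 then 1 - p else p)"
  by (simp add: down_def trans_prob_def res3_def Let_def)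

lemma up_pos [simp]: "up x > 0"
  using p_pos p_less_1 by (cases "x = 0") (auto simp: up_eq)

lemma up_nonzero [simp]: "up x \<noteq> 0"
  using up_pos[of x] by linarith

lemma down_pos: "x > 0 \<Longrightarrow> down x > 0"
  using p_pos p_less_1 by (auto simp: down_eq)

lemma up_le_1: "up x \<le> 1"
  using p_pos p_less_1 by (cases "x = 0") (auto simp: up_eq)

lemma down_le_1: "x > 0 \<Longrightarrow> down x \<le> 1"
  using p_pos p_less_1 by (auto simp: down_eq)

lemma up_plus_down: "x > 0 \<Longrightarrow> up x + down x = 1"
  by (simp add: up_eq down_eq)

lemma up_scale [simp]: "up (3 ^ n * q) = up q"
  by (cases "q = 0") (auto simp: up_eq)

lemma down_scale [simp]: "q > 0 \<Longrightarrow> down (3 ^ n * q) = down q"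
  by (auto simp: down_eq)

lemma up_block: "0 < j \<Longrightarrow> j < 3 ^ n \<Longrightarrow> up (3 ^ n * q + j) = up j"
  by (auto simp: up_eq res3_block)

lemma down_block: "0 < j \<Longrightarrow> j < 3 ^ n \<Longrightarrow> down (3 ^ n * q + j) = down j"
  by (auto simp: down_eq res3_block)

text \<open>Reflection exchanges the digits 1 and 2 and also the two directions of a step, so the
  walk inside a block is reflection invariant.\<close>

lemma up_reflect: "0 < j \<Longrightarrow> j < 3 ^ n \<Longrightarrow> up (3 ^ n - j) = down j"
  using res3_cases[of j] by (auto simp: up_eq down_eq res3_reflect)

lemma down_reflect: "0 < j \<Longrightarrow> j < 3 ^ n \<Longrightarrow> down (3 ^ n - j) = up j"
  using res3_cases[of j] by (auto simp: up_eq down_eq res3_reflect)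

lemma balance: "\<pi> x * up x = \<pi> (Suc x) * down (Suc x)"
  using reversible[of x "Suc x"] by (simp add: up_def down_def)

text \<open>The middle one of the three edges above an original edge is crossed with probability
  \<open>p\<close> from both ends, so its ends have equal weight. The two outer edges then have the
  same conductance, and balance on the original edge carries the identity from \<open>x\<close> to
  \<open>Suc x\<close>.\<close>

lemma weight_triple: "\<pi> (3 * x) = \<pi> x"
proof (induction x)
  case (Suc x)
  have r: "res3 (Suc (3 * x)) = 1" "res3 (Suc (Suc (3 * x))) = 2"
    by (subst res3_not_dvd; presburger)+
  have u: "up (3 * x) = up x" using up_scale[of 1 x] by simp
  have e: "3 * Suc x = Suc (Suc (Suc (3 * x)))" by simp
  have d: "down (Suc (Suc (Suc (3 * x)))) = down (Suc x)"
    using down_scale[of "Suc x" 1] unfolding power_one_right e by simp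
  have 1: "\<pi> (3 * x) * up x = \<pi> (Suc (3 * x)) * (1 - p)"
    using balance[of "3 * x"] by (simp add: down_eq r u)
  have 2: "\<pi> (Suc (3 * x)) * p = \<pi> (Suc (Suc (3 * x))) * p"
    using balance[of "Suc (3 * x)"] by (simp add: up_eq down_eq r)
  have 3: "\<pi> (Suc (Suc (3 * x))) * (1 - p) = \<pi> (3 * Suc x) * down (Suc x)"
    using balance[of "Suc (Suc (3 * x))"] by (simp only: e d up_eq[OF zero_less_Suc] r) simp
  have "\<pi> (Suc (3 * x)) = \<pi> (Suc (Suc (3 * x)))" using 2 p_pos by simp
  then have "\<pi> (3 * Suc x) * down (Suc x) = \<pi> (Suc x) * down (Suc x)"
    using 1 3 Suc balance[of x] by metis
  then show ?case using down_pos[of "Suc x"] by (metis less_numeral_extra(3) mult_right_cancel zero_less_Suc)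
qed simp

lemma weight_scale [simp]: "\<pi> (3 ^ n * x) = \<pi> x"
proof (induction n)
  case (Suc n)
  then show ?case using weight_triple[of "3 ^ n * x"] by (simp add: mult.assoc)
qed simp

lemma weight_power [simp]: "\<pi> (3 ^ n) = \<pi> 1"
  using weight_scale[of n 1] by simp

lemma res3_1: "res3 (Suc 0) = 1" and res3_2: "res3 2 = 2"
  by (simp_all add: res3_not_dvd)

text \<open>The edge into \<open>3 ^ m\<close> has the conductance of the very first edge. This
  normalises the Wronskian on a block and the amplitudes of glued solutions.\<close>

lemma conductance_power: "\<pi> (3 ^ m - 1) * up (3 ^ m - 1) = \<pi> 0"
proof -
  have "\<pi> (3 ^ m - 1) * up (3 ^ m - 1) = \<pi> (3 ^ m) * down (3 ^ m)"
    using balance[of "3 ^ m - 1"] by simp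
  also have "\<dots> = \<pi> 1 * down 1" using down_scale[of 1 m] by simp
  also have "\<dots> = \<pi> 0" using balance[of 0] by simp
  finally show ?thesis .
qed

text \<open>Bounds the quotient of neighbouring weights, because every probability along an edge
  lies between \<open>min p (1 - p)\<close> and 1.\<close>

definition ratio :: real where "ratio = 1 / min p (1 - p)"

lemma ratio_ge_1: "ratio \<ge> 1"
  using p_pos p_less_1 by (auto simp: ratio_def min_def field_simps)

lemma weight_step: "\<pi> x \<le> ratio * \<pi> (Suc x)" "\<pi> (Suc x) \<le> ratio * \<pi> x"
proof -
  define m where "m = min p (1 - p)"
  have m: "m > 0" "m \<le> up x" "m \<le> down (Suc x)"
    using p_pos p_less_1 by (auto simp: m_def up_eq down_eq)
      (cases "x = 0", auto simp: up_eq)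
  have "\<pi> x * m \<le> \<pi> x * up x" "\<pi> (Suc x) * m \<le> \<pi> (Suc x) * down (Suc x)"
    using m weight_pos by (auto intro!: mult_left_mono simp: less_imp_le)
  moreover have "\<pi> x * up x \<le> \<pi> x * 1" "\<pi> (Suc x) * down (Suc x) \<le> \<pi> (Suc x) * 1"
    using weight_pos up_le_1 down_le_1 by (auto intro!: mult_left_mono simp: less_imp_le)
  ultimately show "\<pi> x \<le> ratio * \<pi> (Suc x)" "\<pi> (Suc x) \<le> ratio * \<pi> x"
    using m balance[of x] by (simp_all add: ratio_def m_def[symmetric] field_simps)
qed

lemma weight_shift: "\<pi> x \<le> ratio ^ d * \<pi> (x + d)" "\<pi> (x + d) \<le> ratio ^ d * \<pi> x"
proof (induction d)
  case (Suc d)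
  have r: "0 \<le> ratio" "0 \<le> ratio ^ d" using ratio_ge_1 by auto
  {
    case 1
    have "\<pi> x \<le> ratio ^ d * \<pi> (x + d)" by (rule Suc)
    also have "\<dots> \<le> ratio ^ d * (ratio * \<pi> (Suc (x + d)))"
      using r weight_step(1) by (intro mult_left_mono) auto
    finally show ?case by (simp add: ac_simps)
  next
    case 2
    have "\<pi> (Suc (x + d)) \<le> ratio * \<pi> (x + d)" by (rule weight_step)
    also have "\<dots> \<le> ratio * (ratio ^ d * \<pi> x)"
      using r Suc by (intro mult_left_mono) auto
    finally show ?case by (simp add: ac_simps)
  }
qed auto

lemma weight_near:
  assumes "y \<le> x + d" "x \<le> y + d"
  shows "\<pi> x \<le> ratio ^ d * \<pi> y"
proof -
  obtain e where e: "e \<le> d" "x = y + e \<or> y = x + e"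
    using assms by (metis le_Suc_ex nat_add_left_cancel_le nat_le_linear)
  then have "\<pi> x \<le> ratio ^ e * \<pi> y" using weight_shift by auto
  also have "\<dots> \<le> ratio ^ d * \<pi> y"
    using e ratio_ge_1 weight_pos[of y] by (intro mult_right_mono power_increasing) auto
  finally show ?thesis .
qed

end

section \<open>The weighted space\<close>

context ss_walk
begin

abbreviation ell2 :: "(nat \<Rightarrow> complex) set" where "ell2 \<equiv> ell2w \<pi>"

text \<open>The squared norm keeps the estimates free of square roots. Its value is meaningful for
  members of \<open>ell2\<close> only.\<close>

definition N2 :: "(nat \<Rightarrow> complex) \<Rightarrow> real" where
  "N2 f = (\<Sum>x. (cmod (f x))\<^sup>2 * \<pi> x)"

lemma term_nonneg [simp]: "0 \<le> (cmod z)\<^sup>2 * \<pi> x"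
  using weight_pos[of x] by simp

lemma norm2w_eq: "norm2w \<pi> f = sqrt (N2 f)"
  by (simp add: norm2w_def N2_def)

lemma ell2_bounded_partial_sums:
  assumes "\<And>N. (\<Sum>x<N. (cmod (f x))\<^sup>2 * \<pi> x) \<le> B"
  shows "f \<in> ell2" "N2 f \<le> B"
proof -
  have s: "summable (\<lambda>x. (cmod (f x))\<^sup>2 * \<pi> x)"
    by (rule summableI_nonneg_bounded[of _ B]) (use assms in auto)
  then show "f \<in> ell2" by (simp add: ell2w_def)
  show "N2 f \<le> B" unfolding N2_def by (rule suminf_le_const[OF s]) (use assms in auto)
qed

lemma N2_partial_sum:
  assumes "f \<in> ell2" "finite I"
  shows "(\<Sum>x\<in>I. (cmod (f x))\<^sup>2 * \<pi> x) \<le> N2 f"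
  unfolding N2_def using assms by (intro sum_le_suminf) (auto simp: ell2w_def)

lemma N2_point: "f \<in> ell2 \<Longrightarrow> (cmod (f x))\<^sup>2 * \<pi> x \<le> N2 f"
  using N2_partial_sum[of f "{x}"] by simp

lemma N2_nonneg: "f \<in> ell2 \<Longrightarrow> 0 \<le> N2 f"
  using N2_partial_sum[of f "{}"] by simp

lemma N2_eq_0_iff: "f \<in> ell2 \<Longrightarrow> N2 f = 0 \<longleftrightarrow> f = (\<lambda>x. 0)"
  using N2_point[of f] weight_pos
  by (auto simp: fun_eq_iff N2_def)
     (metis less_numeral_extra(3) mult_eq_0_iff norm_eq_zero order_antisym_conv power_eq_0_iff term_nonneg)

lemma ell2_finite_support: "(\<And>x. x \<ge> N \<Longrightarrow> f x = 0) \<Longrightarrow> f \<in> ell2"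
  unfolding ell2w_def using summable_finite[of "{..<N}" "\<lambda>x. (cmod (f x))\<^sup>2 * \<pi> x"]
  by (auto simp: not_less)

lemma ell2_zero [simp]: "(\<lambda>x. 0) \<in> ell2" and N2_zero [simp]: "N2 (\<lambda>x. 0) = 0"
  by (auto simp: ell2w_def N2_def)

text \<open>Cauchy-Schwarz on a window gives one factor \<open>2 * d + 1\<close>. Exchanging the
  sums gives the other, since each \<open>y\<close> lies in at most that many windows. Moving the
  weight from \<open>x\<close> to \<open>y\<close> costs \<open>ratio ^ d\<close>.\<close>

lemma near_bound:
  assumes f: "f \<in> ell2"
    and g: "\<And>x. cmod (g x) \<le> K * (\<Sum>y\<in>{x-d..x+d}. cmod (f y))"
  shows "g \<in> ell2" "N2 g \<le> K\<^sup>2 * (real (2 * d + 1))\<^sup>2 * ratio ^ d * N2 f"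
proof -
  have pt: "(cmod (g x))\<^sup>2 * \<pi> x
      \<le> K\<^sup>2 * real (2 * d + 1) * ratio ^ d * (\<Sum>y\<in>{x-d..x+d}. (cmod (f y))\<^sup>2 * \<pi> y)" for x
  proof -
    have card: "real (card {x-d..x+d}) \<le> 2 * d + 1" by auto
    have "(cmod (g x))\<^sup>2 \<le> (K * (\<Sum>y\<in>{x-d..x+d}. cmod (f y)))\<^sup>2"
      by (intro power_mono g) auto
    also have "\<dots> = K\<^sup>2 * (\<Sum>y\<in>{x-d..x+d}. 1 * cmod (f y))\<^sup>2" by (simp add: power_mult_distrib)
    also have "\<dots> \<le> K\<^sup>2 * ((\<Sum>y\<in>{x-d..x+d}. 1\<^sup>2) * (\<Sum>y\<in>{x-d..x+d}. (cmod (f y))\<^sup>2))"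
      by (intro mult_left_mono Cauchy_Schwarz_ineq_sum) auto
    also have "\<dots> \<le> K\<^sup>2 * (real (2 * d + 1) * (\<Sum>y\<in>{x-d..x+d}. (cmod (f y))\<^sup>2))"
      using card by (intro mult_left_mono mult_right_mono) (auto intro: sum_nonneg)
    finally have "(cmod (g x))\<^sup>2 * \<pi> x
        \<le> K\<^sup>2 * real (2 * d + 1) * (\<Sum>y\<in>{x-d..x+d}. (cmod (f y))\<^sup>2) * \<pi> x"
      using weight_pos[of x] by (simp add: mult.assoc mult_right_mono)
    also have "\<dots> = K\<^sup>2 * real (2 * d + 1) * (\<Sum>y\<in>{x-d..x+d}. (cmod (f y))\<^sup>2 * \<pi> x)"
      by (simp add: sum_distrib_right mult.assoc)
    also have "\<dots> \<le> K\<^sup>2 * real (2 * d + 1) * (\<Sum>y\<in>{x-d..x+d}. (cmod (f y))\<^sup>2 * (ratio ^ d * \<pi> y))"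
      by (intro mult_left_mono sum_mono weight_near) auto
    also have "\<dots> = K\<^sup>2 * real (2 * d + 1) * ratio ^ d * (\<Sum>y\<in>{x-d..x+d}. (cmod (f y))\<^sup>2 * \<pi> y)"
      by (simp add: sum_distrib_left ac_simps)
    finally show ?thesis .
  qed
  have c: "0 \<le> K\<^sup>2 * real (2 * d + 1) * ratio ^ d" using ratio_ge_1 by simp
  have "(\<Sum>x<N. (cmod (g x))\<^sup>2 * \<pi> x) \<le> K\<^sup>2 * (real (2 * d + 1))\<^sup>2 * ratio ^ d * N2 f" for N
  proof -
    let ?F = "\<lambda>y. (cmod (f y))\<^sup>2 * \<pi> y"
    have le: "(\<Sum>x<N. (cmod (g x))\<^sup>2 * \<pi> x)
        \<le> K\<^sup>2 * real (2 * d + 1) * ratio ^ d * (\<Sum>x<N. \<Sum>y\<in>{x-d..x+d}. ?F y)"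
      unfolding sum_distrib_left[of _ _ "{..<N}"] by (intro sum_mono pt)
    have "(\<Sum>x<N. \<Sum>y\<in>{x-d..x+d}. ?F y) = (\<Sum>x<N. \<Sum>y\<in>{y\<in>{..<N+d}. x - d \<le> y \<and> y \<le> x + d}. ?F y)"
      by (intro sum.cong) auto
    also have "\<dots> = (\<Sum>y<N+d. \<Sum>x\<in>{x\<in>{..<N}. x - d \<le> y \<and> y \<le> x + d}. ?F y)"
      by (rule sum.swap_restrict) auto
    also have "\<dots> \<le> (\<Sum>y<N+d. real (2 * d + 1) * ?F y)"
    proof (intro sum_mono)
      fix y
      have "card {x\<in>{..<N}. x - d \<le> y \<and> y \<le> x + d} \<le> card {y-d..y+d}"
        by (intro card_mono) auto
      also have "\<dots> \<le> 2 * d + 1" by auto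
      finally have "real (card {x\<in>{..<N}. x - d \<le> y \<and> y \<le> x + d}) \<le> 2 * d + 1"
        by linarith
      then show "(\<Sum>x\<in>{x\<in>{..<N}. x - d \<le> y \<and> y \<le> x + d}. ?F y) \<le> real (2 * d + 1) * ?F y"
        by (simp add: mult_right_mono del: of_nat_add of_nat_mult)
    qed
    also have "\<dots> = real (2 * d + 1) * (\<Sum>y<N+d. ?F y)" by (simp add: sum_distrib_left)
    also have "\<dots> \<le> real (2 * d + 1) * N2 f"
      by (intro mult_left_mono N2_partial_sum f) auto
    finally have "(\<Sum>x<N. \<Sum>y\<in>{x-d..x+d}. ?F y) \<le> real (2 * d + 1) * N2 f" .
    from order_trans[OF le mult_left_mono[OF this c]] show ?thesis
      by (simp only: power2_eq_square mult_ac)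
  qed
  from ell2_bounded_partial_sums[OF this]
  show "g \<in> ell2" "N2 g \<le> K\<^sup>2 * (real (2 * d + 1))\<^sup>2 * ratio ^ d * N2 f" by auto
qed

lemma ell2_add:
  assumes "f \<in> ell2" "g \<in> ell2"
  shows "(\<lambda>x. f x + g x) \<in> ell2" "N2 (\<lambda>x. f x + g x) \<le> 2 * (N2 f + N2 g)"
proof -
  have pt: "(cmod (f x + g x))\<^sup>2 * \<pi> x \<le> 2 * ((cmod (f x))\<^sup>2 * \<pi> x + (cmod (g x))\<^sup>2 * \<pi> x)" for x
  proof -
    have "(cmod (f x + g x))\<^sup>2 \<le> (cmod (f x) + cmod (g x))\<^sup>2"
      by (intro power_mono norm_triangle_ineq) auto
    also have "\<dots> \<le> 2 * ((cmod (f x))\<^sup>2 + (cmod (g x))\<^sup>2)"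
      using sum_squares_bound[of "cmod (f x)" "cmod (g x)"] by (simp add: power2_sum)
    finally show ?thesis using weight_pos[of x]
      by (simp add: distrib_right[symmetric] mult.assoc[symmetric] mult_right_mono)
  qed
  have "(\<Sum>x<N. (cmod (f x + g x))\<^sup>2 * \<pi> x) \<le> 2 * (N2 f + N2 g)" for N
  proof -
    have "(\<Sum>x<N. (cmod (f x + g x))\<^sup>2 * \<pi> x)
        \<le> (\<Sum>x<N. 2 * ((cmod (f x))\<^sup>2 * \<pi> x + (cmod (g x))\<^sup>2 * \<pi> x))"
      by (intro sum_mono pt)
    also have "\<dots> = 2 * ((\<Sum>x<N. (cmod (f x))\<^sup>2 * \<pi> x) + (\<Sum>x<N. (cmod (g x))\<^sup>2 * \<pi> x))"
      by (simp add: sum.distrib sum_distrib_left[symmetric])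
    also have "\<dots> \<le> 2 * (N2 f + N2 g)"
      using N2_partial_sum[OF assms(1), of "{..<N}"] N2_partial_sum[OF assms(2), of "{..<N}"]
      by simp
    finally show ?thesis .
  qed
  from ell2_bounded_partial_sums[OF this]
  show "(\<lambda>x. f x + g x) \<in> ell2" "N2 (\<lambda>x. f x + g x) \<le> 2 * (N2 f + N2 g)" by auto
qed

lemma ell2_scale:
  assumes "f \<in> ell2"
  shows "(\<lambda>x. c * f x) \<in> ell2" "N2 (\<lambda>x. c * f x) = (cmod c)\<^sup>2 * N2 f"
proof -
  have e: "(\<lambda>x. (cmod (c * f x))\<^sup>2 * \<pi> x) = (\<lambda>x. (cmod c)\<^sup>2 * ((cmod (f x))\<^sup>2 * \<pi> x))"
    by (simp add: norm_mult power_mult_distrib mult.assoc)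
  show "(\<lambda>x. c * f x) \<in> ell2"
    using assms summable_mult[of "\<lambda>x. (cmod (f x))\<^sup>2 * \<pi> x"] unfolding ell2w_def mem_Collect_eq e by blast
  show "N2 (\<lambda>x. c * f x) = (cmod c)\<^sup>2 * N2 f"
    using assms unfolding N2_def e ell2w_def mem_Collect_eq by (rule suminf_mult)
qed

lemma ell2_diff:
  assumes "f \<in> ell2" "g \<in> ell2"
  shows "(\<lambda>x. f x - g x) \<in> ell2" "N2 (\<lambda>x. f x - g x) \<le> 2 * (N2 f + N2 g)"
  using ell2_add[OF assms(1) ell2_scale(1)[OF assms(2), of "-1"]]
    ell2_scale(2)[OF assms(2), of "-1"] by auto

text \<open>The weight is invariant under scaling by \<open>3 ^ n\<close>, so the sampled sum is a
  part of the original one.\<close>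

lemma ell2_sample:
  assumes "f \<in> ell2"
  shows "(\<lambda>q. f (3 ^ n * q)) \<in> ell2" "N2 (\<lambda>q. f (3 ^ n * q)) \<le> N2 f"
proof -
  have "(\<Sum>q<N. (cmod (f (3 ^ n * q)))\<^sup>2 * \<pi> q) \<le> N2 f" for N
  proof -
    have "(\<Sum>q<N. (cmod (f (3 ^ n * q)))\<^sup>2 * \<pi> q)
        = (\<Sum>x\<in>(\<lambda>q. 3 ^ n * q) ` {..<N}. (cmod (f x))\<^sup>2 * \<pi> x)"
      by (subst sum.reindex) (auto simp: inj_on_def)
    also have "\<dots> \<le> N2 f" by (rule N2_partial_sum) (use assms in auto)
    finally show ?thesis .
  qed
  from ell2_bounded_partial_sums[OF this] show "(\<lambda>q. f (3 ^ n * q)) \<in> ell2"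
    "N2 (\<lambda>q. f (3 ^ n * q)) \<le> N2 f" by auto
qed

text \<open>The adjoint of sampling at the multiples of \<open>3 ^ n\<close>, and a right inverse of
  it.\<close>

definition spread :: "nat \<Rightarrow> (nat \<Rightarrow> complex) \<Rightarrow> nat \<Rightarrow> complex" where
  "spread n a x = (if 3 ^ n dvd x then a (x div 3 ^ n) else 0)"

lemma ell2_spread:
  assumes "a \<in> ell2"
  shows "spread n a \<in> ell2" "N2 (spread n a) \<le> N2 a"
proof -
  have "(\<Sum>x<N. (cmod (spread n a x))\<^sup>2 * \<pi> x) \<le> N2 a" for N
  proof -
    have "(\<Sum>x<N. (cmod (spread n a x))\<^sup>2 * \<pi> x)
        = (\<Sum>x\<in>{x\<in>{..<N}. 3 ^ n dvd x}. (cmod (spread n a x))\<^sup>2 * \<pi> x)"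
      by (rule sum.mono_neutral_right) (auto simp: spread_def)
    also have "\<dots> \<le> (\<Sum>x\<in>(\<lambda>q. 3 ^ n * q) ` {..<N}. (cmod (spread n a x))\<^sup>2 * \<pi> x)"
    proof (rule sum_mono2)
      have "q < N" if "3 ^ n * q < N" for q
        using that
        by (metis mult_1 mult_le_mono1 le_less_trans one_le_numeral one_le_power)
      then show "{x \<in> {..<N}. 3 ^ n dvd x} \<subseteq> (\<lambda>q. 3 ^ n * q) ` {..<N}" by (auto elim!: dvdE)
    qed auto
    also have "\<dots> = (\<Sum>q<N. (cmod (a q))\<^sup>2 * \<pi> q)"
      by (subst sum.reindex) (auto simp: inj_on_def spread_def)
    also have "\<dots> \<le> N2 a" by (rule N2_partial_sum) (use assms in auto)
    finally show ?thesis .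
  qed
  from ell2_bounded_partial_sums[OF this] show "spread n a \<in> ell2" "N2 (spread n a) \<le> N2 a" by auto
qed

text \<open>Fatou's lemma for sums: every partial sum passes to the limit.\<close>

lemma ell2_limit:
  assumes "\<And>j. u j \<in> ell2" "\<And>j. N2 (u j) \<le> B" "\<And>x. (\<lambda>j. u j x) \<longlonglongrightarrow> v x"
  shows "v \<in> ell2" "N2 v \<le> B"
proof -
  have "(\<Sum>x<N. (cmod (v x))\<^sup>2 * \<pi> x) \<le> B" for N
  proof (rule LIMSEQ_le_const2)
    show "(\<lambda>j. \<Sum>x<N. (cmod (u j x))\<^sup>2 * \<pi> x) \<longlonglongrightarrow> (\<Sum>x<N. (cmod (v x))\<^sup>2 * \<pi> x)"
      by (intro tendsto_intros assms(3))
    show "\<exists>M. \<forall>j\<ge>M. (\<Sum>x<N. (cmod (u j x))\<^sup>2 * \<pi> x) \<le> B"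
      using N2_partial_sum[OF assms(1)] assms(2) by (meson finite_lessThan order_trans)
  qed
  from ell2_bounded_partial_sums[OF this] show "v \<in> ell2" "N2 v \<le> B" by auto
qed

end

section \<open>Decimation\<close>

context ss_walk
begin

definition shifted :: "(nat \<Rightarrow> real) \<Rightarrow> complex \<Rightarrow> (nat \<Rightarrow> complex) \<Rightarrow> nat \<Rightarrow> complex" where
  "shifted V z u x = jacobi_op p V u x - z * u x"

lemma shifted_eq:
  "shifted V z u x = (complex_of_real (V x) - z) * u x
     - (if x = 0 then 0 else complex_of_real (down x) * u (x - 1)) - complex_of_real (up x) * u (x + 1)"
  by (simp add: shifted_def jacobi_op_def up_def down_def algebra_simps)

lemma shifted_linear:
  "shifted V z (\<lambda>x. u x + v x) x = shifted V z u x + shifted V z v x"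
  "shifted V z (\<lambda>x. u x - v x) x = shifted V z u x - shifted V z v x"
  "shifted V z (\<lambda>x. c * u x) x = c * shifted V z u x"
  by (auto simp: shifted_eq algebra_simps)

lemma shifted_zero [simp]: "shifted V z (\<lambda>x. 0) x = 0"
  by (simp add: shifted_eq)

text \<open>Solves \<open>shifted V z u x = f x\<close> for \<open>x > 0\<close>. The equation at 0
  is left out, so both initial values are free.\<close>

fun sol :: "(nat \<Rightarrow> real) \<Rightarrow> complex \<Rightarrow> complex \<Rightarrow> complex \<Rightarrow> (nat \<Rightarrow> complex) \<Rightarrow> nat \<Rightarrow> complex" where
  "sol V z a b f 0 = a"
| "sol V z a b f (Suc 0) = b"
| "sol V z a b f (Suc (Suc x)) =
     ((complex_of_real (V (Suc x)) - z) * sol V z a b f (Suc x)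
      - complex_of_real (down (Suc x)) * sol V z a b f x - f (Suc x)) / complex_of_real (up (Suc x))"

lemma shifted_sol: "x > 0 \<Longrightarrow> shifted V z (sol V z a b f) x = f x"
  by (cases x) (auto simp: shifted_eq)

text \<open>The constant may depend on \<open>j\<close>, \<open>z\<close> and \<open>V\<close> but
  not on the source, which makes solving inside blocks a bounded operation.\<close>

lemma sol_bounded:
  "\<exists>K\<ge>0. \<forall>f. cmod (sol V z 0 0 f j) \<le> K * (\<Sum>i<j. cmod (f i))"
proof (induction j rule: induct_nat_012)
  case (ge2 j)
  from ge2 obtain K1 K2 where K: "K1 \<ge> 0" "K2 \<ge> 0"
    "\<And>f. cmod (sol V z 0 0 f j) \<le> K1 * (\<Sum>i<j. cmod (f i))"
    "\<And>f. cmod (sol V z 0 0 f (Suc j)) \<le> K2 * (\<Sum>i<Suc j. cmod (f i))" by blast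
  define a b c where "a = cmod (complex_of_real (V (Suc j)) - z)" and "b = \<bar>down (Suc j)\<bar>"
    and "c = up (Suc j)"
  have c: "c > 0" by (simp add: c_def)
  have dist: "a * (K2 * T) + b * (K1 * T) + T = (a * K2 + b * K1 + 1) * T" for T
    by (simp add: algebra_simps)
  have "cmod (sol V z 0 0 f (Suc (Suc j))) \<le> ((a * K2 + b * K1 + 1) / c) * (\<Sum>i<Suc (Suc j). cmod (f i))" for f
  proof -
    let ?S = "\<Sum>i<Suc (Suc j). cmod (f i)"
    have S: "(\<Sum>i<j. cmod (f i)) \<le> ?S" "(\<Sum>i<Suc j. cmod (f i)) \<le> ?S" "cmod (f (Suc j)) \<le> ?S"
      using sum_nonneg[of "{..<j}" "\<lambda>i. cmod (f i)"] by auto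
    have "cmod ((complex_of_real (V (Suc j)) - z) * sol V z 0 0 f (Suc j)
        - complex_of_real (down (Suc j)) * sol V z 0 0 f j - f (Suc j))
      \<le> a * cmod (sol V z 0 0 f (Suc j)) + b * cmod (sol V z 0 0 f j) + cmod (f (Suc j))"
      unfolding a_def b_def
      by (intro order_trans[OF norm_triangle_ineq4] add_mono) (auto simp: norm_mult)
    also have "\<dots> \<le> a * (K2 * ?S) + b * (K1 * ?S) + ?S"
      using K S by (intro add_mono mult_left_mono order_trans[OF K(3)] order_trans[OF K(4)])
        (auto simp: a_def b_def)
    also have "\<dots> = (a * K2 + b * K1 + 1) * ?S" by (rule dist)
    finally show ?thesis using c
      by (simp add: norm_divide c_def[symmetric] divide_right_mono del: sum.lessThan_Suc)
  qed
  moreover have "(a * K2 + b * K1 + 1) / c \<ge> 0" using K c by (auto simp: a_def b_def)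
  ultimately show ?case by blast
qed auto

end

text \<open>Collects what the elimination of block interiors needs of the potential. The cosine
  potential with phase 0 fits, and so does the constant potential, which makes the Laplacian an
  instance for every positive \<open>n\<close>.\<close>

locale ss_block = ss_walk +
  fixes V :: "nat \<Rightarrow> real" and n :: nat
  assumes n_pos: "n > 0"
    and V_periodic: "\<And>q j. V (3 ^ n * q + j) = V j"
    and V_reflect: "\<And>j. j \<le> 3 ^ n \<Longrightarrow> V (3 ^ n - j) = V j"
begin

abbreviation "L \<equiv> (3::nat) ^ n"

lemma L_gt_1: "L > 1"
  using n_pos by (intro one_less_power) auto

lemma L_pos [simp]: "L > 0"
  by simp

text \<open>The homogeneous solution vanishing at the left end of a block; \<open>S z L = 0\<close>
  says that \<open>z\<close> is a Dirichlet eigenvalue of the block.\<close>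

definition S :: "complex \<Rightarrow> nat \<Rightarrow> complex" where
  "S z = sol V z 0 1 (\<lambda>x. 0)"

definition homog :: "complex \<Rightarrow> (nat \<Rightarrow> complex) \<Rightarrow> bool" where
  "homog z v \<longleftrightarrow> (\<forall>j. 0 < j \<and> j < L \<longrightarrow> shifted V z v j = 0)"

lemma shifted_block:
  assumes "0 < j" "j < L"
  shows "shifted V z u (L * q + j) = shifted V z (\<lambda>j. u (L * q + j)) j"
  using assms by (simp add: shifted_eq up_block down_block V_periodic)

lemma homog_blockI:
  "(\<And>x. \<not> L dvd x \<Longrightarrow> shifted V z u x = 0) \<Longrightarrow> homog z (\<lambda>j. u (L * q + j))"
  unfolding homog_def using shifted_block[of _ z u q]
  by (metis dvd_add_right_iff dvd_triv_left nat_dvd_not_less)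

lemma homog_reflect:
  assumes "homog z v"
  shows "homog z (\<lambda>j. v (L - j))"
  unfolding homog_def
proof (intro allI impI)
  have swap: "a - b - c = 0 \<Longrightarrow> a - c - b = 0" for a b c :: complex
    by (simp add: algebra_simps)
  fix j assume j: "0 < j \<and> j < L"
  then have "shifted V z v (L - j) = 0" using assms by (auto simp: homog_def)
  moreover have "L - j + 1 = L - (j - 1)" "L - j - 1 = L - (j + 1)" "L - j \<noteq> 0" "j \<noteq> 0"
    using j by auto
  moreover have "up (L - j) = down j" "down (L - j) = up j" "V (L - j) = V j"
    using j by (auto simp: up_reflect down_reflect V_reflect)
  ultimately show "shifted V z (\<lambda>j. v (L - j)) j = 0"
    unfolding shifted_eq by (simp only: if_False) (rule swap, assumption)
qed

lemma homog_S: "homog z (S z)"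
  by (auto simp: homog_def S_def shifted_sol)

lemma S_0 [simp]: "S z 0 = 0" and S_1 [simp]: "S z (Suc 0) = 1"
  by (auto simp: S_def)

text \<open>Conductance times Wronskian is constant along the block. The first and the last edge
  have the same conductance \<open>\<pi> 0\<close>, which cancels.\<close>

lemma wronskian:
  assumes v: "homog z v" and w: "homog z w"
  shows "v 0 * w 1 - v 1 * w 0 = v (L - 1) * w L - v L * w (L - 1)"
proof -
  define W where "W j = complex_of_real (\<pi> j * up j) * (v j * w (Suc j) - v (Suc j) * w j)" for j
  have "j < L \<Longrightarrow> W j = W 0" for j
  proof (induction j)
    case (Suc j)
    have v': "complex_of_real (up (Suc j)) * v (Suc (Suc j))
        = (complex_of_real (V (Suc j)) - z) * v (Suc j) - complex_of_real (down (Suc j)) * v j"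
      using v Suc.prems by (auto simp: homog_def shifted_eq algebra_simps)
    have w': "complex_of_real (up (Suc j)) * w (Suc (Suc j))
        = (complex_of_real (V (Suc j)) - z) * w (Suc j) - complex_of_real (down (Suc j)) * w j"
      using w Suc.prems by (auto simp: homog_def shifted_eq algebra_simps)
    have "W (Suc j) = complex_of_real (\<pi> (Suc j))
        * (v (Suc j) * (complex_of_real (up (Suc j)) * w (Suc (Suc j)))
           - (complex_of_real (up (Suc j)) * v (Suc (Suc j))) * w (Suc j))"
      by (simp add: W_def algebra_simps)
    also have "\<dots> = complex_of_real (\<pi> (Suc j) * down (Suc j)) * (v j * w (Suc j) - v (Suc j) * w j)"
      unfolding v' w' by (simp add: algebra_simps)
    also have "\<dots> = W j" by (simp add: W_def balance[symmetric])
    finally show ?case using Suc by simp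
  qed simp
  from this[of "L - 1"] have "W (L - 1) = W 0" by (simp only: diff_less L_pos zero_less_one)
  moreover have "W (L - 1) = complex_of_real (\<pi> 0) * (v (L - 1) * w L - v L * w (L - 1))"
    unfolding W_def conductance_power Suc_diff_1[OF L_pos] ..
  moreover have "W 0 = complex_of_real (\<pi> 0) * (v 0 * w 1 - v 1 * w 0)" by (simp add: W_def)
  ultimately show ?thesis using weight_pos[of 0] by simp
qed

text \<open>The Wronskian of \<open>v\<close> with \<open>S z\<close>. Written without division, it
  remains informative when \<open>S z L = 0\<close>.\<close>

lemma block_last: "homog z v \<Longrightarrow> S z L * v (L - 1) = v 0 + S z (L - 1) * v L"
  using wronskian[of z v "S z"] homog_S by (simp add: algebra_simps)

lemma block_first: "homog z v \<Longrightarrow> S z L * v 1 = v L + S z (L - 1) * v 0"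
  using block_last[OF homog_reflect] L_gt_1 by simp

text \<open>Chosen so that the diagonal coefficient left by the elimination,
  \<open>(V 0 - z) * S z L - S z (L - 1)\<close>, equals \<open>1 - Rfun z\<close>, the one of the
  shifted Laplacian.\<close>

definition Rfun :: "complex \<Rightarrow> complex" where
  "Rfun z = 1 - ((complex_of_real (V 0) - z) * S z L - S z (L - 1))"

abbreviation one :: "nat \<Rightarrow> real" where "one \<equiv> \<lambda>x. 1"

text \<open>After multiplication by \<open>S z L\<close>, the neighbours of \<open>L * q\<close> are
  replaced by values at multiples of \<open>L\<close> through \<open>block_first\<close> and
  \<open>block_last\<close>. Since the two probabilities add up to 1, the terms with
  \<open>S z (L - 1)\<close> join the diagonal.\<close>

lemma decimation:
  assumes u: "\<And>x. \<not> L dvd x \<Longrightarrow> shifted V z u x = 0"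
  shows "S z L * shifted V z u (L * q) = shifted one (Rfun z) (\<lambda>q. u (L * q)) q"
proof -
  have V0: "V (L * q) = V 0" using V_periodic[of q 0] by simp
  have first: "S z L * u (L * q + 1) = u (L * (q + 1)) + S z (L - 1) * u (L * q)"
    using block_first[OF homog_blockI[OF u], of q] by (simp add: algebra_simps)
  show ?thesis
  proof (cases "q = 0")
    case True
    then show ?thesis using first by (simp add: shifted_eq Rfun_def algebra_simps)
  next
    case False
    then obtain r where r: "q = Suc r" by (cases q) auto
    have i: "L * r + (L - 1) = L * q - 1" "L * r + L = L * q" using r by auto
    have last: "S z L * u (L * q - 1) = u (L * (q - 1)) + S z (L - 1) * u (L * q)"
      using block_last[OF homog_blockI[OF u], of r] unfolding i by (simp add: r)
    have sum: "complex_of_real (up q) + complex_of_real (down q) = 1"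
      using up_plus_down[of q] False by (metis of_real_1 of_real_add gr0I)
    have ud: "up (L * q) = up q" "down (L * q) = down q" using False by auto
    have "S z L * shifted V z u (L * q) = (complex_of_real (V 0) - z) * S z L * u (L * q)
        - complex_of_real (down q) * (S z L * u (L * q - 1)) - complex_of_real (up q) * (S z L * u (L * q + 1))"
      using False unfolding shifted_eq V0 ud by (simp add: algebra_simps)
    also have "\<dots> = (complex_of_real (V 0) - z) * S z L * u (L * q)
        - (complex_of_real (up q) + complex_of_real (down q)) * (S z (L - 1) * u (L * q))
        - complex_of_real (down q) * u (L * (q - 1)) - complex_of_real (up q) * u (L * (q + 1))"
      unfolding first last by (simp add: algebra_simps)
    also have "\<dots> = shifted one (Rfun z) (\<lambda>q. u (L * q)) q"
      using False unfolding sum shifted_eq Rfun_def by (simp add: algebra_simps)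
    finally show ?thesis .
  qed
qed

text \<open>The block relations for the second fundamental solution \<open>v\<close> force the
  square of \<open>S z (L - 1)\<close> to be 1 when \<open>S z L\<close> vanishes.\<close>

lemma Rfun_exceptional:
  assumes "S z L = 0"
  shows "S z (L - 1) = 1 \<and> Rfun z = 2 \<or> S z (L - 1) = -1 \<and> Rfun z = 0"
proof -
  define v where "v = sol V z 1 0 (\<lambda>x. 0)"
  have h: "homog z v" by (auto simp: homog_def v_def shifted_sol)
  have "1 + S z (L - 1) * v L = 0" "v L + S z (L - 1) = 0"
    using block_last[OF h] block_first[OF h] assms by (auto simp: v_def)
  then have v: "v L = - S z (L - 1)" by (simp add: eq_neg_iff_add_eq_0)
  with \<open>1 + S z (L - 1) * v L = 0\<close> have "(S z (L - 1))\<^sup>2 = 1"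
    by (simp add: power2_eq_square)
  then have "S z (L - 1) = 1 \<or> S z (L - 1) = -1" by (simp add: power2_eq_1_iff)
  then show ?thesis using assms by (auto simp: Rfun_def)
qed

end

section \<open>Bounded operators and a working form of the resolvent set\<close>

context ss_walk
begin

text \<open>Linearity is not part of the notion, in agreement with
  \<open>in_resolvent_set\<close>.\<close>

definition bdd_op :: "((nat \<Rightarrow> complex) \<Rightarrow> nat \<Rightarrow> complex) \<Rightarrow> bool" where
  "bdd_op T \<longleftrightarrow> (\<exists>C\<ge>0. \<forall>f\<in>ell2. T f \<in> ell2 \<and> N2 (T f) \<le> C * N2 f)"

lemma bdd_op_ell2: "bdd_op T \<Longrightarrow> f \<in> ell2 \<Longrightarrow> T f \<in> ell2"
  by (auto simp: bdd_op_def)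

lemma bdd_op_near:
  assumes "\<And>f x. f \<in> ell2 \<Longrightarrow> cmod (T f x) \<le> K * (\<Sum>y\<in>{x-d..x+d}. cmod (f y))"
  shows "bdd_op T"
  unfolding bdd_op_def
proof (intro exI conjI ballI)
  fix f assume f: "f \<in> ell2"
  show "T f \<in> ell2" "N2 (T f) \<le> (K\<^sup>2 * (real (2 * d + 1))\<^sup>2 * ratio ^ d) * N2 f"
    using near_bound[OF f assms[OF f]] by auto
qed (use ratio_ge_1 in auto)

lemma bdd_op_comp:
  assumes "bdd_op T" "bdd_op U"
  shows "bdd_op (\<lambda>f. T (U f))"
proof -
  obtain C D where CD: "C \<ge> 0" "\<forall>f\<in>ell2. T f \<in> ell2 \<and> N2 (T f) \<le> C * N2 f"
    "D \<ge> 0" "\<forall>f\<in>ell2. U f \<in> ell2 \<and> N2 (U f) \<le> D * N2 f"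
    using assms unfolding bdd_op_def by blast
  have "N2 (T (U f)) \<le> (C * D) * N2 f" if "f \<in> ell2" for f
  proof -
    have "N2 (T (U f)) \<le> C * N2 (U f)" using CD that by blast
    also have "\<dots> \<le> C * (D * N2 f)" using CD that by (intro mult_left_mono) auto
    finally show ?thesis by (simp add: mult.assoc)
  qed
  then show ?thesis unfolding bdd_op_def using CD by (intro exI[of _ "C * D"]) auto
qed

lemma bdd_op_add:
  assumes "bdd_op T" "bdd_op U"
  shows "bdd_op (\<lambda>f x. T f x + U f x)"
proof -
  obtain C D where CD: "C \<ge> 0" "\<forall>f\<in>ell2. T f \<in> ell2 \<and> N2 (T f) \<le> C * N2 f"
    "D \<ge> 0" "\<forall>f\<in>ell2. U f \<in> ell2 \<and> N2 (U f) \<le> D * N2 f"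
    using assms unfolding bdd_op_def by blast
  have "N2 (\<lambda>x. T f x + U f x) \<le> (2 * (C + D)) * N2 f" if "f \<in> ell2" for f
  proof -
    have "N2 (\<lambda>x. T f x + U f x) \<le> 2 * (N2 (T f) + N2 (U f))" using CD that by (intro ell2_add) auto
    also have "\<dots> \<le> 2 * (C * N2 f + D * N2 f)" using CD that by (intro mult_left_mono add_mono) auto
    finally show ?thesis by (simp add: algebra_simps)
  qed
  then show ?thesis unfolding bdd_op_def using CD
    by (intro exI[of _ "2 * (C + D)"]) (auto intro: ell2_add)
qed

lemma bdd_op_scale: "bdd_op (\<lambda>f x. c * f x)"
  unfolding bdd_op_def by (intro exI[of _ "(cmod c)\<^sup>2"]) (auto simp: ell2_scale)

lemma bdd_op_diff:
  assumes "bdd_op T" "bdd_op U"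
  shows "bdd_op (\<lambda>f x. T f x - U f x)"
  using bdd_op_add[OF assms(1) bdd_op_comp[OF bdd_op_scale[of "-1"] assms(2)]] by simp

lemma bdd_op_sample: "bdd_op (\<lambda>f q. f (3 ^ n * q))"
  unfolding bdd_op_def by (intro exI[of _ 1]) (auto simp: ell2_sample)

lemma bdd_op_spread: "bdd_op (spread n)"
  unfolding bdd_op_def by (intro exI[of _ 1]) (auto simp: ell2_spread)

lemma bdd_op_shifted:
  assumes "\<And>x. \<bar>V x\<bar> \<le> B"
  shows "bdd_op (shifted V z)"
proof (rule bdd_op_near[where K = "B + cmod z + 2" and d = 1])
  fix f :: "nat \<Rightarrow> complex" and x
  define T where "T = (\<Sum>y\<in>{x-1..x+1}. cmod (f y))"
  have S: "cmod (f y) \<le> T" if "y \<in> {x-1..x+1}" for y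
    unfolding T_def using that by (intro member_le_sum) auto
  have T: "cmod (f x) \<le> T" "cmod (f (x - 1)) \<le> T" "cmod (f (x + 1)) \<le> T"
    by (rule S, simp)+
  have T0: "T \<ge> 0" unfolding T_def by (rule sum_nonneg) simp
  have "cmod (shifted V z f x) \<le> cmod (complex_of_real (V x) - z) * cmod (f x)
      + cmod (if x = 0 then 0 else complex_of_real (down x) * f (x - 1)) + up x * cmod (f (x + 1))"
    unfolding shifted_eq
    by (intro order_trans[OF norm_triangle_ineq4] add_mono) (auto simp: norm_mult abs_of_pos[OF up_pos])
  also have "\<dots> \<le> (B + cmod z) * T + T + 1 * T"
  proof (intro add_mono mult_mono)
    have "cmod (complex_of_real (V x) - z) \<le> \<bar>V x\<bar> + cmod z"
      by (rule order_trans[OF norm_triangle_ineq4]) simp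
    then show "cmod (complex_of_real (V x) - z) \<le> B + cmod z" using assms[of x] by simp
    show "B + cmod z \<ge> 0" using assms[of x] by (smt (verit) norm_ge_zero)
    have "x > 0 \<Longrightarrow> down x * cmod (f (x - 1)) \<le> 1 * T"
      using down_le_1[of x] down_pos[of x] using T by (intro mult_mono) auto
    then show "cmod (if x = 0 then 0 else complex_of_real (down x) * f (x - 1)) \<le> T"
      using down_pos[of x] by (auto simp: norm_mult abs_of_pos T0)
  qed (use T T0 up_le_1 in auto)
  also have "\<dots> = (B + cmod z + 2) * T" by (simp add: algebra_simps)
  finally show "cmod (shifted V z f x) \<le> (B + cmod z + 2) * (\<Sum>y\<in>{x-1..x+1}. cmod (f y))"
    by (simp add: T_def)
qed

text \<open>A three-term recurrence with nonzero \<open>up\<close>: the equation at 0 fixes the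
  value at 1, and each later equation fixes the next value.\<close>

lemma shifted_unique:
  assumes "\<And>x. shifted V z v x = 0" "v 0 = 0"
  shows "v = (\<lambda>x. 0)"
proof -
  have "v x = 0 \<and> v (Suc x) = 0" for x
  proof (induction x)
    case 0
    show ?case using assms(1)[of 0] assms(2) by (auto simp: shifted_eq)
  next
    case (Suc x)
    show ?case using assms(1)[of "Suc x"] Suc by (auto simp: shifted_eq)
  qed
  then show ?thesis by auto
qed

lemma resolvent_iff:
  "in_resolvent_set \<pi> (jacobi_op p V) z \<longleftrightarrow>
     (\<exists>G. bdd_op G \<and> (\<forall>f\<in>ell2. shifted V z (G f) = f) \<and> (\<forall>f\<in>ell2. G (shifted V z f) = f))"
  (is "_ \<longleftrightarrow> ?R")
proof
  assume "in_resolvent_set \<pi> (jacobi_op p V) z"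
  then obtain G C where G: "\<forall>f\<in>ell2. G f \<in> ell2" "\<forall>f\<in>ell2. norm2w \<pi> (G f) \<le> C * norm2w \<pi> f"
    "\<forall>f\<in>ell2. shifted V z (G f) = f" "\<forall>f\<in>ell2. G (shifted V z f) = f"
    unfolding in_resolvent_set_def shifted_def[abs_def] by blast
  have "N2 (G f) \<le> C\<^sup>2 * N2 f" if f: "f \<in> ell2" for f
  proof -
    have "(sqrt (N2 (G f)))\<^sup>2 \<le> (C * sqrt (N2 f))\<^sup>2"
      using G(1,2) f unfolding norm2w_eq by (intro power_mono) (auto simp: N2_nonneg)
    then show ?thesis using f G(1) by (simp add: power_mult_distrib N2_nonneg)
  qed
  then have "bdd_op G" using G unfolding bdd_op_def by (intro exI[of _ "C\<^sup>2"]) auto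
  then show ?R using G by blast
next
  assume ?R
  then obtain G C where G: "C \<ge> 0" "\<forall>f\<in>ell2. G f \<in> ell2 \<and> N2 (G f) \<le> C * N2 f"
    "\<forall>f\<in>ell2. shifted V z (G f) = f" "\<forall>f\<in>ell2. G (shifted V z f) = f"
    unfolding bdd_op_def by blast
  have "norm2w \<pi> (G f) \<le> sqrt C * norm2w \<pi> f" if "f \<in> ell2" for f
    unfolding norm2w_eq real_sqrt_mult[symmetric] using G that by simp
  then show "in_resolvent_set \<pi> (jacobi_op p V) z"
    using G unfolding in_resolvent_set_def shifted_def[abs_def] by blast
qed

text \<open>A bounded right inverse and a trivial kernel suffice, because the difference of
  \<open>G (shifted V z f)\<close> and \<open>f\<close> lies in the kernel.\<close>

lemma resolventI:
  assumes V: "\<And>x. \<bar>V x\<bar> \<le> B" and G: "bdd_op G" "\<And>f. f \<in> ell2 \<Longrightarrow> shifted V z (G f) = f"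
    and inj: "\<And>v. v \<in> ell2 \<Longrightarrow> (\<And>x. shifted V z v x = 0) \<Longrightarrow> v = (\<lambda>x. 0)"
  shows "in_resolvent_set \<pi> (jacobi_op p V) z"
  unfolding resolvent_iff
proof (intro exI conjI ballI)
  fix f assume f: "f \<in> ell2"
  have g: "shifted V z f \<in> ell2" using bdd_op_ell2[OF bdd_op_shifted[OF V] f] .
  have "(\<lambda>x. G (shifted V z f) x - f x) = (\<lambda>x. 0)"
    by (rule inj) (auto intro!: ell2_diff bdd_op_ell2[OF G(1)] g f simp: shifted_linear G(2)[OF g])
  then show "G (shifted V z f) = f" by (auto simp: fun_eq_iff)
qed (use G in auto)

text \<open>The images stay bounded while the vectors do not, which a bounded left inverse would
  prevent.\<close>

lemma not_resolventI:
  assumes bdd: "\<And>m. v m \<in> ell2" "\<And>m. shifted V z (v m) \<in> ell2" "\<And>m. N2 (shifted V z (v m)) \<le> K"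
    and unb: "\<And>C. \<exists>m. N2 (v m) > C"
  shows "z \<in> op_spectrum \<pi> (jacobi_op p V)"
  unfolding op_spectrum_def mem_Collect_eq resolvent_iff
proof clarify
  fix G assume "bdd_op G" and G: "\<forall>f\<in>ell2. G (shifted V z f) = f"
  then obtain C where C: "C \<ge> 0" "\<forall>f\<in>ell2. N2 (G f) \<le> C * N2 f" by (auto simp: bdd_op_def)
  obtain m where "N2 (v m) > C * K" using unb by blast
  moreover have "N2 (v m) \<le> C * N2 (shifted V z (v m))" using C G bdd by metis
  moreover have "C * N2 (shifted V z (v m)) \<le> C * K" using C bdd by (intro mult_left_mono) auto
  ultimately show False by linarith
qed

end

section \<open>Solving inside the blocks and transferring resolvents\<close>

context ss_block
begin

lemma V_bounded: "\<exists>B. \<forall>x. \<bar>V x\<bar> \<le> B"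
proof (intro exI allI)
  fix x
  have "V x = V (x mod L)" using V_periodic[of "x div L" "x mod L"] by simp
  then show "\<bar>V x\<bar> \<le> Max ((\<lambda>j. \<bar>V j\<bar>) ` {..<L})" by (auto intro!: Max_ge)
qed

lemma shifted_cong:
  "\<lbrakk>u (x - 1) = v (x - 1); u x = v x; u (Suc x) = v (Suc x)\<rbrakk> \<Longrightarrow> shifted V z u x = shifted V z v x"
  by (simp add: shifted_eq)

lemma not_dvd_decomp:
  assumes "\<not> L dvd x"
  obtains q j where "x = L * q + j" "0 < j" "j < L"
proof
  show "x = L * (x div L) + x mod L" "0 < x mod L" "x mod L < L"
    using assms by (auto simp: dvd_eq_mod_eq_0)
qed

lemma sum_block_le:
  assumes "j \<le> L"
  shows "(\<Sum>i<L. cmod (f (L * q + i))) \<le> (\<Sum>y\<in>{L * q + j - L..L * q + j + L}. cmod (f y))"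
proof -
  have "(\<Sum>i<L. cmod (f (L * q + i))) = (\<Sum>y\<in>(\<lambda>i. L * q + i) ` {..<L}. cmod (f y))"
    by (subst sum.reindex) auto
  also have "\<dots> \<le> (\<Sum>y\<in>{L * q + j - L..L * q + j + L}. cmod (f y))"
    using assms by (intro sum_mono2) auto
  finally show ?thesis .
qed

text \<open>The solution with source \<open>f\<close> inside every block and value 0 at both ends:
  the multiple of \<open>S z\<close> corrects the right end value of the particular solution
  \<open>h\<close>.\<close>

definition dirichlet :: "complex \<Rightarrow> (nat \<Rightarrow> complex) \<Rightarrow> nat \<Rightarrow> complex" where
  "dirichlet z f x = (let h = sol V z 0 0 (\<lambda>i. f (L * (x div L) + i))
     in h (x mod L) - h L / S z L * S z (x mod L))"

text \<open>Interpolates the values \<open>a q\<close> at \<open>L * q\<close> by homogeneous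
  solutions, built from \<open>S z\<close> and its reflection.\<close>

definition extend :: "complex \<Rightarrow> (nat \<Rightarrow> complex) \<Rightarrow> nat \<Rightarrow> complex" where
  "extend z a x = (a (x div L) * S z (L - x mod L) + a (x div L + 1) * S z (x mod L)) / S z L"

context
  fixes z :: complex assumes S_L: "S z L \<noteq> 0"
begin

lemma dirichlet_multiple [simp]: "dirichlet z f (L * q) = 0"
  by (simp add: dirichlet_def Let_def)

text \<open>The case \<open>j = L\<close> matters: there the definition already refers to the next
  block, while the equation at \<open>L - 1\<close> needs the formula of the present one.\<close>

lemma dirichlet_block:
  assumes "j \<le> L"
  shows "dirichlet z f (L * q + j) = sol V z 0 0 (\<lambda>i. f (L * q + i)) j
    - sol V z 0 0 (\<lambda>i. f (L * q + i)) L / S z L * S z j"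
proof (cases "j = L")
  case True
  have "dirichlet z f (L * (q + 1)) = 0" by (rule dirichlet_multiple)
  then show ?thesis using True S_L by (simp add: add.commute)
next
  case False
  then show ?thesis using assms by (simp add: dirichlet_def Let_def)
qed

lemma shifted_dirichlet:
  assumes "\<not> L dvd x"
  shows "shifted V z (dirichlet z f) x = f x"
proof -
  obtain q j where x: "x = L * q + j" "0 < j" "j < L" using not_dvd_decomp[OF assms] .
  let ?h = "sol V z 0 0 (\<lambda>i. f (L * q + i))"
  have "shifted V z (dirichlet z f) x = shifted V z (\<lambda>j. dirichlet z f (L * q + j)) j"
    unfolding x(1) by (rule shifted_block) (use x in auto)
  also have "\<dots> = shifted V z (\<lambda>j. ?h j - ?h L / S z L * S z j) j"
    by (rule shifted_cong; rule dirichlet_block) (use x in auto)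
  also have "\<dots> = shifted V z ?h j - ?h L / S z L * shifted V z (S z) j"
    by (simp only: shifted_linear)
  also have "\<dots> = f x" using homog_S[of z] x by (simp add: shifted_sol homog_def)
  finally show ?thesis .
qed

lemma extend_block:
  assumes "j \<le> L"
  shows "extend z a (L * q + j) = (a q * S z (L - j) + a (q + 1) * S z j) / S z L"
proof (cases "j = L")
  case True
  have "(L * q + L) div L = Suc q" "(L * q + L) mod L = 0"
    by (simp_all add: div_add_self2)
  then show ?thesis using True S_L by (simp add: extend_def)
next
  case False
  then show ?thesis using assms by (simp add: extend_def)
qed

lemma extend_multiple [simp]: "extend z a (L * q) = a q"
  using extend_block[of 0 a q] S_L by simp

lemma shifted_extend:
  assumes "\<not> L dvd x"
  shows "shifted V z (extend z a) x = 0"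
proof -
  obtain q j where x: "x = L * q + j" "0 < j" "j < L" using not_dvd_decomp[OF assms] .
  have e: "extend z a (L * q + i) = a q / S z L * S z (L - i) + a (q + 1) / S z L * S z i"
    if "i \<le> L" for i by (simp add: extend_block[OF that] add_divide_distrib)
  have "shifted V z (extend z a) x = shifted V z (\<lambda>j. extend z a (L * q + j)) j"
    unfolding x(1) by (rule shifted_block) (use x in auto)
  also have "\<dots> = shifted V z (\<lambda>j. a q / S z L * S z (L - j) + a (q + 1) / S z L * S z j) j"
    by (rule shifted_cong; rule e) (use x in auto)
  also have "\<dots> = a q / S z L * shifted V z (\<lambda>j. S z (L - j)) j + a (q + 1) / S z L * shifted V z (S z) j"
    by (simp only: shifted_linear)
  also have "\<dots> = 0" using homog_S[of z] homog_reflect[OF homog_S[of z]] x by (simp add: homog_def)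
  finally show ?thesis .
qed

lemma bdd_op_dirichlet: "bdd_op (dirichlet z)"
proof -
  have "\<forall>j. \<exists>K\<ge>0. \<forall>f. cmod (sol V z 0 0 f j) \<le> K * (\<Sum>i<j. cmod (f i))" using sol_bounded by blast
  then obtain K where K: "\<And>j. K j \<ge> 0" "\<And>j f. cmod (sol V z 0 0 f j) \<le> K j * (\<Sum>i<j. cmod (f i))"
    by metis
  \<comment> \<open>The sum of nonnegative terms dominates the coefficient at each position in a
    block.\<close>
  define M where "M = (\<Sum>j\<le>L. K j + K L / cmod (S z L) * cmod (S z j))"
  show ?thesis
  proof (rule bdd_op_near[where K = M and d = L])
    fix f x
    define q j where "q = x div L" and "j = x mod L"
    let ?T = "\<Sum>i<L. cmod (f (L * q + i))"
    have j: "j < L" and x: "x = L * q + j" by (simp_all add: q_def j_def)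
    have T: "(\<Sum>i<j. cmod (f (L * q + i))) \<le> ?T" "0 \<le> ?T" using j by (auto intro!: sum_mono2 sum_nonneg)
    have "cmod (dirichlet z f x) \<le> cmod (sol V z 0 0 (\<lambda>i. f (L * q + i)) j)
        + cmod (sol V z 0 0 (\<lambda>i. f (L * q + i)) L) / cmod (S z L) * cmod (S z j)"
      unfolding x dirichlet_block[OF less_imp_le[OF j]]
      by (rule order_trans[OF norm_triangle_ineq4]) (simp add: norm_mult norm_divide)
    also have "\<dots> \<le> K j * ?T + (K L * ?T) / cmod (S z L) * cmod (S z j)"
      using K T by (intro add_mono mult_right_mono divide_right_mono K(2)
          order_trans[OF K(2) mult_left_mono[OF T(1)]]) auto
    also have "\<dots> = (K j + K L / cmod (S z L) * cmod (S z j)) * ?T" by (simp add: algebra_simps)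
    also have "\<dots> \<le> M * ?T"
      unfolding M_def using j K T
      by (intro mult_right_mono member_le_sum[of j "{..L}" "\<lambda>j. K j + K L / cmod (S z L) * cmod (S z j)"]) auto
    also have "\<dots> \<le> M * (\<Sum>y\<in>{x-L..x+L}. cmod (f y))"
      unfolding x using j K sum_block_le[of j f q]
      by (intro mult_left_mono) (auto simp: M_def intro!: sum_nonneg)
    finally show "cmod (dirichlet z f x) \<le> M * (\<Sum>y\<in>{x-L..x+L}. cmod (f y))" .
  qed
qed

text \<open>Preceded by sampling, the interpolation reads only points within distance
  \<open>L\<close>, so \<open>bdd_op_near\<close> applies. Composition with \<open>spread\<close>
  then cancels the sampling.\<close>

lemma bdd_op_extend: "bdd_op (extend z)"
proof -
  define M where "M = (\<Sum>j\<le>L. cmod (S z j)) / cmod (S z L)"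
  have M: "cmod (S z j) / cmod (S z L) \<le> M" if "j \<le> L" for j
    unfolding M_def using that by (intro divide_right_mono member_le_sum[of j "{..L}"]) auto
  have M0: "M \<ge> 0" by (auto simp: M_def intro!: sum_nonneg divide_nonneg_nonneg)
  have "bdd_op (\<lambda>f. extend z (\<lambda>q. f (L * q)))"
  proof (rule bdd_op_near[where K = "2 * M" and d = L])
    fix f :: "nat \<Rightarrow> complex" and x
    define q j where "q = x div L" and "j = x mod L"
    have j: "j < L" and x: "x = L * q + j" by (simp_all add: q_def j_def)
    let ?T = "\<Sum>y\<in>{x-L..x+L}. cmod (f y)"
    have T: "cmod (f (L * q)) \<le> ?T" "cmod (f (L * (q + 1))) \<le> ?T"
      using j by (auto simp: x intro!: member_le_sum)
    have "cmod (extend z (\<lambda>q. f (L * q)) x)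
        \<le> cmod (f (L * q)) * (cmod (S z (L - j)) / cmod (S z L)) + cmod (f (L * (q + 1))) * (cmod (S z j) / cmod (S z L))"
      unfolding x extend_block[OF less_imp_le[OF j]] add_divide_distrib
      by (rule order_trans[OF norm_triangle_ineq]) (simp add: norm_mult norm_divide)
    also have "\<dots> \<le> ?T * M + ?T * M"
      using j T M0 by (intro add_mono mult_mono T M) (auto intro: sum_nonneg)
    finally show "cmod (extend z (\<lambda>q. f (L * q)) x) \<le> 2 * M * ?T" by (simp add: mult_ac)
  qed
  from bdd_op_comp[OF this bdd_op_spread[of n]] show ?thesis by (simp add: spread_def)
qed

text \<open>A Schur complement: \<open>dirichlet\<close> solves the interior equations,
  \<open>D f\<close> is the defect left at the multiples of \<open>L\<close>, scaled by
  \<open>S z L\<close>, and the resolvent of the Laplacian at \<open>Rfun z\<close> removes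
  it.\<close>

lemma resolvent_lift:
  assumes "in_resolvent_set \<pi> (jacobi_op p one) (Rfun z)"
  shows "in_resolvent_set \<pi> (jacobi_op p V) z"
proof -
  from assms obtain G where G: "bdd_op G" "\<And>f. f \<in> ell2 \<Longrightarrow> shifted one (Rfun z) (G f) = f"
    "\<And>f. f \<in> ell2 \<Longrightarrow> G (shifted one (Rfun z) f) = f" unfolding resolvent_iff by blast
  obtain B where B: "\<And>x. \<bar>V x\<bar> \<le> B" using V_bounded by blast
  define D where "D f q = S z L * (f (L * q) - shifted V z (dirichlet z f) (L * q))" for f q
  have D: "bdd_op D"
    using bdd_op_comp[OF bdd_op_scale[of "S z L"] bdd_op_diff[OF bdd_op_sample[of n]
          bdd_op_comp[OF bdd_op_sample[of n] bdd_op_comp[OF bdd_op_shifted[OF B] bdd_op_dirichlet]]]]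
    by (simp add: D_def[abs_def])
  define T where "T f x = dirichlet z f x + extend z (G (D f)) x" for f x
  show ?thesis
  proof (rule resolventI[OF B])
    show "bdd_op T" unfolding T_def[abs_def]
      by (intro bdd_op_add bdd_op_dirichlet bdd_op_comp[OF bdd_op_extend] bdd_op_comp[OF G(1)] D)
  next
    fix f assume f: "f \<in> ell2"
    have "shifted V z (T f) x = f x" for x
    proof (cases "L dvd x")
      case False
      then show ?thesis by (simp add: T_def[abs_def] shifted_linear shifted_dirichlet shifted_extend)
    next
      case True
      then obtain q where x: "x = L * q" by auto
      have "S z L * shifted V z (extend z (G (D f))) (L * q) = shifted one (Rfun z) (G (D f)) q"
        using decimation[OF shifted_extend, where q = q] by simp
      also have "\<dots> = D f q" using G(2) bdd_op_ell2[OF D f] by simp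
      finally show ?thesis using S_L by (simp add: T_def[abs_def] shifted_linear x D_def)
    qed
    then show "shifted V z (T f) = f" by auto
  next
    fix v assume v: "v \<in> ell2" "\<And>x. shifted V z v x = 0"
    let ?a = "\<lambda>q. v (L * q)"
    have a: "?a \<in> ell2" by (rule ell2_sample[OF v(1)])
    have "shifted one (Rfun z) ?a = (\<lambda>q. 0)" using decimation[of z v] v(2) by (auto simp: fun_eq_iff)
    moreover have "shifted one (Rfun z) (\<lambda>q. 0) = (\<lambda>q. 0)" by auto
    ultimately have "?a = (\<lambda>q. 0)" using G(3)[OF a] G(3)[OF ell2_zero] by simp
    then have "v 0 = 0" by (metis mult_0_right)
    then show "v = (\<lambda>x. 0)" using v(2) by (intro shifted_unique)
  qed
qed

text \<open>A source supported on the multiples of \<open>L\<close> leaves the interior equations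
  homogeneous, so \<open>decimation\<close> applies to its image under \<open>G\<close>. Dividing
  the source by \<open>S z L\<close> cancels the factor there. A kernel element of the decimated
  operator is extended to one of the original operator.\<close>

lemma resolvent_descend:
  assumes "in_resolvent_set \<pi> (jacobi_op p V) z"
  shows "in_resolvent_set \<pi> (jacobi_op p one) (Rfun z)"
proof -
  from assms obtain G where G: "bdd_op G" "\<And>f. f \<in> ell2 \<Longrightarrow> shifted V z (G f) = f"
    "\<And>f. f \<in> ell2 \<Longrightarrow> G (shifted V z f) = f" unfolding resolvent_iff by blast
  define g where "g a x = 1 / S z L * spread n a x" for a x
  have g: "bdd_op g" using bdd_op_comp[OF bdd_op_scale bdd_op_spread, of "1 / S z L" n]
    by (simp add: g_def[abs_def])
  show ?thesis
  proof (rule resolventI[of one 1])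
    show "bdd_op (\<lambda>a q. G (g a) (L * q))"
      by (rule bdd_op_comp[OF bdd_op_sample bdd_op_comp[OF G(1) g]])
  next
    fix a assume a: "a \<in> ell2"
    have s: "shifted V z (G (g a)) = g a" using G(2) bdd_op_ell2[OF g a] by blast
    have "shifted one (Rfun z) (\<lambda>q. G (g a) (L * q)) q = a q" for q
      using decimation[of z "G (g a)" q] S_L by (simp add: s g_def spread_def)
    then show "shifted one (Rfun z) (\<lambda>q. G (g a) (L * q)) = a" by auto
  next
    fix v assume v: "v \<in> ell2" "\<And>x. shifted one (Rfun z) v x = 0"
    have "shifted V z (extend z v) x = 0" for x
    proof (cases "L dvd x")
      case False then show ?thesis by (rule shifted_extend)
    next
      case True
      then obtain q where "x = L * q" by auto
      then show ?thesis using decimation[of z "extend z v" q, OF shifted_extend] v(2) S_L by simp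
    qed
    then have "shifted V z (extend z v) = (\<lambda>x. 0)" "shifted V z (\<lambda>x. 0) = (\<lambda>x. 0)" by auto
    then have "extend z v = (\<lambda>x. 0)"
      using G(3)[OF bdd_op_ell2[OF bdd_op_extend v(1)]] G(3)[OF ell2_zero] by simp
    then show "v = (\<lambda>x. 0)" by (metis extend_multiple)
  qed auto
qed

end

end

section \<open>Approximate eigenvectors, boundedness of the spectrum, and eigenvectors of the
  Laplacian\<close>

context ss_walk
begin

text \<open>Cutting \<open>u\<close> off at a power of 3 leaves defects only at 0 and at the two
  ends of the cut edge, all bounded uniformly. Meanwhile every point \<open>3 ^ i - 1\<close> with
  \<open>i \<ge> m0\<close> inside contributes a fixed amount to the norm, which therefore grows
  without bound.\<close>

lemma spectrum_by_truncation:
  assumes u: "\<And>x. x > 0 \<Longrightarrow> shifted V z u x = 0"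
    and u1: "\<And>m. m \<ge> m0 \<Longrightarrow> cmod (u (3 ^ m - 1)) = 1"
    and u2: "\<And>m. m \<ge> m0 \<Longrightarrow> cmod (u (3 ^ m)) \<le> 1"
  shows "z \<in> op_spectrum \<pi> (jacobi_op p V)"
proof -
  \<comment> \<open>A power of 3, so that the weight there is \<open>\<pi> 1\<close>, and at least
    3, so that 0, \<open>M m - 1\<close> and \<open>M m\<close> are distinct.\<close>
  define M where "M m = (3::nat) ^ (m0 + Suc m)" for m
  define v where "v m x = (if x < M m then u x else 0)" for m x
  define e where "e = shifted V z u 0"
  have M: "M m \<ge> 3" for m
    using power_increasing[of 1 "m0 + Suc m" "3::nat"] by (simp add: M_def)
  have v0: "shifted V z (v m) 0 = e" for m
    using M[of m] by (simp add: shifted_eq e_def v_def)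
  have v1: "shifted V z (v m) (M m - 1) = complex_of_real (up (M m - 1)) * u (M m)" for m
    using M[of m] u[of "M m - 1"] by (simp add: shifted_eq v_def algebra_simps)
  have v2: "shifted V z (v m) (M m) = - (complex_of_real (down (M m)) * u (M m - 1))" for m
    using M[of m] by (simp add: shifted_eq v_def)
  have v3: "shifted V z (v m) x = 0" if "x \<notin> {0, M m - 1, M m}" for m x
  proof (cases "x < M m")
    case True
    then have "shifted V z (v m) x = shifted V z u x" using that by (auto simp: shifted_eq v_def)
    then show ?thesis using u that by simp
  next
    case False
    then have "v m (x - 1) = 0" "v m x = 0" "v m (x + 1) = 0" using that by (auto simp: v_def)
    then show ?thesis by (simp add: shifted_eq)
  qed
  define K where "K = (cmod e)\<^sup>2 * \<pi> 0 + ratio * \<pi> 1 + \<pi> 1"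
  show ?thesis
  proof (rule not_resolventI[where v = v and K = K])
    show "v m \<in> ell2" for m by (rule ell2_finite_support[of "M m"]) (simp add: v_def)
    show "shifted V z (v m) \<in> ell2" for m
      by (rule ell2_finite_support[of "M m + 1"], rule v3) (use M in auto)
    show "N2 (shifted V z (v m)) \<le> K" for m
    proof -
      have pM: "\<pi> (M m) = \<pi> 1" unfolding M_def by (rule weight_power)
      have "N2 (shifted V z (v m)) = (\<Sum>x\<in>{0, M m - 1, M m}. (cmod (shifted V z (v m) x))\<^sup>2 * \<pi> x)"
        unfolding N2_def by (rule suminf_finite) (use v3 in auto)
      also have "\<dots> = (cmod (shifted V z (v m) 0))\<^sup>2 * \<pi> 0
          + (cmod (shifted V z (v m) (M m - 1)))\<^sup>2 * \<pi> (M m - 1) + (cmod (shifted V z (v m) (M m)))\<^sup>2 * \<pi> (M m)"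
        using M[of m] by simp
      also have "\<dots> \<le> (cmod e)\<^sup>2 * \<pi> 0 + 1 * (ratio * \<pi> 1) + 1 * \<pi> 1"
      proof (intro add_mono mult_mono)
        have "cmod (u (M m)) \<le> 1" unfolding M_def by (rule u2) simp
        then show "(cmod (shifted V z (v m) (M m - 1)))\<^sup>2 \<le> 1" unfolding v1
          using mult_mono[of "up (M m - 1)" 1 "cmod (u (M m))" 1] up_le_1[of "M m - 1"] up_pos[of "M m - 1"]
          by (auto simp: norm_mult abs_of_pos intro!: power_le_one mult_nonneg_nonneg less_imp_le[OF up_pos])
        have "cmod (u (M m - 1)) = 1" unfolding M_def by (rule u1) simp
        then show "(cmod (shifted V z (v m) (M m)))\<^sup>2 \<le> 1" unfolding v2
          using M[of m] down_le_1[of "M m"] down_pos[of "M m"]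
          by (auto simp: norm_mult abs_of_pos intro!: power_le_one mult_nonneg_nonneg less_imp_le[OF up_pos])
        show "\<pi> (M m - 1) \<le> ratio * \<pi> 1" using weight_step(1)[of "M m - 1"] M[of m] pM by simp
      qed (use weight_pos[of 0] weight_pos[of "Suc 0"] weight_pos[of "M m - 1"] pM in \<open>auto simp: v0\<close>)
      finally show ?thesis by (simp add: K_def)
    qed
    show "\<exists>m. C < N2 (v m)" for C
    proof -
      \<comment> \<open>A lower bound for the weight of each point \<open>3 ^ i - 1\<close>, a
        neighbour of a point of weight \<open>\<pi> 1\<close>.\<close>
      define c where "c = \<pi> 1 / ratio"
      have r: "ratio > 0" using ratio_ge_1 by linarith
      have c: "c > 0" using weight_pos[of 1] r by (simp add: c_def)
      obtain m where m: "real m > C / c" using reals_Archimedean2 by blast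
      let ?g = "\<lambda>i. (3::nat) ^ (m0 + i) - 1"
      have inj: "inj_on ?g {..<m}"
      proof (rule inj_onI)
        fix i j assume "?g i = ?g j"
        then have "(3::nat) ^ (m0 + i) = 3 ^ (m0 + j)"
          by (metis Suc_diff_1 zero_less_numeral zero_less_power)
        then show "i = j" by simp
      qed
      have "C < m * c" using m c by (simp add: field_simps)
      also have "\<dots> = (\<Sum>i<m. c)" by simp
      also have "\<dots> \<le> (\<Sum>i<m. (cmod (v m (?g i)))\<^sup>2 * \<pi> (?g i))"
      proof (rule sum_mono)
        fix i assume "i \<in> {..<m}"
        then have "(3::nat) ^ (m0 + i) \<le> M m" unfolding M_def by (intro power_increasing) auto
        then have "?g i < M m" using M[of m] by simp
        then have "cmod (v m (?g i)) = 1" using u1[of "m0 + i"] by (simp add: v_def)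
        moreover have "\<pi> 1 \<le> ratio * \<pi> (?g i)"
          using weight_step(2)[of "?g i"] weight_power[of "m0 + i"] by simp
        ultimately show "c \<le> (cmod (v m (?g i)))\<^sup>2 * \<pi> (?g i)"
          using r by (simp add: c_def field_simps)
      qed
      also have "\<dots> = (\<Sum>x\<in>?g ` {..<m}. (cmod (v m x))\<^sup>2 * \<pi> x)"
        by (subst sum.reindex[OF inj]) simp
      also have "\<dots> \<le> N2 (v m)"
        by (rule N2_partial_sum, rule ell2_finite_support[of "M m"]) (auto simp: v_def)
      finally show ?thesis by blast
    qed
  qed
qed

lemma laplacian_spectrum_0: "0 \<in> op_spectrum \<pi> (jacobi_op p (\<lambda>x. 1))"
proof (rule spectrum_by_truncation[where u = "\<lambda>x. 1" and ?m0.0 = 0])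
  fix x :: nat assume "x > 0"
  then have "complex_of_real (up x) + complex_of_real (down x) = 1"
    by (metis of_real_1 of_real_add up_plus_down)
  then show "shifted (\<lambda>x. 1) 0 (\<lambda>x. 1) x = 0"
    using \<open>x > 0\<close> by (simp add: shifted_eq algebra_simps)
qed auto

lemma laplacian_spectrum_2: "2 \<in> op_spectrum \<pi> (jacobi_op p (\<lambda>x. 1))"
proof (rule spectrum_by_truncation[where u = "\<lambda>x. (-1) ^ x" and ?m0.0 = 0])
  fix x :: nat assume "x > 0"
  then obtain y where y: "x = Suc y" by (cases x) auto
  have s: "complex_of_real (up x) + complex_of_real (down x) = 1"
    using \<open>x > 0\<close> by (metis of_real_1 of_real_add up_plus_down)
  have "shifted (\<lambda>x. 1) 2 (\<lambda>x. (-1) ^ x) x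
      = (-1) ^ y * (1 - (complex_of_real (up x) + complex_of_real (down x)))"
    unfolding shifted_eq y by (simp add: algebra_simps)
  then show "shifted (\<lambda>x. 1) 2 (\<lambda>x. (-1) ^ x) x = 0" unfolding s by simp
qed (auto simp: norm_power)

text \<open>For large \<open>cmod z\<close> the resolvent comes from iterating
  \<open>u = (T u - f) / z\<close>. The iterates converge pointwise, and \<open>ell2_limit\<close>
  puts the limit into \<open>ell2\<close>.\<close>

lemma spectrum_bounded:
  assumes V: "\<And>x. \<bar>V x\<bar> \<le> B"
  obtains C where "\<And>z. z \<in> op_spectrum \<pi> (jacobi_op p V) \<Longrightarrow> cmod z \<le> C"
proof -
  define T where "T = shifted V 0"
  have T: "shifted V z u x = T u x - z * u x" for z u x by (simp add: T_def shifted_def)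
  have "bdd_op T" unfolding T_def by (rule bdd_op_shifted[OF V])
  then obtain C where C: "C \<ge> 0" "\<And>f. f \<in> ell2 \<Longrightarrow> T f \<in> ell2 \<and> N2 (T f) \<le> C * N2 f"
    unfolding bdd_op_def by blast
  \<comment> \<open>The threshold serves twice: the squared modulus exceeds
    \<open>2 * (C + 1)\<close>, which keeps the iterates below \<open>N2 f\<close>, and it exceeds
    \<open>4 * C\<close>, which shrinks successive differences by 1/4 in \<open>N2\<close>.\<close>
  have "in_resolvent_set \<pi> (jacobi_op p V) z" if z: "cmod z > sqrt (4 * (C + 1))" for z
  proof -
    have z2: "(cmod z)\<^sup>2 \<ge> 4 * (C + 1)"
      using power_mono[OF less_imp_le[OF z], of 2] C by simp
    have z0: "z \<noteq> 0" using z2 C by auto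
    have inv: "cmod (1 / z) ^ 2 = 1 / (cmod z)\<^sup>2" by (simp add: norm_divide power_divide)
    define it where "it f = rec_nat (\<lambda>x. 0) (\<lambda>k u x. 1 / z * (T u x - f x))" for f
    have it_0: "it f 0 = (\<lambda>x. 0)" and it_Suc: "it f (Suc k) = (\<lambda>x. 1 / z * (T (it f k) x - f x))"
      for f k by (simp_all add: it_def)
    have it: "it f k \<in> ell2 \<and> N2 (it f k) \<le> N2 f" if f: "f \<in> ell2" for f k
    proof (induction k)
      case 0
      then show ?case using f by (simp add: it_0 N2_nonneg)
    next
      case (Suc k)
      have "N2 (T (it f k)) \<le> C * N2 (it f k)" using Suc C by blast
      also have "\<dots> \<le> C * N2 f" using Suc C by (intro mult_left_mono) auto
      finally have a: "N2 (T (it f k)) \<le> C * N2 f" .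
      have "N2 (\<lambda>x. T (it f k) x - f x) \<le> 2 * (N2 (T (it f k)) + N2 f)"
        using Suc C f by (intro ell2_diff) auto
      also have "\<dots> \<le> 2 * (C * N2 f + N2 f)"
        using a by simp
      also have "\<dots> = 2 * (C + 1) * N2 f" by (simp add: algebra_simps)
      also have "\<dots> \<le> (cmod z)\<^sup>2 * N2 f"
        using z2 C f by (intro mult_right_mono) (auto simp: N2_nonneg)
      finally have "1 / (cmod z)\<^sup>2 * N2 (\<lambda>x. T (it f k) x - f x) \<le> N2 f"
        using z0 by (simp add: field_simps)
      moreover have "(\<lambda>x. T (it f k) x - f x) \<in> ell2" using Suc C f by (intro ell2_diff) auto
      ultimately show ?case unfolding it_Suc using ell2_scale[of _ "1 / z"] by (simp add: inv)
    qed
    have conv: "convergent (\<lambda>k. it f k x)" if f: "f \<in> ell2" for f x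
    proof -
      define d where "d k x = it f (Suc k) x - it f k x" for k x
      have d: "d k \<in> ell2" for k unfolding d_def[abs_def] using it[OF f] by (intro ell2_diff) auto
      have dS: "d (Suc k) = (\<lambda>x. 1 / z * T (d k) x)" for k
        unfolding d_def[abs_def] it_Suc[of f "Suc k"] it_Suc[of f k] T_def
        by (simp add: shifted_linear diff_divide_distrib fun_eq_iff it_Suc[symmetric, unfolded T_def])
      have Nd: "N2 (d k) \<le> (1 / 4) ^ k * N2 (d 0)" for k
      proof (induction k)
        case (Suc k)
        have "N2 (d (Suc k)) = 1 / (cmod z)\<^sup>2 * N2 (T (d k))"
          unfolding dS using ell2_scale(2)[of "T (d k)" "1 / z"] C d by (simp add: inv)
        also have "\<dots> \<le> 1 / (cmod z)\<^sup>2 * (C * N2 (d k))"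
          using C d by (intro mult_left_mono) auto
        also have "\<dots> \<le> 1 / 4 * N2 (d k)"
        proof -
          have "C / (cmod z)\<^sup>2 \<le> 1 / 4" using z2 z0 by (simp add: field_simps)
          from mult_right_mono[OF this N2_nonneg[OF d]] show ?thesis by simp
        qed
        finally show ?case using Suc by simp
      qed simp
      define D where "D = sqrt (N2 (d 0) / \<pi> x)"
      have bd: "cmod (d k x) \<le> (1 / 2) ^ k * D" for k
      proof -
        have "(cmod (d k x))\<^sup>2 * \<pi> x \<le> (1 / 4) ^ k * N2 (d 0)"
          using N2_point[OF d] Nd order_trans by blast
        then have "(cmod (d k x))\<^sup>2 \<le> (1 / 4) ^ k * (N2 (d 0) / \<pi> x)"
          using weight_pos[of x] by (simp add: field_simps)
        then have "cmod (d k x) \<le> sqrt ((1 / 4) ^ k * (N2 (d 0) / \<pi> x))" by (rule real_le_rsqrt)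
        also have "\<dots> = sqrt ((1 / 4) ^ k) * D" unfolding D_def by (rule real_sqrt_mult)
        also have "sqrt ((1 / 4) ^ k) = (1 / 2) ^ k"
          unfolding real_sqrt_power by (simp add: real_sqrt_divide)
        finally show ?thesis .
      qed
      have geo: "summable (\<lambda>k. (1 / 2 :: real) ^ k * D)"
        by (intro summable_mult2 summable_geometric) simp
      have "summable (\<lambda>k. d k x)"
        by (rule summable_comparison_test'[OF geo, of 0]) (rule bd)
      then have "convergent (\<lambda>k. \<Sum>i<k. d i x)" by (simp add: summable_iff_convergent)
      moreover have "(\<Sum>i<k. d i x) = it f k x" for k
        using sum_lessThan_telescope[of "\<lambda>i. it f i x" k] by (simp add: d_def it_0)
      ultimately show ?thesis by simp
    qed
    define G where "G f x = lim (\<lambda>k. it f k x)" for f x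
    have lim: "(\<lambda>k. it f k x) \<longlonglongrightarrow> G f x" if "f \<in> ell2" for f x
      using conv[OF that] by (simp add: G_def convergent_LIMSEQ_iff)
    show ?thesis
    proof (rule resolventI[OF V])
      show "bdd_op G" unfolding bdd_op_def
        using ell2_limit[OF conjunct1[OF it] conjunct2[OF it] lim] by (intro exI[of _ 1]) auto
    next
      fix f assume f: "f \<in> ell2"
      have "shifted V z (G f) x = f x" for x
      proof -
        have "(\<lambda>k. T (it f k) x) \<longlonglongrightarrow> T (G f) x"
          unfolding T_def shifted_eq using lim[OF f] by (auto intro!: tendsto_intros)
        then have "(\<lambda>k. 1 / z * (T (it f k) x - f x)) \<longlonglongrightarrow> 1 / z * (T (G f) x - f x)"
          by (intro tendsto_intros)
        moreover have "(\<lambda>k. 1 / z * (T (it f k) x - f x)) \<longlonglongrightarrow> G f x"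
          using LIMSEQ_Suc[OF lim[OF f, of x]] by (simp add: it_Suc)
        ultimately have "G f x = 1 / z * (T (G f) x - f x)" using LIMSEQ_unique by blast
        then show ?thesis using z0 by (simp add: T field_simps)
      qed
      then show "shifted V z (G f) = f" by auto
    next
      fix v assume v: "v \<in> ell2" "\<And>x. shifted V z v x = 0"
      have "T v = (\<lambda>x. z * v x)" using v(2) by (auto simp: T)
      then have "(cmod z)\<^sup>2 * N2 v \<le> C * N2 v" using C(2)[OF v(1)] ell2_scale(2)[OF v(1), of z] by simp
      moreover have "(C + 1) * N2 v \<le> (cmod z)\<^sup>2 * N2 v"
        using z2 C N2_nonneg[OF v(1)] by (intro mult_right_mono) auto
      ultimately have "N2 v = 0" using N2_nonneg[OF v(1)] by (simp add: algebra_simps)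
      then show "v = (\<lambda>x. 0)" using N2_eq_0_iff[OF v(1)] by simp
    qed
  qed
  then show thesis by (intro that[of "sqrt (4 * (C + 1))"]) (force simp: op_spectrum_def not_less[symmetric])
qed

text \<open>Every decimation keeps the value at 0, while the values at \<open>3 ^ m\<close> and
  \<open>2 * 3 ^ m\<close> have to die out in \<open>ell2\<close>.\<close>

lemma laplacian_no_eigenvector:
  assumes a: "a \<in> ell2" and eq: "\<And>x. shifted (\<lambda>x. 1) t a x = 0"
  shows "a = (\<lambda>x. 0)"
proof (rule ccontr)
  assume "a \<noteq> (\<lambda>x. 0)"
  define w where "w = a 0"
  have w: "w \<noteq> 0" using shifted_unique[OF eq] \<open>a \<noteq> (\<lambda>x. 0)\<close> unfolding w_def by blast
  \<comment> \<open>Decimation by \<open>3 ^ Suc m\<close> gives equations at 0 and 1 whose spectral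
    parameter \<open>l\<close> depends on \<open>m\<close>. The first expresses
    \<open>(1 - l) * w\<close>, and multiplying the second by \<open>w\<close> eliminates
    \<open>l\<close>.\<close>
  have rel: "p * w * a (2 * 3 ^ Suc m) = (a (3 ^ Suc m))\<^sup>2 - (1 - p) * w\<^sup>2" for m
  proof -
    interpret B: ss_block p \<pi> "\<lambda>x. 1" "Suc m" by unfold_locales auto
    define l where "l = B.Rfun t"
    have l: "shifted (\<lambda>x. 1) l (\<lambda>q. a (3 ^ Suc m * q)) q = 0" for q
      using B.decimation[of t a q] eq by (simp add: l_def)
    have 1: "a (3 ^ Suc m) = (1 - l) * w" using l[of 0] by (simp add: shifted_eq w_def)
    have "up 1 = p" "down 1 = 1 - p" using res3_1 by (auto simp: up_eq down_eq)
    then have "complex_of_real p * a (2 * 3 ^ Suc m) = (1 - l) * a (3 ^ Suc m) - (1 - complex_of_real p) * w"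
      using l[of 1] by (simp add: shifted_eq w_def mult.commute[of _ 2])
    then have "w * (complex_of_real p * a (2 * 3 ^ Suc m))
        = w * ((1 - l) * a (3 ^ Suc m) - (1 - complex_of_real p) * w)" by (simp only:)
    also have "\<dots> = ((1 - l) * w) * a (3 ^ Suc m) - (1 - complex_of_real p) * w\<^sup>2"
      by (simp add: algebra_simps power2_eq_square)
    finally have "w * (complex_of_real p * a (2 * 3 ^ Suc m))
        = ((1 - l) * w) * a (3 ^ Suc m) - (1 - complex_of_real p) * w\<^sup>2" .
    then show ?thesis unfolding 1[symmetric] by (simp add: power2_eq_square mult_ac)
  qed
  \<comment> \<open>The weight along this sequence is constantly \<open>\<pi> c\<close>, so
    summability forces the values themselves to 0.\<close>
  have decay: "(\<lambda>m. a (c * 3 ^ Suc m)) \<longlonglongrightarrow> 0" if c: "c > 0" for c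
  proof -
    have "(\<lambda>x. (cmod (a x))\<^sup>2 * \<pi> x) \<longlonglongrightarrow> 0"
      using a by (auto simp: ell2w_def intro: summable_LIMSEQ_zero)
    moreover have "strict_mono (\<lambda>m. c * 3 ^ Suc m)"
      using c by (auto simp: strict_mono_def intro!: power_strict_increasing)
    ultimately have "(\<lambda>m. (cmod (a (c * 3 ^ Suc m)))\<^sup>2 * \<pi> (c * 3 ^ Suc m)) \<longlonglongrightarrow> 0"
      by (auto dest: LIMSEQ_subseq_LIMSEQ simp: o_def)
    moreover have "\<pi> (c * 3 ^ Suc m) = \<pi> c" for m using weight_scale[of "Suc m" c] by (simp only: mult.commute)
    ultimately have "(\<lambda>m. (cmod (a (c * 3 ^ Suc m)))\<^sup>2 * \<pi> c / \<pi> c) \<longlonglongrightarrow> 0 / \<pi> c"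
      using weight_pos[of c] by (intro tendsto_divide) auto
    then have "(\<lambda>m. (cmod (a (c * 3 ^ Suc m)))\<^sup>2) \<longlonglongrightarrow> 0" using weight_pos[of c] by simp
    then have "(\<lambda>m. sqrt ((cmod (a (c * 3 ^ Suc m)))\<^sup>2)) \<longlonglongrightarrow> sqrt 0" by (intro tendsto_real_sqrt)
    then show ?thesis by (simp add: tendsto_norm_zero_iff)
  qed
  have "(\<lambda>m. p * w * a (2 * 3 ^ Suc m)) \<longlonglongrightarrow> p * w * 0"
    by (intro tendsto_intros decay) simp
  moreover have "(\<lambda>m. (a (1 * 3 ^ Suc m))\<^sup>2 - (1 - p) * w\<^sup>2) \<longlonglongrightarrow> 0\<^sup>2 - (1 - p) * w\<^sup>2"
    by (intro tendsto_intros decay) simp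
  ultimately have "p * w * 0 = 0\<^sup>2 - complex_of_real (1 - p) * w\<^sup>2"
    unfolding rel mult_1 by (rule LIMSEQ_unique)
  then have "complex_of_real (1 - p) = 0" using w by simp
  then show False using p_less_1 by simp
qed

end

section \<open>Eigenvectors and exceptional energies of the block operator\<close>

context ss_block
begin

text \<open>The restriction to the multiples of \<open>L\<close> solves the Laplacian equation
  whether or not \<open>S t L\<close> vanishes, so exceptional energies need no case of their
  own.\<close>

lemma no_eigenvector:
  assumes u: "u \<in> ell2" and eq: "\<And>x. shifted V t u x = 0"
  shows "u = (\<lambda>x. 0)"
proof -
  have "(\<lambda>q. u (L * q)) = (\<lambda>q. 0)"
  proof (rule laplacian_no_eigenvector[where t = "Rfun t"])
    show "shifted one (Rfun t) (\<lambda>q. u (L * q)) x = 0" for x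
      using decimation[of t u x] eq by simp
  qed (rule ell2_sample[OF u])
  then have "u 0 = 0" by (metis mult_0_right)
  then show ?thesis using eq by (intro shifted_unique)
qed

text \<open>When \<open>S z L = 0\<close>, multiples of \<open>S z\<close> on the blocks agree at
  the common end points, where they vanish. Only the balance of the two slopes at these points
  remains to be arranged.\<close>

lemma exceptional_in_spectrum:
  assumes S_L: "S z L = 0"
  shows "z \<in> op_spectrum \<pi> (jacobi_op p V)"
proof -
  define s where "s = S z (L - 1)"
  have s: "s = 1 \<or> s = -1" using Rfun_exceptional[OF S_L] by (auto simp: s_def)
  \<comment> \<open>The amplitudes make the contributions of the two blocks meeting at \<open>L * q\<close> cancel for \<open>q > 0\<close>.\<close>
  define a where "a q = (- s) ^ q * complex_of_real (\<pi> 0 / (\<pi> q * up q))" for q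
  define u where "u x = a (x div L) * S z (x mod L)" for x
  have u_block: "u (L * q + j) = a q * S z j" if "j \<le> L" for q j
  proof (cases "j = L")
    case True
    then have "(L * q + j) mod L = 0" by simp
    then show ?thesis using True S_L by (simp add: u_def)
  qed (use that in \<open>simp add: u_def\<close>)
  show ?thesis
  proof (rule spectrum_by_truncation[where u = u and ?m0.0 = n])
    fix x :: nat assume x: "x > 0"
    show "shifted V z u x = 0"
    proof (cases "L dvd x")
      case False
      then obtain q j where x: "x = L * q + j" "0 < j" "j < L" using not_dvd_decomp by metis
      have "shifted V z u x = shifted V z (\<lambda>j. u (L * q + j)) j"
        unfolding x(1) by (rule shifted_block) (use x in auto)
      also have "\<dots> = shifted V z (\<lambda>j. a q * S z j) j"
        by (rule shifted_cong; rule u_block) (use x in auto)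
      also have "\<dots> = 0" using homog_S[of z] x by (simp add: shifted_linear homog_def)
      finally show ?thesis .
    next
      case True
      then obtain q where q: "x = L * q" by auto
      with x obtain r where "q = Suc r" by (cases q) auto
      with q have r: "x = L * Suc r" by simp
      have i: "x - 1 = L * r + (L - 1)" using r L_gt_1 by simp
      have ud: "up x = up (Suc r)" "down x = down (Suc r)" using r by (simp_all del: mult_Suc_right)
      have "u (x - 1) = a r * s" unfolding i s_def by (rule u_block) simp
      moreover have "u (x + 1) = a (Suc r)" using u_block[of 1 "Suc r"] L_gt_1 by (simp add: r)
      moreover have "u x = 0" using u_block[of 0 "Suc r"] by (simp add: r)
      ultimately have "shifted V z u x = - (complex_of_real (down (Suc r)) * (a r * s)
          + complex_of_real (up (Suc r)) * a (Suc r))"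
        using x unfolding shifted_eq ud by simp
      moreover have "complex_of_real (down (Suc r)) * (a r * s)
          = (- s) ^ r * s * complex_of_real (\<pi> 0 / \<pi> (Suc r))"
        using down_pos[of "Suc r"] weight_pos[of "Suc r"] by (simp add: a_def balance field_simps)
      moreover have "complex_of_real (up (Suc r)) * a (Suc r)
          = - ((- s) ^ r * s * complex_of_real (\<pi> 0 / \<pi> (Suc r)))"
        using weight_pos[of "Suc r"] by (simp add: a_def field_simps)
      ultimately show ?thesis by simp
    qed
  next
    fix m assume m: "n \<le> m"
    define q where "q = (3::nat) ^ (m - n) - 1"
    \<comment> \<open>Hence \<open>3 ^ m - 1\<close> is the last interior point of block
      \<open>q\<close>. The amplitude there has modulus 1 by \<open>conductance_power\<close>,
      because \<open>q + 1\<close> is a power of 3.\<close>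
    have e: "3 ^ m = L * (q + 1)" using m by (simp add: q_def power_add[symmetric])
    then have "3 ^ m - 1 = L * q + (L - 1)" using L_gt_1 by simp
    then have "u (3 ^ m - 1) = a q * s" unfolding s_def using u_block[of "L - 1" q] by simp
    moreover have "cmod (a q) = 1"
      using s conductance_power[of "m - n"] weight_pos[of 0]
      by (auto simp: a_def q_def norm_mult norm_power norm_divide)
    ultimately show "cmod (u (3 ^ m - 1)) = 1" using s by (auto simp: norm_mult)
    show "cmod (u (3 ^ m)) \<le> 1" using u_block[of 0 "q + 1"] e by simp
  qed
qed

theorem spectral_decimation:
  "op_spectrum \<pi> (jacobi_op p V) = {z. Rfun z \<in> op_spectrum \<pi> (jacobi_op p one)}"
proof (intro set_eqI iffI CollectI)
  fix z assume "z \<in> op_spectrum \<pi> (jacobi_op p V)"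
  then show "Rfun z \<in> op_spectrum \<pi> (jacobi_op p one)"
    using resolvent_lift Rfun_exceptional[of z] laplacian_spectrum_0 laplacian_spectrum_2
    by (cases "S z L = 0") (auto simp: op_spectrum_def)
next
  fix z assume "z \<in> {z. Rfun z \<in> op_spectrum \<pi> (jacobi_op p one)}"
  then show "z \<in> op_spectrum \<pi> (jacobi_op p V)"
    using resolvent_descend exceptional_in_spectrum
    by (cases "S z L = 0") (auto simp: op_spectrum_def)
qed

end

section \<open>The weighted inner product\<close>

context ss_walk
begin

lemma ell2_abs_prod_le:
  "norm (cnj a * b * complex_of_real (\<pi> x)) \<le> (cmod a)\<^sup>2 * \<pi> x + (cmod b)\<^sup>2 * \<pi> x"
proof -
  have "2 * (cmod a * cmod b) \<le> (cmod a)\<^sup>2 + (cmod b)\<^sup>2"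
    using sum_squares_bound[of "cmod a" "cmod b"] by simp
  moreover have "0 \<le> cmod a * cmod b" by simp
  ultimately have "cmod a * cmod b \<le> (cmod a)\<^sup>2 + (cmod b)\<^sup>2" by linarith
  then have "cmod a * cmod b * \<pi> x \<le> ((cmod a)\<^sup>2 + (cmod b)\<^sup>2) * \<pi> x"
    using weight_pos[of x] by (intro mult_right_mono) auto
  then show ?thesis using weight_pos[of x] by (simp add: norm_mult distrib_right)
qed

lemma inner_summable:
  assumes "f \<in> ell2" "g \<in> ell2"
  shows "summable (\<lambda>x. cnj (f x) * g x * complex_of_real (\<pi> x))"
proof (rule summable_comparison_test'[of _ 0])
  show "summable (\<lambda>x. (cmod (f x))\<^sup>2 * \<pi> x + (cmod (g x))\<^sup>2 * \<pi> x)"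
    using assms unfolding ell2w_def by (intro summable_add) auto
qed (rule ell2_abs_prod_le)

abbreviation "ip \<equiv> inner2w \<pi>"

lemma ip_add_right:
  "f \<in> ell2 \<Longrightarrow> g \<in> ell2 \<Longrightarrow> h \<in> ell2 \<Longrightarrow> ip f (\<lambda>x. g x + h x) = ip f g + ip f h"
  unfolding inner2w_def
  using suminf_add[OF inner_summable[of f g] inner_summable[of f h]] by (simp add: algebra_simps)

lemma ip_scale_right:
  "f \<in> ell2 \<Longrightarrow> g \<in> ell2 \<Longrightarrow> ip f (\<lambda>x. c * g x) = c * ip f g"
  unfolding inner2w_def
  using suminf_mult[OF inner_summable[of f g], of c] by (simp add: algebra_simps)

lemma ip_commute:
  assumes "f \<in> ell2" "g \<in> ell2" shows "ip g f = cnj (ip f g)"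
proof -
  have "(\<lambda>x. cnj (f x) * g x * complex_of_real (\<pi> x)) sums ip f g"
    unfolding inner2w_def by (rule summable_sums[OF inner_summable[OF assms]])
  then have "(\<lambda>x. cnj (cnj (f x) * g x * complex_of_real (\<pi> x))) sums cnj (ip f g)"
    by (simp only: sums_cnj)
  then have "(\<lambda>x. cnj (g x) * f x * complex_of_real (\<pi> x)) sums cnj (ip f g)"
    by (simp add: mult_ac)
  then show ?thesis unfolding inner2w_def[of _ g f] by (rule sums_unique[symmetric])
qed

lemma ip_self: "f \<in> ell2 \<Longrightarrow> ip f f = complex_of_real (N2 f)"
proof -
  assume f: "f \<in> ell2"
  have "cnj (f x) * f x * complex_of_real (\<pi> x) = complex_of_real ((cmod (f x))\<^sup>2 * \<pi> x)" for x
    by (simp add: complex_norm_square[symmetric] mult.commute)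
  then have "ip f f = (\<Sum>x. complex_of_real ((cmod (f x))\<^sup>2 * \<pi> x))" unfolding inner2w_def by (simp only:)
  also have "\<dots> = complex_of_real (N2 f)"
    unfolding N2_def using f by (intro suminf_of_real[symmetric]) (simp add: ell2w_def)
  finally show ?thesis .
qed

lemma ip_Cauchy_Schwarz:
  assumes "f \<in> ell2" "g \<in> ell2"
  shows "(cmod (ip f g))\<^sup>2 \<le> N2 f * N2 g"
proof (rule LIMSEQ_le_const2)
  let ?t = "\<lambda>x. cnj (f x) * g x * complex_of_real (\<pi> x)"
  show "(\<lambda>N. (cmod (\<Sum>x<N. ?t x))\<^sup>2) \<longlonglongrightarrow> (cmod (ip f g))\<^sup>2"
    unfolding inner2w_def by (intro tendsto_intros summable_LIMSEQ inner_summable assms)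
  have "(cmod (\<Sum>x<N. ?t x))\<^sup>2 \<le> N2 f * N2 g" for N
  proof -
    have "cmod (\<Sum>x<N. ?t x) \<le> (\<Sum>x<N. cmod (?t x))" by (rule norm_sum)
    also have "\<dots> = (\<Sum>x<N. (cmod (f x) * sqrt (\<pi> x)) * (cmod (g x) * sqrt (\<pi> x)))"
      using weight_pos by (intro sum.cong) (auto simp: norm_mult less_imp_le)
    finally have "(cmod (\<Sum>x<N. ?t x))\<^sup>2
        \<le> (\<Sum>x<N. (cmod (f x) * sqrt (\<pi> x)) * (cmod (g x) * sqrt (\<pi> x)))\<^sup>2"
      by (intro power_mono) auto
    also have "\<dots> \<le> (\<Sum>x<N. (cmod (f x) * sqrt (\<pi> x))\<^sup>2) * (\<Sum>x<N. (cmod (g x) * sqrt (\<pi> x))\<^sup>2)"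
      by (rule Cauchy_Schwarz_ineq_sum)
    also have "\<dots> = (\<Sum>x<N. (cmod (f x))\<^sup>2 * \<pi> x) * (\<Sum>x<N. (cmod (g x))\<^sup>2 * \<pi> x)"
      using weight_pos by (simp add: power_mult_distrib less_imp_le)
    also have "\<dots> \<le> N2 f * N2 g"
      using assms by (intro mult_mono N2_partial_sum N2_nonneg) (auto intro: sum_nonneg)
    finally show ?thesis .
  qed
  then show "\<exists>M. \<forall>N\<ge>M. (cmod (\<Sum>x<N. ?t x))\<^sup>2 \<le> N2 f * N2 g" by blast
qed

text \<open>Summation by parts: the real potential and, by balance, the interior edge terms cancel,
  leaving the Wronskian on the last edge.\<close>

lemma green_identity:
  "(\<Sum>x<Suc N. (cnj (f x) * shifted V 0 g x - cnj (shifted V 0 f x) * g x) * complex_of_real (\<pi> x))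
    = complex_of_real (\<pi> N * up N) * (cnj (f (Suc N)) * g N - cnj (f N) * g (Suc N))"
proof (induction N)
  case 0
  show ?case by (simp add: shifted_eq algebra_simps)
next
  case (Suc N)
  have "(cnj (f (Suc N)) * shifted V 0 g (Suc N) - cnj (shifted V 0 f (Suc N)) * g (Suc N)) * complex_of_real (\<pi> (Suc N))
     = complex_of_real (\<pi> (Suc N) * down (Suc N)) * (cnj (f N) * g (Suc N) - cnj (f (Suc N)) * g N)
      + complex_of_real (\<pi> (Suc N) * up (Suc N)) * (cnj (f (Suc (Suc N))) * g (Suc N) - cnj (f (Suc N)) * g (Suc (Suc N)))"
    by (simp add: shifted_eq algebra_simps)
  then show ?case unfolding sum.lessThan_Suc[of _ "Suc N"] Suc.IH balance[symmetric]
    by (simp add: algebra_simps)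
qed

text \<open>The boundary term of \<open>green_identity\<close> tends to 0, since it is dominated by
  summands of the two convergent norm series.\<close>

lemma ip_symmetric:
  assumes V: "\<And>x. \<bar>V x\<bar> \<le> B" and f: "f \<in> ell2" and g: "g \<in> ell2"
  shows "ip f (shifted V 0 g) = ip (shifted V 0 f) g"
proof -
  let ?a = "\<lambda>x. cnj (f x) * shifted V 0 g x * complex_of_real (\<pi> x)"
  let ?b = "\<lambda>x. cnj (shifted V 0 f x) * g x * complex_of_real (\<pi> x)"
  have H: "shifted V 0 f \<in> ell2" "shifted V 0 g \<in> ell2"
    using bdd_op_ell2[OF bdd_op_shifted[OF V]] f g by auto
  have s: "summable ?a" "summable ?b" by (intro inner_summable f g H)+
  have "(\<lambda>N. \<Sum>x<Suc N. ?a x - ?b x) \<longlonglongrightarrow> (\<Sum>x. ?a x - ?b x)"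
    by (rule LIMSEQ_Suc[OF summable_LIMSEQ[OF summable_diff[OF s]]])
  moreover have "(\<lambda>N. \<Sum>x<Suc N. ?a x - ?b x) \<longlonglongrightarrow> 0"
  proof (rule Lim_null_comparison)
    let ?F = "\<lambda>x. (cmod (f x))\<^sup>2 * \<pi> x" and ?G = "\<lambda>x. (cmod (g x))\<^sup>2 * \<pi> x"
    have t: "?F \<longlonglongrightarrow> 0" "?G \<longlonglongrightarrow> 0"
      using f g by (auto simp: ell2w_def intro: summable_LIMSEQ_zero)
    have "(\<lambda>N. ratio * ?F (Suc N) + ?G N + (?F N + ratio * ?G (Suc N))) \<longlonglongrightarrow> ratio * 0 + 0 + (0 + ratio * 0)"
      by (intro tendsto_intros t LIMSEQ_Suc)
    then show "(\<lambda>N. ratio * ?F (Suc N) + ?G N + (?F N + ratio * ?G (Suc N))) \<longlonglongrightarrow> 0" by simp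
    have "norm (\<Sum>x<Suc N. ?a x - ?b x) \<le> ratio * ?F (Suc N) + ?G N + (?F N + ratio * ?G (Suc N))" for N
    proof -
      have step: "(cmod h)\<^sup>2 * \<pi> N \<le> ratio * ((cmod h)\<^sup>2 * \<pi> (Suc N))" for h
        using mult_left_mono[OF weight_step(1)[of N], of "(cmod h)\<^sup>2"] by (simp add: mult_ac)
      have "(\<Sum>x<Suc N. ?a x - ?b x)
          = complex_of_real (\<pi> N * up N) * (cnj (f (Suc N)) * g N - cnj (f N) * g (Suc N))"
        using green_identity[of f V g N] by (simp add: algebra_simps)
      also have "\<dots> = complex_of_real (up N) * (cnj (f (Suc N)) * g N * complex_of_real (\<pi> N)
          - cnj (f N) * g (Suc N) * complex_of_real (\<pi> N))"
        by (simp add: algebra_simps)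
      finally have "norm (\<Sum>x<Suc N. ?a x - ?b x) = up N * norm (cnj (f (Suc N)) * g N * complex_of_real (\<pi> N)
          - cnj (f N) * g (Suc N) * complex_of_real (\<pi> N))"
        by (simp add: norm_mult abs_of_pos[OF up_pos] del: of_real_mult)
      also have "\<dots> \<le> 1 * norm (cnj (f (Suc N)) * g N * complex_of_real (\<pi> N)
          - cnj (f N) * g (Suc N) * complex_of_real (\<pi> N))"
        by (intro mult_right_mono up_le_1) simp
      also have "\<dots> \<le> norm (cnj (f (Suc N)) * g N * complex_of_real (\<pi> N))
          + norm (cnj (f N) * g (Suc N) * complex_of_real (\<pi> N))"
        using norm_triangle_ineq4 by simp
      also have "\<dots> \<le> ((cmod (f (Suc N)))\<^sup>2 * \<pi> N + ?G N) + (?F N + (cmod (g (Suc N)))\<^sup>2 * \<pi> N)"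
        by (intro add_mono ell2_abs_prod_le)
      also have "\<dots> \<le> (ratio * ?F (Suc N) + ?G N) + (?F N + ratio * ?G (Suc N))"
        by (intro add_mono step order_refl)
      finally show ?thesis .
    qed
    then show "\<forall>\<^sub>F N in sequentially. norm (\<Sum>x<Suc N. ?a x - ?b x)
        \<le> ratio * ?F (Suc N) + ?G N + (?F N + ratio * ?G (Suc N))" by simp
  qed
  ultimately have "(\<Sum>x. ?a x - ?b x) = 0" by (rule LIMSEQ_unique)
  then show ?thesis unfolding inner2w_def using suminf_diff[OF s] by simp
qed

text \<open>A bounded sequence tending to 0 pointwise tends to 0 weakly: \<open>\<psi>\<close> is
  cut into a finite head \<open>h\<close>, where pointwise convergence suffices, and a tail
  \<open>k\<close> of small norm.\<close>

lemma ip_weak_limit: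
  assumes \<psi>: "\<psi> \<in> ell2" and u: "\<And>j. u j \<in> ell2" "\<And>j. N2 (u j) \<le> T"
    and lim: "\<And>x. (\<lambda>j. u j x) \<longlonglongrightarrow> 0"
  shows "(\<lambda>j. ip \<psi> (u j)) \<longlonglongrightarrow> 0"
proof (rule LIMSEQ_I)
  fix e :: real assume e: "e > 0"
  have T: "T \<ge> 0" using u(2)[of 0] N2_nonneg[OF u(1)[of 0]] by linarith
  let ?F = "\<lambda>x. (cmod (\<psi> x))\<^sup>2 * \<pi> x"
  have sF: "summable ?F" using \<psi> by (simp add: ell2w_def)
  \<comment> \<open>Cauchy-Schwarz then keeps the tail pairing below \<open>e / 2\<close>; using
    \<open>T + 1\<close> instead of \<open>T\<close> avoids division by 0.\<close>
  define d where "d = (e / 2)\<^sup>2 / (T + 1)"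
  have d: "d > 0" using e T by (simp add: d_def)
  have "(\<lambda>N. \<Sum>x<N. ?F x) \<longlonglongrightarrow> N2 \<psi>" unfolding N2_def by (rule summable_LIMSEQ[OF sF])
  from LIMSEQ_D[OF this d] obtain N where "norm ((\<Sum>x<N. ?F x) - N2 \<psi>) < d" by blast
  then have N: "N2 \<psi> - (\<Sum>x<N. ?F x) < d" by (simp add: abs_less_iff)
  define h k where "h x = (if x < N then \<psi> x else 0)" and "k x = (if x < N then 0 else \<psi> x)" for x
  have h: "h \<in> ell2" by (rule ell2_finite_support[of N]) (simp add: h_def)
  have k_eq: "k = (\<lambda>x. \<psi> x - h x)" by (auto simp: h_def k_def)
  have k: "k \<in> ell2" unfolding k_eq by (rule ell2_diff[OF \<psi> h])
  have "(\<lambda>x. (cmod (k x))\<^sup>2 * \<pi> x) = (\<lambda>x. ?F x - (cmod (h x))\<^sup>2 * \<pi> x)"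
    by (auto simp: h_def k_def)
  then have "N2 k = N2 \<psi> - N2 h"
    unfolding N2_def using suminf_diff[OF sF, of "\<lambda>x. (cmod (h x))\<^sup>2 * \<pi> x"] h by (simp add: ell2w_def)
  also have "N2 h = (\<Sum>x<N. (cmod (h x))\<^sup>2 * \<pi> x)"
    unfolding N2_def by (rule suminf_finite) (auto simp: h_def)
  also have "\<dots> = (\<Sum>x<N. ?F x)" by (simp add: h_def)
  finally have Nk: "N2 k < d" using N by simp
  have tail: "cmod (ip k (u j)) < e / 2" for j
  proof -
    have "(cmod (ip k (u j)))\<^sup>2 \<le> N2 k * N2 (u j)" by (rule ip_Cauchy_Schwarz[OF k u(1)])
    also have "\<dots> \<le> d * T" using Nk u d by (intro mult_mono) (auto simp: N2_nonneg)
    also have "\<dots> < d * (T + 1)" using d by simp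
    also have "\<dots> = (e / 2)\<^sup>2" using T by (simp add: d_def)
    finally show ?thesis using e power2_less_imp_less[of "cmod (ip k (u j))" "e / 2"] by simp
  qed
  have head: "ip h (u j) = (\<Sum>x<N. cnj (\<psi> x) * u j x * complex_of_real (\<pi> x))" for j
    unfolding inner2w_def by (subst suminf_finite[of "{..<N}"]) (auto simp: h_def)
  have "(\<lambda>j. ip h (u j)) \<longlonglongrightarrow> (\<Sum>x<N. cnj (\<psi> x) * 0 * complex_of_real (\<pi> x))"
    unfolding head by (intro tendsto_intros lim)
  then have "(\<lambda>j. ip h (u j)) \<longlonglongrightarrow> 0" by simp
  from LIMSEQ_D[OF this, of "e / 2"] e obtain J where J: "\<And>j. j \<ge> J \<Longrightarrow> cmod (ip h (u j)) < e / 2"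
    by auto
  have "ip \<psi> (u j) = ip h (u j) + ip k (u j)" for j
  proof -
    have "(\<lambda>x. h x + k x) = \<psi>" by (auto simp: h_def k_def)
    then have "ip (u j) \<psi> = ip (u j) h + ip (u j) k" using ip_add_right[OF u(1) h k, of j] by simp
    then show ?thesis using ip_commute[OF u(1)] h k \<psi> by simp
  qed
  then have "cmod (ip \<psi> (u j)) < e" if "j \<ge> J" for j
    using J[OF that] tail[of j] norm_triangle_ineq[of "ip h (u j)" "ip k (u j)"] by simp
  then show "\<exists>J. \<forall>j\<ge>J. norm (ip \<psi> (u j) - 0) < e" by auto
qed

end

section \<open>A null invariant set\<close>

text \<open>In the coordinate \<open>arccos\<close> the derivative of \<open>f\<close> is
  \<open>f' w * sqrt (1 - w ^ 2) / sqrt (1 - (f w) ^ 2)\<close>, which the squared hypothesis bounds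
  below by \<open>\<rho>\<close>. The claim is the monotonicity of
  \<open>\<rho> * arccos w - arccos (f w)\<close>.\<close>

lemma arccos_expansion:
  fixes f f' :: "real \<Rightarrow> real"
  assumes xy: "x < y" "-1 \<le> x" "y \<le> 1" and f1: "-1 \<le> f x" "f y \<le> 1" and \<rho>: "\<rho> \<ge> 0"
    and der: "\<And>w. x \<le> w \<Longrightarrow> w \<le> y \<Longrightarrow> (f has_real_derivative f' w) (at w) \<and> f' w > 0"
    and exp: "\<And>w. x < w \<Longrightarrow> w < y \<Longrightarrow> \<rho>\<^sup>2 * (1 - (f w)\<^sup>2) \<le> (f' w)\<^sup>2 * (1 - w\<^sup>2)"
  shows "\<rho> * (arccos x - arccos y) \<le> arccos (f x) - arccos (f y)"
proof -
  have less: "f u < f v" if "x \<le> u" "u < v" "v \<le> y" for u v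
  proof (rule DERIV_pos_imp_increasing[OF that(2)])
    fix w assume "u \<le> w" "w \<le> v"
    then show "\<exists>d. (f has_real_derivative d) (at w) \<and> 0 < d"
      using der[of w] that by (intro exI[of _ "f' w"]) auto
  qed
  have cont: "continuous_on {x..y} f"
    using der by (intro DERIV_atLeastAtMost_imp_continuous_on) blast
  have range: "-1 \<le> f w \<and> f w \<le> 1" if "w \<in> {x..y}" for w
  proof -
    have "w = x \<or> w = y \<or> x < w \<and> w < y" using that by auto
    then show ?thesis using less[of x w] less[of w y] less[of x y] f1 xy by auto
  qed
  have "\<rho> * arccos x - arccos (f x) \<le> \<rho> * arccos y - arccos (f y)"
  \<comment> \<open>The open interval is essential, as \<open>arccos\<close> is not differentiable
    at 1 and -1, which \<open>w\<close> or \<open>f w\<close> may reach at the ends.\<close>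
  proof (rule DERIV_nonneg_imp_increasing_open[where f = "\<lambda>w. \<rho> * arccos w - arccos (f w)"])
    show "continuous_on {x..y} (\<lambda>w. \<rho> * arccos w - arccos (f w))"
      using xy range cont by (intro continuous_intros) auto
  next
    fix w assume w: "x < w" "w < y"
    have w1: "-1 < w" "w < 1" using w xy by auto
    have fw: "-1 < f w" "f w < 1" using less[of x w] less[of w y] w f1 by auto
    have pos: "1 - w\<^sup>2 > 0" "1 - (f w)\<^sup>2 > 0" using w1 fw by (auto simp: abs_square_less_1)
    have D: "((\<lambda>w. \<rho> * arccos w - arccos (f w)) has_real_derivative
        \<rho> * inverse (- sqrt (1 - w\<^sup>2)) - inverse (- sqrt (1 - (f w)\<^sup>2)) * f' w) (at w)"
      using der[of w] w by (intro DERIV_diff DERIV_cmult DERIV_arccos w1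
          DERIV_chain2[where f = arccos and g = f] fw) auto
    have "sqrt (\<rho>\<^sup>2 * (1 - (f w)\<^sup>2)) \<le> sqrt ((f' w)\<^sup>2 * (1 - w\<^sup>2))"
      using exp[OF w] by simp
    then have "\<rho> * sqrt (1 - (f w)\<^sup>2) \<le> f' w * sqrt (1 - w\<^sup>2)"
      using \<rho> der[of w] w by (simp add: real_sqrt_mult)
    then have "\<rho> / sqrt (1 - w\<^sup>2) \<le> f' w / sqrt (1 - (f w)\<^sup>2)"
      using pos by (simp add: field_simps)
    then have "0 \<le> \<rho> * inverse (- sqrt (1 - w\<^sup>2)) - inverse (- sqrt (1 - (f w)\<^sup>2)) * f' w"
      by (simp add: divide_inverse mult.commute)
    with D show "\<exists>d. ((\<lambda>w. \<rho> * arccos w - arccos (f w)) has_real_derivative d) (at w) \<and> 0 \<le> d"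
      by blast
  qed (use xy in auto)
  then show ?thesis by (simp add: algebra_simps)
qed

text \<open>The cosine is Lipschitz with constant 1; this turns small \<open>arccos\<close>
  diameters into short intervals.\<close>

lemma abs_le_abs_arccos_diff:
  assumes "-1 \<le> x" "x \<le> 1" "-1 \<le> y" "y \<le> 1"
  shows "\<bar>x - y\<bar> \<le> \<bar>arccos x - arccos y\<bar>"
proof -
  have "\<bar>cos a - cos b\<bar> \<le> \<bar>a - b\<bar>" for a b :: real
  proof -
    have "\<bar>cos a - cos b\<bar> = 2 * \<bar>sin ((a + b) / 2)\<bar> * \<bar>sin ((b - a) / 2)\<bar>"
      by (simp add: cos_diff_cos abs_mult)
    also have "\<dots> \<le> 2 * 1 * \<bar>(b - a) / 2\<bar>"
      by (intro mult_mono abs_sin_x_le_abs_x abs_sin_le_one) auto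
    finally show ?thesis by simp
  qed
  from this[of "arccos x" "arccos y"] show ?thesis using assms by simp
qed

text \<open>Here \<open>c\<close> stands for \<open>p * (1 - p)\<close>, which for
  \<open>0 < p < 1\<close> is below 1/4 exactly when \<open>p\<close> differs from 1/2.\<close>

locale escaping_cubic =
  fixes c :: real
  assumes c_pos: "0 < c" and c_less: "c < 1 / 4"
begin

text \<open>The decimation map of the Laplacian by 3 in the coordinate \<open>y = 1 - z\<close>. At
  \<open>c = 1 / 4\<close> it would be the Chebyshev polynomial \<open>4 * y ^ 3 - 3 * y\<close>,
  which triples the angle \<open>arccos y\<close> and so expands by exactly 3.\<close>

definition f :: "real \<Rightarrow> real" where "f y = (y ^ 3 - (1 - c) * y) / c"
definition f' :: "real \<Rightarrow> real" where "f' y = (3 * y\<^sup>2 - (1 - c)) / c"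
definition \<rho> :: real where "\<rho> = sqrt (9 + (1 - 4 * c) / 4)"

lemma f_deriv: "(f has_real_derivative f' y) (at y)"
  unfolding f_def[abs_def] f'_def using c_pos
  by (auto intro!: derivative_eq_intros simp: power2_eq_square)

lemma rho_gt_3: "\<rho> > 3"
proof -
  have "sqrt (3\<^sup>2) < \<rho>" unfolding \<rho>_def using c_less by (intro real_sqrt_less_mono) simp
  then show ?thesis by simp
qed

text \<open>With \<open>t = w ^ 2\<close> both sides carry the factor
  \<open>(1 - t) / c ^ 2\<close>. The remaining square on the right exceeds \<open>9 * D\<close> by
  \<open>(1 - 4 * c) * (3 * t + 1 + 2 * c)\<close>, and \<open>D \<le> 4\<close> lets this surplus
  pay for the excess of \<open>\<rho> ^ 2\<close> over 9.\<close>

lemma expansion: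
  assumes "-1 \<le> w" "w \<le> 1"
  shows "\<rho>\<^sup>2 * (1 - (f w)\<^sup>2) \<le> (f' w)\<^sup>2 * (1 - w\<^sup>2)"
proof -
  define t D where "t = w\<^sup>2" and "D = (t + c)\<^sup>2 - t"
  have t: "0 \<le> t" "t \<le> 1" using assms by (auto simp: t_def abs_square_le_1)
  have fw: "(f w)\<^sup>2 = t * (t - (1 - c))\<^sup>2 / c\<^sup>2"
    by (simp add: f_def t_def power_divide power2_eq_square power3_eq_cube algebra_simps)
  have 1: "1 - (f w)\<^sup>2 = (1 - t) * D / c\<^sup>2"
    unfolding fw D_def using c_pos by (simp add: field_simps) (simp add: power2_eq_square algebra_simps)
  have "\<rho>\<^sup>2 = 9 + (1 - 4 * c) / 4" using c_less by (simp add: \<rho>_def)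
  then have 2: "\<rho>\<^sup>2 * D = 9 * D + (1 - 4 * c) / 4 * D" by (simp add: algebra_simps)
  have "(t + c)\<^sup>2 \<le> 2\<^sup>2" using t c_pos c_less by (intro power_mono) auto
  then have "D \<le> 4" using t by (simp add: D_def)
  then have "(1 - 4 * c) / 4 * D \<le> (1 - 4 * c) / 4 * 4" using c_less by (intro mult_left_mono) auto
  also have "\<dots> = (1 - 4 * c) * 1" by simp
  also have "\<dots> \<le> (1 - 4 * c) * (3 * t + 1 + 2 * c)"
    using t c_pos c_less by (intro mult_left_mono) auto
  also have "9 * D + \<dots> = (3 * t - (1 - c))\<^sup>2" by (simp add: D_def power2_eq_square algebra_simps)
  finally have "\<rho>\<^sup>2 * D \<le> (3 * t - (1 - c))\<^sup>2" using 2 by simp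
  then have "(1 - t) / c\<^sup>2 * (\<rho>\<^sup>2 * D) \<le> (1 - t) / c\<^sup>2 * (3 * t - (1 - c))\<^sup>2"
    using t by (intro mult_left_mono) auto
  moreover have "(f' w)\<^sup>2 * (1 - w\<^sup>2) = (1 - t) / c\<^sup>2 * (3 * t - (1 - c))\<^sup>2"
    by (simp add: f'_def t_def power_divide)
  ultimately show ?thesis unfolding 1 by (simp add: mult_ac)
qed

text \<open>The quotient \<open>f y / y\<close> is \<open>1 + (y ^ 2 - 1) / c\<close>, at least
  \<open>y ^ 2\<close> because \<open>c < 1\<close>.\<close>

lemma f_large: "\<bar>y\<bar> > 1 \<Longrightarrow> \<bar>f y\<bar> \<ge> y\<^sup>2 * \<bar>y\<bar>"
proof -
  assume y: "\<bar>y\<bar> > 1"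
  then have y2: "y\<^sup>2 \<ge> 1" using abs_square_less_1[of y] by linarith
  have "y\<^sup>2 - 1 \<le> (y\<^sup>2 - 1) / c"
    using y2 c_pos c_less mult_left_le[of c "y\<^sup>2 - 1"] by (simp add: field_simps)
  then have "y\<^sup>2 \<le> 1 + (y\<^sup>2 - 1) / c" by simp
  moreover have "f y = (1 + (y\<^sup>2 - 1) / c) * y"
    using c_pos by (simp add: f_def field_simps power2_eq_square power3_eq_cube)
  ultimately show ?thesis using y2 by (simp add: abs_mult mult_right_mono)
qed

text \<open>The branches are separated by the critical points, where \<open>3 * w\<^sup>2 = 1 - c\<close> and \<open>\<bar>f w\<bar> > 1\<close>.\<close>

definition branch :: "real \<Rightarrow> nat" where
  "branch w = (if 3 * w\<^sup>2 < 1 - c then 0 else if w < 0 then 1 else 2)"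

text \<open>The squared critical value is \<open>4 * (1 - c) ^ 3 / (27 * c ^ 2)\<close>, and it
  exceeds 1 because \<open>4 * (1 - c) ^ 3 - 27 * c ^ 2\<close> factors as
  \<open>(1 - 4 * c) * (c + 2) ^ 2\<close>. So no point with value in [-1, 1] is critical.\<close>

lemma f_critical:
  assumes "3 * w\<^sup>2 = 1 - c" shows "\<bar>f w\<bar> > 1"
proof -
  have w2: "w\<^sup>2 = (1 - c) / 3" using assms by simp
  have "f w = - (2 * (1 - c) / 3) * w / c"
  proof -
    have "w ^ 3 = (1 - c) / 3 * w" using w2 by (simp add: power3_eq_cube power2_eq_square)
    then have "f w = ((1 - c) / 3 * w - (1 - c) * w) / c" by (simp only: f_def)
    then show ?thesis using c_pos by (simp add: field_simps)
  qed
  have eq: "(2 * d / 3)\<^sup>2 * (d / 3) / c\<^sup>2 = 4 / 27 * d ^ 3 / c\<^sup>2" for d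
    by (simp add: power2_eq_square power3_eq_cube)
  from \<open>f w = - (2 * (1 - c) / 3) * w / c\<close> have "(f w)\<^sup>2 = (2 * (1 - c) / 3)\<^sup>2 * w\<^sup>2 / c\<^sup>2"
    by (simp add: power_mult_distrib power_divide)
  also have "\<dots> = 4 / 27 * (1 - c) ^ 3 / c\<^sup>2" unfolding w2 by (rule eq)
  also have "\<dots> > 1"
  proof -
    have "4 * (1 - c) ^ 3 - 27 * c\<^sup>2 = (1 - 4 * c) * (c + 2)\<^sup>2"
      by (simp add: power2_eq_square power3_eq_cube algebra_simps)
    also have "\<dots> > 0" using c_pos c_less by simp
    finally show ?thesis using c_pos by (simp add: field_simps)
  qed
  finally show ?thesis using abs_square_le_1[of "f w"] by linarith
qed

text \<open>No critical point lies between two such points of one branch. On the middle branch the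
  map decreases and the expansion is applied to \<open>- f\<close>; on the outer ones it
  increases.\<close>

lemma same_branch_expansion_less:
  assumes "x < y" "-1 \<le> x" "y \<le> 1" "\<bar>f x\<bar> \<le> 1" "\<bar>f y\<bar> \<le> 1" "branch x = branch y"
  shows "\<rho> * (arccos x - arccos y) \<le> \<bar>arccos (f x) - arccos (f y)\<bar>"
proof -
  have r0: "\<rho> \<ge> 0" using rho_gt_3 by simp
  show ?thesis
  proof (cases "branch x = 0")
    case True
    then have b: "3 * x\<^sup>2 < 1 - c" "3 * y\<^sup>2 < 1 - c" using assms(6)
      by (auto simp: branch_def split: if_splits)
    have neg: "f' w < 0" if "x \<le> w" "w \<le> y" for w
    proof -
      have "w\<^sup>2 \<le> max (x\<^sup>2) (y\<^sup>2)"
      proof (cases "w \<ge> 0")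
        case True then show ?thesis using power_mono[of w y 2] that by (simp add: le_max_iff_disj)
      next
        case False then show ?thesis using power_mono[of "-w" "-x" 2] that by (simp add: le_max_iff_disj)
      qed
      then show ?thesis using b c_pos by (auto simp: f'_def divide_less_0_iff)
    qed
    have "\<rho> * (arccos x - arccos y) \<le> arccos (- f x) - arccos (- f y)"
      using assms r0 neg expansion
      by (intro arccos_expansion[where f' = "\<lambda>w. - f' w"]) (auto intro!: DERIV_minus f_deriv)
    then show ?thesis using assms by (simp add: arccos_minus)
  next
    case False
    have b: "3 * x\<^sup>2 > 1 - c" "3 * y\<^sup>2 > 1 - c"
      using False assms(6) f_critical[of x] f_critical[of y] assms(4,5)
      by (auto simp: branch_def not_less le_less split: if_splits)
    have sgn: "x < 0 \<longleftrightarrow> y < 0" using False assms(6) by (auto simp: branch_def split: if_splits)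
    have pos: "f' w > 0" if "x \<le> w" "w \<le> y" for w
    proof -
      have "w\<^sup>2 \<ge> x\<^sup>2 \<or> w\<^sup>2 \<ge> y\<^sup>2"
        using sgn that power_mono[of x w 2] power_mono[of "-y" "-w" 2] by fastforce
      then show ?thesis using b c_pos by (auto simp: f'_def)
    qed
    have "\<rho> * (arccos x - arccos y) \<le> arccos (f x) - arccos (f y)"
      using assms r0 pos expansion
      by (intro arccos_expansion[where f' = f']) (auto intro!: f_deriv)
    then show ?thesis by simp
  qed
qed

lemma same_branch_expansion:
  assumes "\<bar>x\<bar> \<le> 1" "\<bar>y\<bar> \<le> 1" "\<bar>f x\<bar> \<le> 1" "\<bar>f y\<bar> \<le> 1" "branch x = branch y"
  shows "\<rho> * \<bar>arccos x - arccos y\<bar> \<le> \<bar>arccos (f x) - arccos (f y)\<bar>"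
proof -
  have *: "\<bar>arccos x - arccos y\<bar> = arccos x - arccos y" if "x < y" "\<bar>x\<bar> \<le> 1" "\<bar>y\<bar> \<le> 1" for x y
    using that arccos_le_arccos[of x y] by auto
  consider "x < y" | "y < x" | "x = y" by linarith
  then show ?thesis
  proof cases
    case 1 then show ?thesis using same_branch_expansion_less[of x y] *[of x y] assms by auto
  next
    case 2
    then show ?thesis using same_branch_expansion_less[of y x] *[of y x] assms
      by (auto simp: abs_minus_commute)
  qed simp
qed

text \<open>An orbit starting outside [-1, 1] grows at least geometrically and would leave the bound
  \<open>B\<close>.\<close>

lemma invariant_bounded:
  assumes bdd: "\<And>y. y \<in> K \<Longrightarrow> \<bar>y\<bar> \<le> B" and inv: "\<And>y. y \<in> K \<Longrightarrow> f y \<in> K" and y: "y \<in> K"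
  shows "\<bar>y\<bar> \<le> 1"
proof (rule ccontr)
  assume "\<not> \<bar>y\<bar> \<le> 1"
  then have y1: "\<bar>y\<bar> > 1" by simp
  define u where "u n = (f ^^ n) y" for n
  have uK: "u n \<in> K" for n by (induction n) (auto simp: u_def y inv)
  have grow: "\<bar>u n\<bar> \<ge> (\<bar>y\<bar>) ^ Suc n" for n
  proof (induction n)
    case (Suc n)
    have "\<bar>y\<bar> ^ 1 \<le> \<bar>y\<bar> ^ Suc n" using y1 by (intro power_increasing) auto
    then have un: "\<bar>u n\<bar> \<ge> \<bar>y\<bar>" using Suc by simp
    then have "\<bar>u n\<bar> * 1 \<le> \<bar>u n\<bar> * \<bar>u n\<bar>" using y1 by (intro mult_left_mono) auto
    then have u2: "\<bar>y\<bar> \<le> (u n)\<^sup>2" using un by (simp add: power2_eq_square flip: abs_mult)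
    have "\<bar>y\<bar> ^ Suc (Suc n) = \<bar>y\<bar> * \<bar>y\<bar> ^ Suc n" by simp
    also have "\<dots> \<le> (u n)\<^sup>2 * \<bar>u n\<bar>" using u2 Suc y1 by (intro mult_mono) auto
    also have "\<dots> \<le> \<bar>u (Suc n)\<bar>" using f_large[of "u n"] un y1 by (simp add: u_def)
    finally show ?case .
  qed (simp add: u_def)
  obtain n where "B < \<bar>y\<bar> ^ n" using real_arch_pow[OF y1] by blast
  also have "\<dots> \<le> \<bar>y\<bar> ^ Suc n" using y1 by (intro power_increasing) auto
  also have "\<dots> \<le> B" using grow[of n] bdd[OF uK, of n] by linarith
  finally show False by simp
qed

text \<open>Each pull-back triples the number of covering sets and divides their
  \<open>arccos\<close> diameter by \<open>\<rho>\<close>, so the total length is at most a constant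
  times \<open>(3 / \<rho>) ^ n\<close>.\<close>

lemma negligible_invariant:
  assumes bdd: "\<And>y. y \<in> K \<Longrightarrow> \<bar>y\<bar> \<le> B" and inv: "\<And>y. y \<in> K \<Longrightarrow> f y \<in> K"
  shows "negligible K"
proof -
  have K1: "\<bar>y\<bar> \<le> 1" if "y \<in> K" for y using invariant_bounded[OF bdd inv that] .
  have cover: "\<exists>F :: nat \<Rightarrow> real set. K \<subseteq> (\<Union>i<3 ^ n. F i) \<and>
      (\<forall>i. F i \<subseteq> K \<and> (\<forall>x\<in>F i. \<forall>y\<in>F i. \<bar>arccos x - arccos y\<bar> \<le> pi / \<rho> ^ n))" for n :: nat
  proof (induction n)
    case 0
    have "\<bar>arccos x - arccos y\<bar> \<le> pi" if "x \<in> K" "y \<in> K" for x y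
      using K1[OF that(1)] K1[OF that(2)] arccos_bounded[of x] arccos_bounded[of y] by (auto simp: abs_le_iff)
    then show ?case by (intro exI[of _ "\<lambda>i. K"]) auto
  next
    case (Suc n)
    then obtain F :: "nat \<Rightarrow> real set" where F: "K \<subseteq> (\<Union>i<3 ^ n. F i)"
      and F': "\<forall>i. F i \<subseteq> K \<and> (\<forall>x\<in>F i. \<forall>y\<in>F i. \<bar>arccos x - arccos y\<bar> \<le> pi / \<rho> ^ n)"
      by (elim exE conjE)
    \<comment> \<open>The index encodes the set containing the image as \<open>i div 3\<close> and
      the branch as \<open>i mod 3\<close>.\<close>
    define G where "G i = {w \<in> K. f w \<in> F (i div 3) \<and> branch w = i mod 3}" for i
    have "K \<subseteq> (\<Union>i<3 ^ Suc n. G i)"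
    proof
      fix w assume w: "w \<in> K"
      then obtain i where i: "i < 3 ^ n" "f w \<in> F i" using F inv[OF w] by blast
      have br: "branch w < 3" by (simp add: branch_def)
      then have "w \<in> G (3 * i + branch w)" using w i by (simp add: G_def)
      moreover have "3 * i + branch w < 3 ^ Suc n" using i br by simp
      ultimately show "w \<in> (\<Union>i<3 ^ Suc n. G i)" by blast
    qed
    moreover have "\<bar>arccos x - arccos y\<bar> \<le> pi / \<rho> ^ Suc n" if "x \<in> G i" "y \<in> G i" for i x y
    proof -
      have "\<rho> * \<bar>arccos x - arccos y\<bar> \<le> \<bar>arccos (f x) - arccos (f y)\<bar>"
        using that by (intro same_branch_expansion K1 inv) (auto simp: G_def)
      also have "\<dots> \<le> pi / \<rho> ^ n" using that F' unfolding G_def by blast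
      finally show ?thesis using rho_gt_3 by (simp add: field_simps)
    qed
    ultimately show ?case by (intro exI[of _ G]) (auto simp: G_def)
  qed
  show ?thesis unfolding negligible_outer_le
  proof (intro allI impI)
    fix e :: real assume e: "e > 0"
    have "(\<lambda>n. 2 * pi * (3 / \<rho>) ^ n) \<longlonglongrightarrow> 2 * pi * 0"
      using rho_gt_3 by (intro tendsto_intros LIMSEQ_power_zero) simp
    then have "eventually (\<lambda>n. 2 * pi * (3 / \<rho>) ^ n < e) sequentially"
      using e by (intro order_tendstoD) auto
    then obtain n where n: "2 * pi * (3 / \<rho>) ^ n < e" by (auto simp: eventually_sequentially)
    define d where "d = pi / \<rho> ^ n"
    have d0: "d \<ge> 0" using rho_gt_3 by (simp add: d_def)
    obtain F :: "nat \<Rightarrow> real set" where F: "K \<subseteq> (\<Union>i<3 ^ n. F i)"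
      and F': "\<forall>i. F i \<subseteq> K \<and> (\<forall>x\<in>F i. \<forall>y\<in>F i. \<bar>arccos x - arccos y\<bar> \<le> d)"
      using cover[of n] unfolding d_def by (elim exE conjE)
    \<comment> \<open>For empty \<open>F i\<close> the centre is arbitrary, and \<open>J i\<close>
      still covers \<open>F i\<close>.\<close>
    define m where "m i = (SOME x. x \<in> F i)" for i
    define J where "J i = {m i - d..m i + d}" for i
    have "F i \<subseteq> J i" for i
    proof
      fix x assume x: "x \<in> F i"
      then have mi: "m i \<in> F i" unfolding m_def by (rule someI)
      have xK: "\<bar>x\<bar> \<le> 1" "\<bar>m i\<bar> \<le> 1" using K1 F' x mi by blast+
      have "\<bar>x - m i\<bar> \<le> \<bar>arccos x - arccos (m i)\<bar>"
        using xK by (intro abs_le_abs_arccos_diff) (auto simp: abs_le_iff)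
      also have "\<dots> \<le> d" using F' x mi by blast
      finally show "x \<in> J i" by (auto simp: J_def abs_le_iff)
    qed
    then have "K \<subseteq> (\<Union>i<(3::nat) ^ n. J i)" using F by blast
    moreover have lm: "J i \<in> lmeasurable" for i by (simp add: J_def)
    then have "(\<Union>i<(3::nat) ^ n. J i) \<in> lmeasurable" by (intro fmeasurable.finite_UN) auto
    moreover have "measure lebesgue (\<Union>i<(3::nat) ^ n. J i) \<le> e"
    proof -
      have "measure lebesgue (\<Union>i<(3::nat) ^ n. J i) \<le> (\<Sum>i<(3::nat) ^ n. measure lebesgue (J i))"
        using lm by (intro measure_UNION_le) (auto simp: fmeasurableD)
      also have "\<dots> = 3 ^ n * (2 * d)" using d0 by (simp add: J_def)
      also have "\<dots> = 2 * pi * (3 / \<rho>) ^ n" by (simp add: d_def power_divide)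
      finally show ?thesis using n by simp
    qed
    ultimately show "\<exists>T. K \<subseteq> T \<and> T \<in> lmeasurable \<and> measure lebesgue T \<le> e" by blast
  qed
qed

end

text \<open>Off the finitely many zeros of the derivative the differential is injective, and there
  preimages of null sets are null.\<close>

lemma negligible_poly_vimage:
  fixes P :: "real poly"
  assumes "degree P > 0" "negligible T"
  shows "negligible {x. poly P x \<in> T}"
proof -
  have "negligible {x \<in> {x. poly (pderiv P) x \<noteq> 0}. poly P x \<in> T}"
  proof (rule negligible_differentiable_vimage[OF assms(2)])
    fix x assume "x \<in> {x. poly (pderiv P) x \<noteq> 0}"
    then show "inj ((*) (poly (pderiv P) x))" by (auto simp: inj_on_def)
    show "(poly P has_derivative (*) (poly (pderiv P) x)) (at x within {x. poly (pderiv P) x \<noteq> 0})"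
      using poly_DERIV[of P x] by (simp add: has_field_derivative_def has_derivative_at_withinI)
  qed
  moreover have "negligible {x. poly (pderiv P) x = 0}"
    using assms(1) by (intro negligible_finite poly_roots_finite) (simp add: pderiv_eq_0_iff)
  ultimately have "negligible ({x \<in> {x. poly (pderiv P) x \<noteq> 0}. poly P x \<in> T} \<union> {x. poly (pderiv P) x = 0})"
    by (rule negligible_Un)
  then show ?thesis by (rule negligible_subset) auto
qed

section \<open>The decimation polynomial\<close>

context ss_walk
begin

text \<open>The values of \<open>S\<close> as polynomials in the spectral parameter. The complex
  instance gives the polynomial of the theorem, and the real one pulls back null sets on the
  line.\<close>

fun sinpoly :: "(nat \<Rightarrow> real) \<Rightarrow> nat \<Rightarrow> 'a::real_field poly" where
  "sinpoly V 0 = 0"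
| "sinpoly V (Suc 0) = 1"
| "sinpoly V (Suc (Suc x)) = smult (of_real (1 / up (Suc x)))
     ([:of_real (V (Suc x)), -1:] * sinpoly V (Suc x) - smult (of_real (down (Suc x))) (sinpoly V x))"

lemma poly_sinpoly: "poly (sinpoly V x) z = sol V z 0 1 (\<lambda>x. 0) x"
  by (induction x rule: induct_nat_012) (auto simp: algebra_simps add_divide_distrib diff_divide_distrib)

lemma poly_sinpoly_of_real:
  "poly (sinpoly V x) (of_real t :: complex) = of_real (poly (sinpoly V x) t)"
  by (induction x rule: induct_nat_012) (auto simp: algebra_simps)

lemma degree_linear_mult:
  "q \<noteq> 0 \<Longrightarrow> degree ([:a, -1:] * q :: 'a::idom poly) = Suc (degree q)"
  by (subst degree_mult_eq) auto

text \<open>The degree bound on the previous polynomial is carried along to see that the second term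
  of the recursion cannot cancel the leading coefficient. It is only an inequality because
  \<open>sinpoly V 0\<close> is 0.\<close>

lemma degree_sinpoly:
  "degree (sinpoly V (Suc x) :: 'a::real_field poly) = x \<and> sinpoly V (Suc x) \<noteq> (0 :: 'a poly)
    \<and> degree (sinpoly V x :: 'a poly) \<le> x"
proof (induction x)
  case (Suc x)
  let ?s = "\<lambda>x. sinpoly V x :: 'a poly"
  have 1: "degree ([:of_real (V (Suc x)), -1:] * ?s (Suc x)) = Suc x"
    using Suc by (subst degree_linear_mult) auto
  have "degree (smult (of_real (down (Suc x))) (?s x)) < Suc x"
    using Suc degree_smult_le[of "of_real (down (Suc x))" "?s x"] by linarith
  then have "degree ([:of_real (V (Suc x)), -1:] * ?s (Suc x) - smult (of_real (down (Suc x))) (?s x)) = Suc x"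
    using 1 degree_add_eq_left[of "- smult (of_real (down (Suc x))) (?s x)" "[:of_real (V (Suc x)), -1:] * ?s (Suc x)"]
    by (simp only: degree_minus diff_conv_add_uminus)
  then have d: "degree (?s (Suc (Suc x))) = Suc x" by simp
  then have "?s (Suc (Suc x)) \<noteq> 0" by (metis degree_0 nat.distinct(1))
  with d Suc show ?case by simp
qed auto

end

context ss_block
begin

definition Rpoly :: "'a::real_field poly" where
  "Rpoly = 1 - ([:of_real (V 0), -1:] * sinpoly V L - sinpoly V (L - 1))"

lemma poly_Rpoly: "poly Rpoly z = Rfun z"
  by (simp add: Rpoly_def Rfun_def S_def poly_sinpoly algebra_simps)

lemma poly_Rpoly_of_real: "poly Rpoly (of_real t :: complex) = of_real (poly Rpoly t)"
  by (simp add: Rpoly_def poly_sinpoly_of_real algebra_simps)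

text \<open>The linear factor raises the degree \<open>L - 1\<close> of \<open>sinpoly V L\<close>
  by one, and the other terms have smaller degree.\<close>

lemma degree_Rpoly: "degree (Rpoly :: 'a::real_field poly) = L"
proof -
  obtain l where l: "L = Suc l" using L_pos gr0_conv_Suc by blast
  have d: "degree (sinpoly V L :: 'a poly) = l" "sinpoly V L \<noteq> (0 :: 'a poly)"
    "degree (sinpoly V l :: 'a poly) \<le> l"
    unfolding l using degree_sinpoly by auto
  have "degree ([:of_real (V 0), -1:] * sinpoly V L :: 'a poly) = Suc l"
    using d by (subst degree_linear_mult) auto
  moreover have "degree (1 + sinpoly V (L - 1) :: 'a poly) < Suc l"
    using d degree_add_le[of "1 :: 'a poly" l "sinpoly V l"] by (simp add: l del: sinpoly.simps)
  ultimately have "degree ((1 + sinpoly V (L - 1)) + - ([:of_real (V 0), -1:] * sinpoly V L) :: 'a poly) = Suc l"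
    by (subst degree_add_eq_right) (simp_all only: degree_minus)
  moreover have "(1 + sinpoly V (L - 1)) + - ([:of_real (V 0), -1:] * sinpoly V L) = (Rpoly :: 'a poly)"
    unfolding Rpoly_def by (simp only: diff_diff_eq2 diff_conv_add_uminus[symmetric])
  ultimately show ?thesis unfolding l by (simp only:)
qed

end

section \<open>Lebesgue measure of the spectra\<close>

context ss_walk
begin

text \<open>Spectral decimation of the constant potential with \<open>n = 1\<close>, in the
  coordinate \<open>y = 1 - z\<close> that makes the map odd.\<close>

lemma laplacian_spectrum_cubic:
  assumes "c = p * (1 - p)"
  shows "complex_of_real (1 - y) \<in> op_spectrum \<pi> (jacobi_op p (\<lambda>x. 1)) \<longleftrightarrow>
    complex_of_real (1 - (y ^ 3 - (1 - c) * y) / c) \<in> op_spectrum \<pi> (jacobi_op p (\<lambda>x. 1))"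
proof -
  interpret B: ss_block p \<pi> "\<lambda>x. 1" 1 by unfold_locales auto
  have ud: "up (Suc 0) = p" "up (Suc (Suc 0)) = 1 - p" "down (Suc 0) = 1 - p" "down (Suc (Suc 0)) = p"
    using res3_1 res3_2 by (auto simp: up_eq down_eq numeral_2_eq_2)
  have c: "c \<noteq> 0" using assms p_pos p_less_1 by simp
  have "B.Rfun (of_real (1 - y)) = complex_of_real (1 - (y * ((y * y / p - p) / (1 - p)) - y / p))"
    unfolding B.Rfun_def B.S_def by (simp add: ud numeral_3_eq_3)
  also have "y * ((y * y / p - p) / (1 - p)) - y / p = (y ^ 3 - (1 - c) * y) / c"
    using p_pos p_less_1 unfolding assms
    by (simp add: field_simps) (simp add: algebra_simps power3_eq_cube power2_eq_square)
  finally have R: "B.Rfun (of_real (1 - y)) = complex_of_real (1 - (y ^ 3 - (1 - c) * y) / c)" .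
  show ?thesis
    using arg_cong[OF B.spectral_decimation, of "\<lambda>A. complex_of_real (1 - y) \<in> A"]
    unfolding mem_Collect_eq R .
qed

lemma laplacian_spectrum_null:
  assumes "p \<noteq> 1 / 2"
  shows "negligible {t. complex_of_real t \<in> op_spectrum \<pi> (jacobi_op p (\<lambda>x. 1))}"
proof -
  define c where "c = p * (1 - p)"
  define K where "K = {y. complex_of_real (1 - y) \<in> op_spectrum \<pi> (jacobi_op p (\<lambda>x. 1))}"
  have "0 < (1 - 2 * p)\<^sup>2" using assms by (simp add: field_simps)
  then have "c < 1 / 4" by (simp add: c_def power2_eq_square algebra_simps)
  then interpret E: escaping_cubic c
    using p_pos p_less_1 by unfold_locales (auto simp: c_def)
  obtain C where C: "\<And>z. z \<in> op_spectrum \<pi> (jacobi_op p (\<lambda>x. 1)) \<Longrightarrow> cmod z \<le> C"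
    using spectrum_bounded[of "\<lambda>x. 1" 1] by auto
  have "negligible K"
  proof (rule E.negligible_invariant)
    fix y assume y: "y \<in> K"
    have "cmod (complex_of_real (1 - y)) \<le> C" using y C by (simp add: K_def)
    then show "\<bar>y\<bar> \<le> C + 1" unfolding norm_of_real by linarith
    show "E.f y \<in> K" using y laplacian_spectrum_cubic[OF c_def, of y] by (simp add: K_def E.f_def)
  qed
  moreover have "{t. complex_of_real t \<in> op_spectrum \<pi> (jacobi_op p (\<lambda>x. 1))} = {t. poly [:1, -1:] t \<in> K}"
    by (simp add: K_def)
  ultimately show ?thesis using negligible_poly_vimage[of "[:1, -1:]" K] by simp
qed

end

context ss_block
begin

text \<open>\<open>Rpoly\<close> maps reals to reals, so the real points of the spectrum form the
  preimage of a null set under a real polynomial.\<close>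

lemma spectrum_null:
  assumes "p \<noteq> 1 / 2"
  shows "negligible {t. complex_of_real t \<in> op_spectrum \<pi> (jacobi_op p V)}"
proof -
  have "negligible {t. poly Rpoly t \<in> {t. complex_of_real t \<in> op_spectrum \<pi> (jacobi_op p one)}}"
    by (rule negligible_poly_vimage[OF _ laplacian_spectrum_null[OF assms]]) (simp add: degree_Rpoly)
  then show ?thesis
    by (simp add: spectral_decimation poly_Rpoly[symmetric] poly_Rpoly_of_real)
qed

end

section \<open>Spectral measures\<close>

text \<open>The measure is accessible through its moments only, so everything below is done with
  polynomials.\<close>

locale spectral_measure_of = ss_walk +
  fixes V :: "nat \<Rightarrow> real" and B :: real and \<psi> :: "nat \<Rightarrow> complex" and \<mu> :: "real measure"
  assumes V_le: "\<And>x. \<bar>V x\<bar> \<le> B" and \<psi>: "\<psi> \<in> ell2"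
    and spectral: "is_spectral_measure \<pi> (jacobi_op p V) \<psi> \<mu>"
begin

sublocale finite_measure \<mu>
  using spectral by (simp add: is_spectral_measure_def)

abbreviation "H \<equiv> shifted V 0"

lemma H_eq: "jacobi_op p V = H"
  by (simp add: shifted_def[abs_def])

lemma sets_mu [measurable_cong, simp]: "sets \<mu> = sets borel"
  using spectral by (simp add: is_spectral_measure_def)

lemma space_mu [simp]: "space \<mu> = UNIV"
  using sets_eq_imp_space_eq[OF sets_mu] by simp

lemma integrable_ind [simp]: "A \<in> sets borel \<Longrightarrow> integrable \<mu> (indicat_real A)"
  by (intro integrable_real_indicator) (auto simp: less_top[symmetric])

lemma H_ell2: "f \<in> ell2 \<Longrightarrow> H f \<in> ell2"
  by (rule bdd_op_ell2[OF bdd_op_shifted[OF V_le]])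

lemma integrable_power: "integrable \<mu> (\<lambda>t. t ^ k)"
  and moment: "complex_of_real (\<integral>t. t ^ k \<partial>\<mu>) = ip \<psi> ((H ^^ k) \<psi>)"
  using spectral by (simp_all add: is_spectral_measure_def H_eq)

lemma integrable_poly: "integrable \<mu> (poly P)"
  unfolding poly_altdef[abs_def] using integrable_power by simp

text \<open>The vector \<open>P(H) \<psi>\<close>, evaluated by Horner's scheme.\<close>

definition calc :: "real poly \<Rightarrow> nat \<Rightarrow> complex" where
  "calc P = fold_coeffs (\<lambda>a f x. complex_of_real a * \<psi> x + H f x) P (\<lambda>x. 0)"

lemma calc_0 [simp]: "calc 0 = (\<lambda>x. 0)"
  by (simp add: calc_def)

lemma calc_pCons: "calc (pCons a P) = (\<lambda>x. complex_of_real a * \<psi> x + H (calc P) x)"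
  by (cases "a = 0 \<and> P = 0") (auto simp: calc_def)

lemma calc_ell2 [simp]: "calc P \<in> ell2"
  by (induction P) (auto simp: calc_pCons intro!: ell2_add ell2_scale \<psi> H_ell2)

lemma H_calc: "H (calc P) = calc (pCons 0 P)"
  by (simp add: calc_pCons)

lemma H_power_ell2 [simp]: "(H ^^ k) \<psi> \<in> ell2"
  by (induction k) (auto intro: \<psi> H_ell2)

lemma ip_H: "f \<in> ell2 \<Longrightarrow> g \<in> ell2 \<Longrightarrow> ip (H f) g = ip f (H g)"
  using ip_symmetric[of V B f g] V_le by simp

lemma ip_H_power: "g \<in> ell2 \<Longrightarrow> ip ((H ^^ k) \<psi>) g = ip \<psi> ((H ^^ k) g)"
proof (induction k arbitrary: g)
  case (Suc k)
  have "ip ((H ^^ Suc k) \<psi>) g = ip ((H ^^ k) \<psi>) (H g)" using Suc.prems by (simp add: ip_H)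
  also have "\<dots> = ip \<psi> ((H ^^ k) (H g))" by (rule Suc.IH[OF H_ell2[OF Suc.prems]])
  finally show ?case by (simp add: funpow_swap1)
qed simp

text \<open>The free power \<open>k\<close> absorbs the factor \<open>H\<close> that each further
  coefficient of \<open>P\<close> brings and that symmetry moves to the left.\<close>

lemma ip_power_calc:
  "integrable \<mu> (\<lambda>t. t ^ k * poly P t) \<and>
    ip ((H ^^ k) \<psi>) (calc P) = complex_of_real (\<integral>t. t ^ k * poly P t \<partial>\<mu>)"
proof (induction P arbitrary: k)
  case 0
  show ?case by (simp add: inner2w_def)
next
  case (pCons a P)
  have i: "integrable \<mu> (\<lambda>t. t ^ Suc k * poly P t)" using pCons(2) by blast
  have e: "t ^ k * poly (pCons a P) t = a * t ^ k + t ^ Suc k * poly P t" for t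
    by (simp add: algebra_simps)
  have "ip ((H ^^ k) \<psi>) (calc (pCons a P)) = a * ip ((H ^^ k) \<psi>) \<psi> + ip ((H ^^ k) \<psi>) (H (calc P))"
    unfolding calc_pCons by (simp add: ip_add_right ip_scale_right ell2_scale H_ell2 \<psi>)
  also have "ip ((H ^^ k) \<psi>) (H (calc P)) = ip ((H ^^ Suc k) \<psi>) (calc P)"
    by (simp add: ip_H)
  also have "\<dots> = complex_of_real (\<integral>t. t ^ Suc k * poly P t \<partial>\<mu>)" using pCons(2) by blast
  also have "ip ((H ^^ k) \<psi>) \<psi> = complex_of_real (\<integral>t. t ^ k \<partial>\<mu>)"
    by (simp add: ip_H_power \<psi> moment)
  finally show ?case unfolding e using i integrable_power[of k] by simp
qed

text \<open>This makes \<open>calc\<close> an isometry from the polynomials with the square integral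
  norm of \<open>\<mu>\<close> into \<open>ell2\<close>. The induction moves the factors
  \<open>H\<close> from the left to the right.\<close>

lemma ip_calc: "ip (calc Q) (calc P) = complex_of_real (\<integral>t. poly (Q * P) t \<partial>\<mu>)"
proof (induction Q arbitrary: P)
  case 0
  show ?case by (simp add: inner2w_def)
next
  case (pCons a Q)
  have "ip (calc P) (calc (pCons a Q)) = a * ip (calc P) \<psi> + ip (calc P) (H (calc Q))"
    unfolding calc_pCons by (simp add: ip_add_right ip_scale_right ell2_scale H_ell2 \<psi>)
  then have "ip (calc (pCons a Q)) (calc P) = a * ip \<psi> (calc P) + ip (H (calc Q)) (calc P)"
    using ip_commute[of "calc P"] by (simp add: \<psi> H_ell2)
  also have "ip (H (calc Q)) (calc P) = ip (calc Q) (calc (pCons 0 P))"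
    unfolding H_calc[of P, symmetric] by (rule ip_H) simp_all
  also have "\<dots> = complex_of_real (\<integral>t. poly (Q * pCons 0 P) t \<partial>\<mu>)" by (rule pCons(2))
  also have "ip \<psi> (calc P) = complex_of_real (\<integral>t. poly P t \<partial>\<mu>)" using ip_power_calc[of 0 P] by simp
  also have "complex_of_real a * complex_of_real (\<integral>t. poly P t \<partial>\<mu>)
      + complex_of_real (\<integral>t. poly (Q * pCons 0 P) t \<partial>\<mu>)
      = complex_of_real (\<integral>t. a * poly P t + poly (Q * pCons 0 P) t \<partial>\<mu>)"
  proof -
    have "integrable \<mu> (\<lambda>t. a * poly P t)" using integrable_poly[of P] by simp
    from Bochner_Integration.integral_add[OF this integrable_poly[of "Q * pCons 0 P"]]
    show ?thesis by (simp only: integral_mult_right_zero of_real_add of_real_mult)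
  qed
  also have "(\<lambda>t. a * poly P t + poly (Q * pCons 0 P) t) = poly (pCons a Q * P)"
    by (auto simp: algebra_simps)
  finally show ?case .
qed

lemma ip_psi_calc: "ip \<psi> (calc P) = complex_of_real (\<integral>t. poly P t \<partial>\<mu>)"
  using ip_power_calc[of 0 P] by simp

lemma N2_calc: "N2 (calc P) = (\<integral>t. (poly P t)\<^sup>2 \<partial>\<mu>)"
  using ip_calc[of P P] ip_self[OF calc_ell2[of P]] by (simp add: power2_eq_square)

text \<open>Under the isometry, \<open>H - t0\<close> becomes multiplication by
  \<open>t - t0\<close>.\<close>

lemma calc_shifted: "shifted V (complex_of_real t0) (calc P) = calc ([:-t0, 1:] * P)"
proof -
  have add: "calc (P + Q) x = calc P x + calc Q x" for P Q x
    by (induction P Q arbitrary: x rule: poly_induct2)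
      (auto simp: calc_pCons shifted_eq algebra_simps)
  have scale: "calc (smult c P) x = complex_of_real c * calc P x" for c P x
    by (induction P arbitrary: x) (auto simp: calc_pCons shifted_eq algebra_simps)
  have "calc ([:-t0, 1:] * P) x = complex_of_real (-t0) * calc P x + H (calc P) x" for x
  proof -
    have "[:-t0, 1:] * P = smult (-t0) P + pCons 0 P" by simp
    then show ?thesis by (simp only: add scale H_calc)
  qed
  then show ?thesis by (auto simp: shifted_def fun_eq_iff)
qed

lemma integrable_poly_sq: "integrable \<mu> (\<lambda>t. (poly P t)\<^sup>2)"
proof -
  have "(\<lambda>t. (poly P t)\<^sup>2) = poly (P * P)" by (auto simp: power2_eq_square)
  then show ?thesis using integrable_poly by simp
qed

lemma poly_linear_mult_power_sq: "(poly ([:-t0, 1:] * q ^ j) t)\<^sup>2 = (t - t0)\<^sup>2 * ((poly q t)\<^sup>2) ^ j" for t0 :: real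
proof -
  have "poly ([:-t0, 1:] * q ^ j) t = (t - t0) * poly q t ^ j" by (simp add: poly_power algebra_simps)
  then show ?thesis by (simp only: power_mult_distrib power_mult[symmetric] mult.commute[of j])
qed

text \<open>Chebyshev's inequality for the moment of order \<open>2 * k\<close> bounds the mass
  beyond \<open>b\<close> by \<open>(C / b ^ 2) ^ k * N2 \<psi>\<close> for all \<open>k\<close>;
  with \<open>b = C + 1\<close> the quotient is less than 1.\<close>

lemma support_bounded: "\<exists>b\<ge>1. AE t in \<mu>. \<bar>t\<bar> \<le> b"
proof -
  obtain C where C: "C \<ge> 0" "\<And>f. f \<in> ell2 \<Longrightarrow> N2 (H f) \<le> C * N2 f"
    using bdd_op_shifted[of V B 0, OF V_le] unfolding bdd_op_def by blast
  have mon: "calc (monom 1 k) \<in> ell2 \<and> N2 (calc (monom 1 k)) \<le> C ^ k * N2 \<psi>" for k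
  proof (induction k)
    case 0
    then show ?case by (simp add: monom_0 calc_pCons \<psi>)
  next
    case (Suc k)
    have "calc (monom 1 (Suc k)) = H (calc (monom 1 k))" by (simp add: monom_Suc H_calc)
    then have "N2 (calc (monom 1 (Suc k))) \<le> C * N2 (calc (monom 1 k))" using C by simp
    also have "\<dots> \<le> C * (C ^ k * N2 \<psi>)" using Suc C by (intro mult_left_mono) auto
    finally show ?case by simp
  qed
  define b where "b = C + 1"
  have b: "b \<ge> 1" using C by (simp add: b_def)
  define A where "A = {t. \<bar>t\<bar> > b}"
  have A: "A \<in> sets \<mu>" unfolding sets_mu A_def by measurable
  have bound: "measure \<mu> A \<le> (C / b\<^sup>2) ^ k * N2 \<psi>" for k
  proof -
    have "(b\<^sup>2) ^ k * measure \<mu> A = (\<integral>t. (b\<^sup>2) ^ k * indicator A t \<partial>\<mu>)" using A by simp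
    also have "\<dots> \<le> (\<integral>t. (poly (monom 1 k) t)\<^sup>2 \<partial>\<mu>)"
    proof (rule integral_mono)
      show "integrable \<mu> (\<lambda>t. (b\<^sup>2) ^ k * indicator A t)" using A by simp
      show "(b\<^sup>2) ^ k * indicator A t \<le> (poly (monom 1 k) t)\<^sup>2" for t
      proof (cases "t \<in> A")
        case True
        then have "b\<^sup>2 \<le> \<bar>t\<bar>\<^sup>2" using b by (intro power_mono) (auto simp: A_def)
        then have "b\<^sup>2 \<le> t\<^sup>2" by simp
        then have "(b\<^sup>2) ^ k \<le> (t\<^sup>2) ^ k" by (rule power_mono) simp
        then show ?thesis using True by (simp add: poly_monom power_mult[symmetric] mult.commute)
      qed simp
    qed (rule integrable_poly_sq)
    also have "\<dots> = N2 (calc (monom 1 k))" by (rule N2_calc[symmetric])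
    also have "\<dots> \<le> C ^ k * N2 \<psi>" using mon by blast
    finally show ?thesis using b by (simp add: field_simps power_divide)
  qed
  have "b * 1 \<le> b * b" using b by (intro mult_left_mono) auto
  then have "C < b * b" by (simp add: b_def)
  then have "\<bar>C / b\<^sup>2\<bar> < 1" using b C by (simp add: power2_eq_square)
  then have "(\<lambda>k. (C / b\<^sup>2) ^ k * N2 \<psi>) \<longlonglongrightarrow> 0 * N2 \<psi>"
    by (intro tendsto_intros LIMSEQ_power_zero) simp
  then have "measure \<mu> A \<le> 0 * N2 \<psi>" using bound by (intro LIMSEQ_le_const) auto
  then have "measure \<mu> A = 0" using measure_nonneg[of \<mu> A] by simp
  then have "emeasure \<mu> A = 0" by (simp add: emeasure_eq_measure)
  then have "AE t in \<mu>. t \<notin> A" using A by (intro AE_not_in) auto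
  then show ?thesis using b by (intro exI[of _ b]) (auto simp: A_def not_less)
qed

text \<open>The polynomials \<open>q\<^sup>j\<close> are at least 1 close to \<open>t0\<close> and decay geometrically at distance
  \<open>sqrt r\<close> or more, so mass near \<open>t0\<close> would make \<open>calc (q\<^sup>j)\<close> violate the lower bound.\<close>

lemma locally_null:
  assumes bdd: "\<And>f. f \<in> ell2 \<Longrightarrow> N2 f \<le> C * N2 (shifted V (complex_of_real t0) f)"
  shows "\<exists>e>0. emeasure \<mu> {t. \<bar>t - t0\<bar> < e} = 0"
proof -
  obtain b where b: "b \<ge> 1" "AE t in \<mu>. \<bar>t\<bar> \<le> b" using support_bounded by blast
  define M where "M = (b + \<bar>t0\<bar>)\<^sup>2"
  have M: "M \<ge> 1" using b by (simp add: M_def one_le_power)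
  have aeM: "AE t in \<mu>. (t - t0)\<^sup>2 \<le> M"
    using b(2)
  proof eventually_elim
    case (elim t)
    then have "\<bar>t - t0\<bar>\<^sup>2 \<le> (b + \<bar>t0\<bar>)\<^sup>2" by (intro power_mono) auto
    then show ?case by (simp add: M_def)
  qed
  \<comment> \<open>Keeps \<open>D\<close> positive and \<open>r = 1 / D\<close> at most 1, hence
    \<open>s < M\<close>.\<close>
  define D where "D = max C 1"
  have D: "D \<ge> 1" by (simp add: D_def)
  have bddD: "N2 f \<le> D * N2 (shifted V (complex_of_real t0) f)" if "f \<in> ell2" for f
  proof -
    have "shifted V (complex_of_real t0) f \<in> ell2"
      by (rule bdd_op_ell2[OF bdd_op_shifted[OF V_le] that])
    then have "C * N2 (shifted V (complex_of_real t0) f) \<le> D * N2 (shifted V (complex_of_real t0) f)"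
      by (intro mult_right_mono N2_nonneg) (auto simp: D_def)
    then show ?thesis using bdd[OF that] by linarith
  qed
  define r s where "r = 1 / D" and "s = r / 2"
  have "0 < r" "r \<le> 1" using D by (auto simp: r_def)
  then have rs: "0 < s" "s < r" "r \<le> 1" "s < M" using M by (auto simp: s_def)
  \<comment> \<open>Scaled to be 1 where \<open>(t - t0) ^ 2 = s\<close>, so that \<open>q\<close>
    is at least 1 on \<open>A\<close>. On the support, \<open>q ^ 2\<close> is at most
    \<open>k\<close> once \<open>(t - t0) ^ 2\<close> reaches \<open>r\<close>.\<close>
  define q where "q = smult (1 / (M - s)) ([:M:] - [:-t0, 1:] * [:-t0, 1:])"
  have q: "poly q t = (M - (t - t0)\<^sup>2) / (M - s)" for t
    by (simp add: q_def power2_eq_square algebra_simps diff_divide_distrib add_divide_distrib)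
  define A where "A = {t. (t - t0)\<^sup>2 < s}"
  have A: "A \<in> sets \<mu>" unfolding sets_mu A_def by measurable
  define k where "k = ((M - r) / (M - s))\<^sup>2"
  have k: "0 \<le> k" "k < 1"
  proof -
    have "(M - r) / (M - s) < 1" "0 \<le> (M - r) / (M - s)" using rs M by auto
    then show "0 \<le> k" "k < 1" by (auto simp: k_def power_less_one_iff)
  qed
  \<comment> \<open>The function \<open>((t - t0) ^ 2 - r) * q ^ (2 * j)\<close> has nonnegative
    integral by the lower bound. It is at most \<open>-(r - s)\<close> on \<open>A\<close>, at most
    0 up to distance \<open>sqrt r\<close>, and at most \<open>k ^ j * M\<close> on the rest of the
    support.\<close>
  have key: "(r - s) * measure \<mu> A \<le> k ^ j * (M * measure \<mu> UNIV)" for j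
  proof -
    have "(\<integral>t. (poly (q ^ j) t)\<^sup>2 \<partial>\<mu>) \<le> D * (\<integral>t. (poly ([:-t0, 1:] * q ^ j) t)\<^sup>2 \<partial>\<mu>)"
      using bddD[OF calc_ell2[of "q ^ j"]] unfolding calc_shifted N2_calc .
    then have "r * (\<integral>t. (poly (q ^ j) t)\<^sup>2 \<partial>\<mu>) \<le> (\<integral>t. (poly ([:-t0, 1:] * q ^ j) t)\<^sup>2 \<partial>\<mu>)"
      using D by (simp add: r_def field_simps)
    then have "0 \<le> (\<integral>t. (poly ([:-t0, 1:] * q ^ j) t)\<^sup>2 - r * (poly (q ^ j) t)\<^sup>2 \<partial>\<mu>)"
      using integrable_poly_sq[of "[:-t0, 1:] * q ^ j"] integrable_poly_sq[of "q ^ j"]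
      by (subst Bochner_Integration.integral_diff) auto
    also have "\<dots> \<le> (\<integral>t. k ^ j * M - (r - s) * indicator A t \<partial>\<mu>)"
    proof (rule integral_mono_AE)
      show "integrable \<mu> (\<lambda>t. (poly ([:-t0, 1:] * q ^ j) t)\<^sup>2 - r * (poly (q ^ j) t)\<^sup>2)"
        using integrable_poly_sq[of "[:-t0, 1:] * q ^ j"] integrable_poly_sq[of "q ^ j"]
        by (intro Bochner_Integration.integrable_diff) auto
      show "integrable \<mu> (\<lambda>t. k ^ j * M - (r - s) * indicator A t)" using A by simp
      show "AE t in \<mu>. (poly ([:-t0, 1:] * q ^ j) t)\<^sup>2 - r * (poly (q ^ j) t)\<^sup>2
          \<le> k ^ j * M - (r - s) * indicator A t"
        using aeM
      proof eventually_elim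
        case (elim t)
        define x y where "x = (t - t0)\<^sup>2" and "y = ((poly q t)\<^sup>2) ^ j"
        have x: "0 \<le> x" "x \<le> M" using elim by (auto simp: x_def)
        have y: "0 \<le> y" by (simp add: y_def)
        have pq: "poly q t = (M - x) / (M - s)" by (simp add: q x_def)
        have kM: "0 \<le> k ^ j * M" using k M by simp
        have "(poly ([:-t0, 1:] * q ^ j) t)\<^sup>2 - r * (poly (q ^ j) t)\<^sup>2 = (x - r) * y"
          unfolding poly_linear_mult_power_sq by (simp add: x_def y_def poly_power left_diff_distrib power_mult[symmetric] mult.commute)
        also have "\<dots> \<le> k ^ j * M - (r - s) * indicator A t"
        proof (cases "x < s")
          case True
          then have "1 \<le> poly q t" unfolding pq using rs by simp
          then have "1 \<le> y" unfolding y_def by (intro one_le_power) auto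
          then have "(r - x) * 1 \<le> (r - x) * y" using True rs by (intro mult_left_mono) auto
          moreover have "t \<in> A" using True by (simp add: A_def x_def)
          moreover have "(x - r) * y = - ((r - x) * y)" by (simp add: algebra_simps)
          ultimately show ?thesis using True kM by (simp add: x_def)
        next
          case False
          then have tA: "t \<notin> A" by (simp add: A_def x_def)
          show ?thesis
          proof (cases "x < r")
            case True
            then have "(x - r) * y \<le> 0" using y by (intro mult_nonpos_nonneg) auto
            then show ?thesis using tA kM by simp
          next
            case False
            have "(poly q t)\<^sup>2 \<le> k" unfolding pq k_def
              using False x rs by (intro power_mono divide_right_mono) auto
            then have "y \<le> k ^ j" unfolding y_def by (intro power_mono) auto
            moreover have "x - r \<le> M" using x rs by simp
            ultimately have "(x - r) * y \<le> M * k ^ j" using y M by (intro mult_mono) auto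
            then show ?thesis using tA by (simp add: mult.commute)
          qed
        qed
        finally show ?case .
      qed
    qed
    also have "\<dots> = k ^ j * M * measure \<mu> UNIV - (r - s) * measure \<mu> A"
      using A by (subst Bochner_Integration.integral_diff) auto
    finally show ?thesis by (simp add: mult_ac)
  qed
  have "(\<lambda>j. k ^ j * (M * measure \<mu> UNIV)) \<longlonglongrightarrow> 0 * (M * measure \<mu> UNIV)"
    using k by (intro tendsto_intros LIMSEQ_power_zero) simp
  then have "(r - s) * measure \<mu> A \<le> 0 * (M * measure \<mu> UNIV)"
    using key by (intro LIMSEQ_le_const) auto
  then have "measure \<mu> A = 0"
    using rs measure_nonneg[of \<mu> A] by (simp add: mult_le_0_iff)
  then have "emeasure \<mu> A = 0" by (simp add: emeasure_eq_measure)
  moreover have "A = {t. \<bar>t - t0\<bar> < sqrt s}"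
  proof -
    have "(t - t0)\<^sup>2 < s \<longleftrightarrow> \<bar>t - t0\<bar> < sqrt s" for t
      using real_sqrt_less_iff[of "(t - t0)\<^sup>2" s] by simp
    then show ?thesis by (simp add: A_def)
  qed
  ultimately show ?thesis using rs by (intro exI[of _ "sqrt s"]) auto
qed

text \<open>The polynomials \<open>q\<^sup>j\<close> converge to the indicator of \<open>t0\<close> on the support of \<open>\<mu>\<close>, so \<open>calc (q\<^sup>j)\<close> would
  have an eigenvector as a weak limit point if \<open>t0\<close> were an atom.\<close>

lemma no_atom:
  assumes no_ev: "\<And>u. u \<in> ell2 \<Longrightarrow> (\<And>x. shifted V (complex_of_real t0) u x = 0) \<Longrightarrow> u = (\<lambda>x. 0)"
  shows "emeasure \<mu> {t0} = 0"
proof -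
  obtain b where b: "b \<ge> 1" "AE t in \<mu>. \<bar>t\<bar> \<le> b" using support_bounded by blast
  define M where "M = (b + \<bar>t0\<bar>)\<^sup>2"
  have M: "M \<ge> 1" using b by (simp add: M_def one_le_power)
  have aeM: "AE t in \<mu>. (t - t0)\<^sup>2 \<le> M"
    using b(2)
  proof eventually_elim
    case (elim t)
    then have "\<bar>t - t0\<bar>\<^sup>2 \<le> (b + \<bar>t0\<bar>)\<^sup>2" by (intro power_mono) auto
    then show ?case by (simp add: M_def)
  qed
  define q where "q = smult (1 / M) ([:M:] - [:-t0, 1:] * [:-t0, 1:])"
  have q: "poly q t = 1 - (t - t0)\<^sup>2 / M" for t
    using M by (simp add: q_def power2_eq_square field_simps)
  have aeq: "AE t in \<mu>. 0 \<le> poly q t \<and> poly q t \<le> 1"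
    using aeM by eventually_elim (use M in \<open>auto simp: q\<close>)
  define u where "u j = calc (q ^ j)" for j
  define T where "T = measure \<mu> UNIV"
  have u_N2: "N2 (u j) \<le> T" for j
  proof -
    have "N2 (u j) = (\<integral>t. (poly (q ^ j) t)\<^sup>2 \<partial>\<mu>)" by (simp only: u_def N2_calc)
    also have "\<dots> \<le> (\<integral>t. 1 \<partial>\<mu>)"
    proof (intro integral_mono_AE integrable_poly_sq)
      show "AE t in \<mu>. (poly (q ^ j) t)\<^sup>2 \<le> 1"
        using aeq by eventually_elim (auto simp: poly_power intro!: power_le_one)
    qed simp
    finally show ?thesis by (simp add: T_def)
  qed
  have u_shift: "N2 (shifted V (complex_of_real t0) (u j)) \<le> M * T / (2 * real j)" if j: "j > 0" for j
  proof -
    have "N2 (shifted V (complex_of_real t0) (u j)) = (\<integral>t. (poly ([:-t0, 1:] * q ^ j) t)\<^sup>2 \<partial>\<mu>)"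
      by (simp only: u_def calc_shifted N2_calc)
    also have "\<dots> \<le> (\<integral>t. M / (2 * real j) \<partial>\<mu>)"
    proof (intro integral_mono_AE integrable_poly_sq)
      show "AE t in \<mu>. (poly ([:-t0, 1:] * q ^ j) t)\<^sup>2 \<le> M / (2 * real j)"
        using aeM
      proof eventually_elim
        case (elim t)
        define y where "y = (t - t0)\<^sup>2 / M"
        have y: "0 \<le> y" "y \<le> 1" using elim M by (auto simp: y_def)
        \<comment> \<open>Multiplying by \<open>(1 - y) ^ (2 * j)\<close> makes the right side a
          power of \<open>1 - y ^ 2\<close>, at most 1. This bounds
          \<open>y * (1 - y) ^ (2 * j)\<close> by \<open>1 / (2 * j)\<close> uniformly in
          \<open>y\<close>.\<close>
        have "1 + real (2 * j) * y \<le> (1 + y) ^ (2 * j)" using y by (intro Bernoulli_inequality) simp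
        then have "(1 + real (2 * j) * y) * (1 - y) ^ (2 * j) \<le> (1 + y) ^ (2 * j) * (1 - y) ^ (2 * j)"
          using y by (intro mult_right_mono) auto
        also have "\<dots> = (1 - y\<^sup>2) ^ (2 * j)"
          by (simp add: power_mult_distrib[symmetric] power2_eq_square algebra_simps)
        also have "\<dots> \<le> 1" using y by (intro power_le_one) (auto simp: power_le_one)
        finally have "real (2 * j) * y * (1 - y) ^ (2 * j) \<le> 1"
          using zero_le_power[of "1 - y" "2 * j"] y(2) unfolding distrib_right by linarith
        then have *: "y * (1 - y) ^ (2 * j) \<le> 1 / (2 * real j)" using j by (simp add: field_simps)
        have "(poly ([:-t0, 1:] * q ^ j) t)\<^sup>2 = (t - t0)\<^sup>2 * (1 - y) ^ (2 * j)"
          unfolding poly_linear_mult_power_sq by (simp add: q y_def power_mult)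
        also have "\<dots> = M * (y * (1 - y) ^ (2 * j))" using M by (simp add: y_def)
        also have "\<dots> \<le> M * (1 / (2 * real j))" using * M by (intro mult_left_mono) auto
        finally show ?case by simp
      qed
    qed simp
    finally show ?thesis by (simp add: T_def mult_ac)
  qed
  have sh_lim: "(\<lambda>j. shifted V (complex_of_real t0) (u j) x) \<longlonglongrightarrow> 0" for x
  proof -
    have "(\<lambda>j. (cmod (shifted V (complex_of_real t0) (u j) x))\<^sup>2) \<longlonglongrightarrow> 0"
    proof (rule tendsto_sandwich[where f = "\<lambda>j. 0" and h = "\<lambda>j. M * T / (2 * real j) / \<pi> x"])
      show "\<forall>\<^sub>F j in sequentially. (cmod (shifted V (complex_of_real t0) (u j) x))\<^sup>2 \<le> M * T / (2 * real j) / \<pi> x"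
      proof (rule eventually_sequentiallyI[of 1])
        fix j :: nat assume "1 \<le> j"
        then have "(cmod (shifted V (complex_of_real t0) (u j) x))\<^sup>2 * \<pi> x \<le> M * T / (2 * real j)"
          using N2_point[of "shifted V (complex_of_real t0) (u j)" x] u_shift[of j]
          by (simp add: u_def calc_shifted)
        then show "(cmod (shifted V (complex_of_real t0) (u j) x))\<^sup>2 \<le> M * T / (2 * real j) / \<pi> x"
          by (subst pos_le_divide_eq[OF weight_pos])
      qed
      show "(\<lambda>j. M * T / (2 * real j) / \<pi> x) \<longlonglongrightarrow> 0"
        using lim_const_over_n[of "M * T / 2 / \<pi> x"] by (simp add: mult_ac)
    qed auto
    then have "(\<lambda>j. sqrt ((cmod (shifted V (complex_of_real t0) (u j) x))\<^sup>2)) \<longlonglongrightarrow> sqrt 0"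
      by (rule tendsto_real_sqrt)
    then show ?thesis by (simp add: tendsto_norm_zero_iff)
  qed
  have "bounded (range (\<lambda>j. u j 0))"
  proof (rule boundedI)
    fix y assume "y \<in> range (\<lambda>j. u j 0)"
    then obtain j where y: "y = u j 0" by auto
    have "(cmod (u j 0))\<^sup>2 * \<pi> 0 \<le> T"
      using N2_point[of "u j" 0] u_N2[of j] by (simp add: u_def)
    then have "(cmod (u j 0))\<^sup>2 \<le> T / \<pi> 0" using weight_pos[of 0] by (simp add: field_simps)
    then show "norm y \<le> sqrt (T / \<pi> 0)" unfolding y by (rule real_le_rsqrt)
  qed
  \<comment> \<open>Convergence at 0 is enough: since the right sides of the recurrence tend to 0
    pointwise, it propagates to every other point.\<close>
  then obtain c r where r: "strict_mono r" and c: "(\<lambda>j. u (r j) 0) \<longlonglongrightarrow> c"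
    using bounded_imp_convergent_subsequence[of "\<lambda>j. u j 0"] by (auto simp: o_def)
  have sh_r: "(\<lambda>j. shifted V (complex_of_real t0) (u (r j)) x) \<longlonglongrightarrow> 0" for x
    using LIMSEQ_subseq_LIMSEQ[OF sh_lim r] by (simp add: o_def)
  \<comment> \<open>The second initial value encodes the equation at 0, which \<open>sol\<close>
    does not impose.\<close>
  define v where "v = sol V (complex_of_real t0) c ((complex_of_real (V 0) - complex_of_real t0) * c) (\<lambda>x. 0)"
  have "(\<lambda>j. u (r j) x) \<longlonglongrightarrow> v x \<and> (\<lambda>j. u (r j) (Suc x)) \<longlonglongrightarrow> v (Suc x)" for x
  proof (induction x)
    case 0
    have e: "u (r j) (Suc 0) = (complex_of_real (V 0) - complex_of_real t0) * u (r j) 0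
        - shifted V (complex_of_real t0) (u (r j)) 0" for j
      by (simp add: shifted_eq)
    have "(\<lambda>j. u (r j) (Suc 0)) \<longlonglongrightarrow> (complex_of_real (V 0) - complex_of_real t0) * c - 0"
      unfolding e by (intro tendsto_intros c sh_r)
    then show ?case using c by (simp add: v_def)
  next
    case (Suc x)
    have e: "u (r j) (Suc (Suc x)) = ((complex_of_real (V (Suc x)) - complex_of_real t0) * u (r j) (Suc x)
        - complex_of_real (down (Suc x)) * u (r j) x - shifted V (complex_of_real t0) (u (r j)) (Suc x))
        / complex_of_real (up (Suc x))" for j
      by (simp add: shifted_eq)
    have "(\<lambda>j. u (r j) (Suc (Suc x))) \<longlonglongrightarrow> ((complex_of_real (V (Suc x)) - complex_of_real t0) * v (Suc x)
        - complex_of_real (down (Suc x)) * v x - 0) / complex_of_real (up (Suc x))"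
      unfolding e using Suc by (intro tendsto_intros sh_r) auto
    then show ?case using Suc by (simp add: v_def)
  qed
  then have lim: "(\<lambda>j. u (r j) x) \<longlonglongrightarrow> v x" for x by blast
  have ur: "u (r j) \<in> ell2" for j by (simp add: u_def)
  have "v = (\<lambda>x. 0)"
  proof (rule no_ev)
    show "v \<in> ell2" by (rule ell2_limit(1)[OF ur u_N2 lim])
    show "shifted V (complex_of_real t0) v x = 0" for x
      by (cases "x = 0") (auto simp: v_def shifted_sol, simp add: shifted_eq)
  qed
  then have ip_lim: "(\<lambda>j. ip \<psi> (u (r j))) \<longlonglongrightarrow> 0"
    using lim by (intro ip_weak_limit[OF \<psi> ur u_N2]) auto
  \<comment> \<open>The polynomial \<open>q ^ j\<close> is 1 at \<open>t0\<close> and nonnegative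
    almost everywhere, so it dominates the indicator.\<close>
  have le: "measure \<mu> {t0} \<le> cmod (ip \<psi> (u j))" for j
  proof -
    have "measure \<mu> {t0} = (\<integral>t. indicator {t0} t \<partial>\<mu>)" by simp
    also have "\<dots> \<le> (\<integral>t. poly (q ^ j) t \<partial>\<mu>)"
    proof (rule integral_mono_AE)
      show "AE t in \<mu>. indicator {t0} t \<le> poly (q ^ j) t"
        using aeq by eventually_elim (auto simp: indicator_def poly_power q)
    qed (rule integrable_ind, simp, rule integrable_poly)
    also have "\<dots> \<le> cmod (ip \<psi> (u j))" by (simp add: u_def ip_psi_calc)
    finally show ?thesis .
  qed
  have "measure \<mu> {t0} \<le> 0"
    by (rule LIMSEQ_le_const[OF tendsto_norm_zero[OF ip_lim]]) (use le in blast)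
  then show ?thesis using measure_nonneg[of \<mu> "{t0}"] by (simp add: emeasure_eq_measure)
qed

text \<open>Each real point outside the spectrum has a null neighbourhood by
  \<open>locally_null\<close>, and the Lindelof property makes the union of all null open sets null.
  Its complement is closed, so no measurability of the spectrum itself has to be shown.\<close>

lemma carried_by_spectrum:
  "\<exists>N\<in>sets borel. N \<subseteq> {t. complex_of_real t \<in> op_spectrum \<pi> (jacobi_op p V)} \<and> emeasure \<mu> (UNIV - N) = 0"
proof -
  define F where "F = {U. open U \<and> emeasure \<mu> U = 0}"
  obtain F' where F': "F' \<subseteq> F" "countable F'" "\<Union>F' = \<Union>F"
    using Lindelof[of F] by (auto simp: F_def)
  have "(\<Union>U\<in>F'. U) \<in> null_sets \<mu>"
    using F' by (intro null_sets_UN') (auto simp: F_def null_sets_def)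
  then have null: "emeasure \<mu> (\<Union>F) = 0" using F'(3) by (auto simp: null_sets_def)
  have op: "open (\<Union>F)" by (auto simp: F_def)
  have "t0 \<in> \<Union>F" if t0: "complex_of_real t0 \<notin> op_spectrum \<pi> (jacobi_op p V)" for t0
  proof -
    obtain G where G: "bdd_op G" "\<forall>f\<in>ell2. G (shifted V (complex_of_real t0) f) = f"
      using t0 unfolding op_spectrum_def mem_Collect_eq not_not resolvent_iff by blast
    then obtain C where C: "\<forall>f\<in>ell2. N2 (G f) \<le> C * N2 f" by (auto simp: bdd_op_def)
    have "N2 f \<le> C * N2 (shifted V (complex_of_real t0) f)" if "f \<in> ell2" for f
    proof -
      have "shifted V (complex_of_real t0) f \<in> ell2"
        by (rule bdd_op_ell2[OF bdd_op_shifted[OF V_le] that])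
      then have "N2 (G (shifted V (complex_of_real t0) f)) \<le> C * N2 (shifted V (complex_of_real t0) f)"
        using C by blast
      then show ?thesis using G(2) that by simp
    qed
    from locally_null[OF this] obtain e where e: "e > 0" "emeasure \<mu> {t. \<bar>t - t0\<bar> < e} = 0" by blast
    have "{t. \<bar>t - t0\<bar> < e} = ball t0 e" by (auto simp: dist_real_def)
    then have "ball t0 e \<in> F" using e by (simp add: F_def)
    then show ?thesis using e centre_in_ball by blast
  qed
  then show ?thesis using null op
    by (intro bexI[of _ "UNIV - \<Union>F"]) (auto simp: double_diff)
qed

end

section \<open>Singular continuity of the block operator\<close>

context ss_block
begin

theorem purely_singular_continuous:
  assumes "p \<noteq> 1 / 2"
  shows "purely_sc_spectrum \<pi> (jacobi_op p V)"
  unfolding purely_sc_spectrum_def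
proof (intro ballI allI impI conjI)
  fix \<psi> \<mu> assume \<psi>: "\<psi> \<in> ell2" and \<mu>: "is_spectral_measure \<pi> (jacobi_op p V) \<psi> \<mu>"
  obtain B where B: "\<And>x. \<bar>V x\<bar> \<le> B" using V_bounded by blast
  interpret M: spectral_measure_of p \<pi> V B \<psi> \<mu> by unfold_locales (fact B \<psi> \<mu>)+
  show "emeasure \<mu> {t} = 0" for t by (rule M.no_atom) (rule no_eigenvector)
  obtain N where N: "N \<in> sets borel" "N \<subseteq> {t. complex_of_real t \<in> op_spectrum \<pi> (jacobi_op p V)}"
    "emeasure \<mu> (UNIV - N) = 0" using M.carried_by_spectrum by blast
  have "negligible N" using spectrum_null[OF assms] N(2) by (rule negligible_subset)
  then have "N \<in> null_sets lebesgue" by (simp add: negligible_iff_null_sets)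
  then have "N \<in> null_sets lborel" using N(1) by (simp add: null_sets_completion_iff)
  then show "\<exists>N\<in>sets borel. emeasure lborel N = 0 \<and> emeasure \<mu> (UNIV - N) = 0"
    using N by auto
qed

end

theorem theorem3p8:
  fixes p \<beta> :: real and n k :: nat and \<pi> :: "nat \<Rightarrow> real"
  assumes "0 < p" and "p < 1" and "n \<ge> 1" and "1 \<le> k" and "k < 3 ^ n"
    and "\<forall>x. \<pi> x > 0"
    and "\<forall>x y. \<pi> x * trans_prob p x y = \<pi> y * trans_prob p y x"
  shows "(\<exists>R :: complex poly. degree R = 3 ^ n \<and>
            op_spectrum \<pi> (ss_amo p \<beta> (real k / 3 ^ n) 0)
              = {z. poly R z \<in> op_spectrum \<pi> (ss_laplacian p)})
         \<and> (p \<noteq> 1 / 2 \<longrightarrow> purely_sc_spectrum \<pi> (ss_amo p \<beta> (real k / 3 ^ n) 0))"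
proof -
  \<comment> \<open>The summand 0 is the phase, kept so that the unfolded \<open>ss_amo\<close>
    matches literally.\<close>
  define V where "V x = \<beta> * cos (2 * pi * (real k / 3 ^ n) * real x + 0)" for x
  have cos_shift: "cos (2 * pi * real m + a) = cos a" "cos (2 * pi * real m - a) = cos a" for m a
    using cos_int_2pin[of "int m"] sin_int_2pin[of "int m"] by (simp_all add: cos_add cos_diff)
  interpret ss_block p \<pi> V n
  proof
    fix q j
    have "2 * pi * (real k / 3 ^ n) * real (3 ^ n * q + j)
        = 2 * pi * real (k * q) + 2 * pi * (real k / 3 ^ n) * real j"
      by (simp add: field_simps)
    then show "V (3 ^ n * q + j) = V j" by (simp only: V_def add_0_right cos_shift)
  next
    \<comment> \<open>Here the phase 0 enters: reflection of the block negates the angle up to full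
      turns, and the cosine is even.\<close>
    fix j :: nat assume "j \<le> 3 ^ n"
    then have "2 * pi * (real k / 3 ^ n) * real (3 ^ n - j)
        = 2 * pi * real k - 2 * pi * (real k / 3 ^ n) * real j"
      by (simp add: field_simps of_nat_diff)
    then show "V (3 ^ n - j) = V j" by (simp only: V_def add_0_right cos_shift)
  qed (use assms in auto)
  have H: "ss_amo p \<beta> (real k / 3 ^ n) 0 = jacobi_op p V"
    by (simp add: ss_amo_def V_def[abs_def])
  have "degree (Rpoly :: complex poly) = 3 ^ n" by (rule degree_Rpoly)
  moreover have "op_spectrum \<pi> (jacobi_op p V) = {z. poly Rpoly z \<in> op_spectrum \<pi> (ss_laplacian p)}"
    unfolding poly_Rpoly ss_laplacian_def by (rule spectral_decimation)
  ultimately show ?thesis unfolding H using purely_singular_continuous by blast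
qed

end
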